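(* Let $(S,\mathcal{T})$ be a triangulated connected closed surface with vertex set $V$, $|V|=N$, edge set $E$, face set $F$, and with a weight $I:E\to(1,+\infty)$. Let $\overline{K}:V\to(-\infty,2\pi)$ be a given function satisfying the discrete Gauss-Bonnet formula $\sum_{i=1}^N\overline{K}_i=2\pi\chi(S)$, and let $s\in\mathbb{R}$ be a constant. (i) If the solution $u(t)$ of the combinatorial Calabi flow $$\frac{du}{dt}=\Delta_{\mathcal{T}}(K-\overline{K}),\qquad u(0)=u_0,$$ or of the $2s$-th order fractional combinatorial Calabi flow $$\frac{du}{dt}=\Delta^s_{\mathcal{T}}(K-\overline{K}),\qquad u(0)=u_0,$$ converges, then there exists a discrete conformal factor on $(S,\mathcal{T},I)$ with combinatorial curvature $\overline{K}$. (ii) If there exists a discrete conformal factor $\overline{u}$ with combinatorial curvature $\overline{K}$ on $(S,\mathcal{T},I)$, then there exists a constant $\delta>0$ such that, if the initial value $u(0)$ satisfies $\|u(0)-\overline{u}\|<\delta$ and $\sum_{i=1}^N u_i(0)=\sum_{i=1}^N\overline{u}_i$, then the solutions of the combinatorial Calabi flow and of the $2s$-th order fractional combinatorial Calabi flow exist for all time and converge exponentially fast to $\overline{u}$.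
   Context: $\mathcal{T}=(V,E,F)$ is a triangulation of a connected closed surface $S$; vertices are denoted $i$, edges $\{ij\}$, faces $\{ijk\}$. $\chi(S)$ is the Euler number of $S$. Inversive distance circle packings: fix a reference function $r:V\to\mathbb{R}_{>0}$. For $u\in\mathbb{R}^N$ put $\widetilde r_i=e^{u_i}r_i$ and, for each edge $\{ij\}\in E$, $$\widetilde l_{ij}=\sqrt{\widetilde r_i^2+\widetilde r_j^2+2I_{ij}\widetilde r_i\widetilde r_j}.$$ The admissible space $\Omega^{\mathcal{T}}\subseteq\mathbb{R}^N$ is the set of all $u$ such that for every face $\{ijk\}\in F$ the numbers $\widetilde l_{ij},\widetilde l_{ik},\widetilde l_{jk}$ satisfy the strict triangle inequalities. Elements $u\in\Omega^{\mathcal{T}}$ are the discrete conformal factors on $(S,\mathcal{T},I)$; each determines a piecewise Euclidean metric on $S$ by gluing Euclidean triangles with edge lengths $\widetilde l$. Combinatorial curvature: for $u\in\Omega^{\mathcal{T}}$, $K_i(u)=2\pi-\sum_{\{ijk\}\in F}\theta^i_{jk}$, the sum being over all triangles having $i$ as a vertex, where $\theta^i_{jk}$ is the inner angle at $i$ of the Euclidean triangle $\{ijk\}$ with edge lengths $\widetilde l$. A discrete conformal factor $u$ has combinatorial curvature $\overline{K}$ if $K(u)=\overline{K}$. Operators: let $L=L(u)=\left(\frac{\partial K_i}{\partial u_j}\right)_{N\times N}$. It is known that, on $\Omega^{\mathcal{T}}$, $L$ is symmetric and positive semi-definite of rank $N-1$ with kernel spanned by $(1,\dots,1)^{\mathrm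 T}$. The discrete Laplace operator is $\Delta_{\mathcal{T}}=-L$, i.e. $\Delta_{\mathcal{T}}f_i=-\sum_{j=1}^N\frac{\partial K_i}{\partial u_j}f_j$ for $f:V\to\mathbb{R}$. Writing $L=P^{\mathrm T}\operatorname{diag}\{\lambda_1,\dots,\lambda_N\}P$ with $P$ orthogonal and $\lambda_i\ge 0$ the eigenvalues, the $2s$-th order fractional discrete Laplace operator is $\Delta^s_{\mathcal{T}}=-L^s=-P^{\mathrm T}\operatorname{diag}\{\lambda_1^s,\dots,\lambda_N^s\}P$. For the zero eigenvalue, $0^s=0$ if $s\neq0$ (so that $\Delta^s_{\mathcal{T}}$ has the same kernel as $\Delta_{\mathcal{T}}$), and $\Delta^0_{\mathcal{T}}$ is minus the identity. The flows are ODE systems for $u(t)$, with $K=K(u(t))$ and the operators evaluated at $u(t)$, starting from an initial value in $\Omega^{\mathcal{T}}$.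
   Formalization: In (i), "converges" is taken to mean that u(t) converges to a limit that is itself a discrete conformal factor (a point of the admissible space); with limits on the boundary of that space allowed, (i) fails, e.g. for s = -1 on a tetrahedron. *)

theory Defs
  imports "HOL-Analysis.Analysis"
begin

definition closed_surface :: "'s topology \<Rightarrow> bool" where
  "closed_surface S \<longleftrightarrow>
     compact_space S \<and> Hausdorff_space S \<and>
     (\<forall>x\<in>topspace S. \<exists>U. openin S U \<and> x \<in> U \<and>
        subtopology S U homeomorphic_space (euclidean :: (real^2) topology))"

text \<open>
  A triangulation is a finite abstract simplicial complex. Its vertex set is the whole finite
  type \<open>'v\<close>, so \<open>N = CARD('v)\<close>; edges and faces are 2-element and 3-element sets of vertices.
\<close>

definition realization :: "'v::finite set set \<Rightarrow> (real^'v) set" where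
  "realization F = (\<Union>f\<in>F. convex hull ((\<lambda>i. axis i 1) ` f))"

definition triangulation_of :: "'s topology \<Rightarrow> 'v::finite set set \<Rightarrow> 'v set set \<Rightarrow> bool" where
  "triangulation_of S E F \<longleftrightarrow>
     (\<forall>f\<in>F. card f = 3) \<and>
     E = {e. card e = 2 \<and> (\<exists>f\<in>F. e \<subseteq> f)} \<and>
     \<Union>F = UNIV \<and>
     top_of_set (realization F) homeomorphic_space S"

definition euler_number :: "'v::finite set set \<Rightarrow> 'v set set \<Rightarrow> real" where
  "euler_number E F = real CARD('v) - real (card E) + real (card F)"

text \<open>The weight of the edge with end points \<open>i\<close> and \<open>j\<close> is \<open>I {i, j}\<close>.\<close>

definition scaled_radius :: "('v::finite \<Rightarrow> real) \<Rightarrow> real^'v \<Rightarrow> 'v \<Rightarrow> real" where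
  "scaled_radius r u i = exp (u $ i) * r i"

definition edge_length ::
  "('v::finite set \<Rightarrow> real) \<Rightarrow> ('v \<Rightarrow> real) \<Rightarrow> real^'v \<Rightarrow> 'v \<Rightarrow> 'v \<Rightarrow> real" where
  "edge_length I r u i j =
     sqrt ((scaled_radius r u i)\<^sup>2 + (scaled_radius r u j)\<^sup>2
           + 2 * I {i, j} * scaled_radius r u i * scaled_radius r u j)"

text \<open>
  The quantifiers run over all orderings of the vertices of a face, so that the single
  inequality yields all three strict triangle inequalities.
\<close>

definition admissible ::
  "'v::finite set set \<Rightarrow> ('v set \<Rightarrow> real) \<Rightarrow> ('v \<Rightarrow> real) \<Rightarrow> (real^'v) set" where
  "admissible F I r =
     {u. \<forall>i j k. {i, j, k} \<in> F \<longrightarrow>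
           edge_length I r u j k < edge_length I r u i j + edge_length I r u i k}"

text \<open>
  Inner angle of a Euclidean triangle between the sides of lengths \<open>a\<close> and \<open>b\<close>, the
  opposite side having length \<open>c\<close> (law of cosines).
\<close>

definition triangle_angle :: "real \<Rightarrow> real \<Rightarrow> real \<Rightarrow> real" where
  "triangle_angle a b c = arccos ((a\<^sup>2 + b\<^sup>2 - c\<^sup>2) / (2 * a * b))"

lemma triangle_angle_dist:
  fixes A B C :: "'a::real_inner"
  shows "triangle_angle (dist A B) (dist A C) (dist B C) =
         arccos (((B - A) \<bullet> (C - A)) / (norm (B - A) * norm (C - A)))"
proof -
  have "(dist A B)\<^sup>2 + (dist A C)\<^sup>2 - (dist B C)\<^sup>2 = 2 * ((B - A) \<bullet> (C - A))"
    by (simp add: dist_norm power2_norm_eq_inner inner_diff inner_commute algebra_simps)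
  then show ?thesis
    by (simp add: triangle_angle_def dist_norm norm_minus_commute mult.assoc)
qed

lemma triangle_angle_commute: "triangle_angle a b c = triangle_angle b a c"
  by (simp add: triangle_angle_def add.commute mult.commute mult.left_commute)

lemma edge_length_commute: "edge_length I r u i j = edge_length I r u j i"
  by (simp add: edge_length_def insert_commute algebra_simps)

text \<open>
  The angle at \<open>i\<close> in the face \<open>f\<close>; by symmetry the value does not depend on how the
  two other vertices are named.
\<close>

definition face_angle ::
  "('v::finite set \<Rightarrow> real) \<Rightarrow> ('v \<Rightarrow> real) \<Rightarrow> real^'v \<Rightarrow> 'v set \<Rightarrow> 'v \<Rightarrow> real" where
  "face_angle I r u f i =
     (THE \<theta>. \<exists>j k. f = {i, j, k} \<and>
        \<theta> = triangle_angle (edge_length I r u i j) (edge_length I r u i k) (edge_length I r u j k))"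

lemma face_angle_eq:
  assumes "card {i, j, k} = 3"
  shows "face_angle I r u {i, j, k} i =
         triangle_angle (edge_length I r u i j) (edge_length I r u i k) (edge_length I r u j k)"
  unfolding face_angle_def
proof (rule the_equality)
  fix \<theta>
  assume "\<exists>j' k'. {i, j, k} = {i, j', k'} \<and>
    \<theta> = triangle_angle (edge_length I r u i j') (edge_length I r u i k') (edge_length I r u j' k')"
  then obtain j' k' where eq: "{i, j, k} = {i, j', k'}"
    and \<theta>: "\<theta> = triangle_angle (edge_length I r u i j') (edge_length I r u i k') (edge_length I r u j' k')"
    by blast
  have "i \<noteq> j" "i \<noteq> k" "j \<noteq> k"
    using assms by (auto simp: card_insert_if split: if_splits)
  moreover have "j \<in> {i, j', k'}" "k \<in> {i, j', k'}"
    using eq by auto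
  ultimately have "j' = j \<and> k' = k \<or> j' = k \<and> k' = j"
    by auto
  then show "\<theta> = triangle_angle (edge_length I r u i j) (edge_length I r u i k) (edge_length I r u j k)"
    using \<theta> by (auto simp: edge_length_commute[of I r u k j] triangle_angle_commute)
qed blast

definition curvature ::
  "'v::finite set set \<Rightarrow> ('v set \<Rightarrow> real) \<Rightarrow> ('v \<Rightarrow> real) \<Rightarrow> real^'v \<Rightarrow> real^'v" where
  "curvature F I r u = (\<chi> i. 2 * pi - (\<Sum>f | f \<in> F \<and> i \<in> f. face_angle I r u f i))"

definition curvature_jacobian ::
  "'v::finite set set \<Rightarrow> ('v set \<Rightarrow> real) \<Rightarrow> ('v \<Rightarrow> real) \<Rightarrow> real^'v \<Rightarrow> real^'v^'v" where
  "curvature_jacobian F I r u =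
     (\<chi> i j. deriv (\<lambda>t. curvature F I r (u + t *\<^sub>R axis j 1) $ i) 0)"

definition diag_matrix :: "real^'n \<Rightarrow> real^'n^'n" where
  "diag_matrix d = (\<chi> i j. if i = j then d $ i else 0)"

text \<open>
  In Isabelle \<open>0 powr s = 0\<close> for every \<open>s\<close>, including \<open>s = 0\<close>; the zeroth power is
  therefore treated separately, so that \<open>L\<^sup>0\<close> is the identity.
\<close>

definition eigenvalue_power :: "real \<Rightarrow> real \<Rightarrow> real" where
  "eigenvalue_power x s = (if s = 0 then 1 else x powr s)"

definition is_fractional_power :: "real^'n::finite^'n \<Rightarrow> real \<Rightarrow> real^'n^'n \<Rightarrow> bool" where
  "is_fractional_power A s B \<longleftrightarrow>
     (\<exists>P lam. orthogonal_matrix P \<and> (\<forall>i. lam $ i \<ge> 0) \<and>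
        A = transpose P ** diag_matrix lam ** P \<and>
        B = transpose P ** diag_matrix (\<chi> i. eigenvalue_power (lam $ i) s) ** P)"

definition fractional_power :: "real^'n::finite^'n \<Rightarrow> real \<Rightarrow> real^'n^'n" where
  "fractional_power A s = (THE B. is_fractional_power A s B)"

lemma diag_matrix_mult_left: "(diag_matrix d ** M) $ i $ j = d $ i * M $ i $ j"
  by (simp add: matrix_matrix_mult_def diag_matrix_def if_distrib[of "\<lambda>x. x * _"] sum.delta cong: if_cong)

lemma diag_matrix_mult_right: "(M ** diag_matrix d) $ i $ j = M $ i $ j * d $ j"
  by (simp add: matrix_matrix_mult_def diag_matrix_def if_distrib[of "\<lambda>x. _ * x"] sum.delta' cong: if_cong)

lemma is_fractional_power_unique:
  assumes "is_fractional_power A s B" "is_fractional_power A s C"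
  shows "B = C"
proof -
  obtain P d where P: "orthogonal_matrix P" "A = transpose P ** diag_matrix d ** P"
      "B = transpose P ** diag_matrix (\<chi> i. eigenvalue_power (d $ i) s) ** P"
    using assms(1) unfolding is_fractional_power_def by blast
  obtain Q e where Q: "orthogonal_matrix Q" "A = transpose Q ** diag_matrix e ** Q"
      "C = transpose Q ** diag_matrix (\<chi> i. eigenvalue_power (e $ i) s) ** Q"
    using assms(2) unfolding is_fractional_power_def by blast
  define M where "M = P ** transpose Q"
  have PP: "transpose P ** P = mat 1" "P ** transpose P = mat 1"
    and QQ: "transpose Q ** Q = mat 1" "Q ** transpose Q = mat 1"
    using P(1) Q(1) by (auto simp: orthogonal_matrix_def)
  have left: "P ** (transpose P ** X ** P) ** transpose Q = X ** M" for X
    unfolding M_def using PP by (metis matrix_mul_assoc matrix_mul_lid)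
  have right: "P ** (transpose Q ** X ** Q) ** transpose Q = M ** X" for X
    unfolding M_def using QQ by (metis matrix_mul_assoc matrix_mul_rid)
  have "diag_matrix d ** M = M ** diag_matrix e"
    using left right P(2) Q(2) by metis
  then have "d $ i * M $ i $ j = M $ i $ j * e $ j" for i j
    by (metis diag_matrix_mult_left diag_matrix_mult_right)
  then have "M $ i $ j = 0 \<or> d $ i = e $ j" for i j
    by (metis mult.commute mult_left_cancel)
  then have "eigenvalue_power (d $ i) s * M $ i $ j = M $ i $ j * eigenvalue_power (e $ j) s" for i j
    by (metis mult.commute mult_zero_left)
  then have "diag_matrix (\<chi> i. eigenvalue_power (d $ i) s) ** M
           = M ** diag_matrix (\<chi> i. eigenvalue_power (e $ i) s)"
    by (simp add: vec_eq_iff diag_matrix_mult_left diag_matrix_mult_right)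
  then have "P ** B ** transpose Q = P ** C ** transpose Q"
    using left right P(3) Q(3) by metis
  then have "transpose P ** (P ** B ** transpose Q) ** Q = transpose P ** (P ** C ** transpose Q) ** Q"
    by simp
  moreover have "transpose P ** (P ** X ** transpose Q) ** Q = X" for X
    using PP QQ by (metis matrix_mul_assoc matrix_mul_lid matrix_mul_rid)
  ultimately show ?thesis
    by metis
qed

definition laplace_op ::
  "'v::finite set set \<Rightarrow> ('v set \<Rightarrow> real) \<Rightarrow> ('v \<Rightarrow> real) \<Rightarrow> real^'v \<Rightarrow> real^'v \<Rightarrow> real^'v" where
  "laplace_op F I r u f = - (curvature_jacobian F I r u *v f)"

definition fractional_laplace_op ::
  "'v::finite set set \<Rightarrow> ('v set \<Rightarrow> real) \<Rightarrow> ('v \<Rightarrow> real) \<Rightarrow> real \<Rightarrow> real^'v \<Rightarrow> real^'v \<Rightarrow> real^'v" where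
  "fractional_laplace_op F I r s u f = - (fractional_power (curvature_jacobian F I r u) s *v f)"

definition calabi_field ::
  "'v::finite set set \<Rightarrow> ('v set \<Rightarrow> real) \<Rightarrow> ('v \<Rightarrow> real) \<Rightarrow> real^'v \<Rightarrow> real^'v \<Rightarrow> real^'v" where
  "calabi_field F I r Kbar u = laplace_op F I r u (curvature F I r u - Kbar)"

definition fractional_calabi_field ::
  "'v::finite set set \<Rightarrow> ('v set \<Rightarrow> real) \<Rightarrow> ('v \<Rightarrow> real) \<Rightarrow> real \<Rightarrow> real^'v \<Rightarrow> real^'v \<Rightarrow> real^'v" where
  "fractional_calabi_field F I r s Kbar u =
     fractional_laplace_op F I r s u (curvature F I r u - Kbar)"

text \<open>
  A solution of \<open>u' = X u\<close>, \<open>u 0 = u0\<close> on a time interval \<open>J\<close> with left end point \<open>0\<close>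
  (one-sided derivative at \<open>0\<close>) that stays in the domain \<open>D\<close> of the vector field.
\<close>

definition flow_solution ::
  "('a::real_normed_vector \<Rightarrow> 'a) \<Rightarrow> 'a set \<Rightarrow> real set \<Rightarrow> 'a \<Rightarrow> (real \<Rightarrow> 'a) \<Rightarrow> bool" where
  "flow_solution X D J u0 u \<longleftrightarrow>
     u 0 = u0 \<and> (\<forall>t\<in>J. u t \<in> D \<and> (u has_vector_derivative X (u t)) (at t within J))"

definition converges_exponentially :: "(real \<Rightarrow> 'a::real_normed_vector) \<Rightarrow> 'a \<Rightarrow> bool" where
  "converges_exponentially u l \<longleftrightarrow>
     (\<exists>C>0. \<exists>c>0. \<forall>t\<ge>0. norm (u t - l) \<le> C * exp (- c * t))"

text \<open>
  Long-time existence: a solution on \<open>{0..}\<close> exists, and no solution breaks down in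
  finite time, that is, every solution on some \<open>{0..<T}\<close> extends to all of \<open>{0..}\<close>.
\<close>

definition exists_for_all_time :: "('a::real_normed_vector \<Rightarrow> 'a) \<Rightarrow> 'a set \<Rightarrow> 'a \<Rightarrow> bool" where
  "exists_for_all_time X D u0 \<longleftrightarrow>
     (\<exists>u. flow_solution X D {0..} u0 u) \<and>
     (\<forall>T>0. \<forall>v. flow_solution X D {0..<T} u0 v \<longrightarrow>
        (\<exists>u. flow_solution X D {0..} u0 u \<and> (\<forall>t\<in>{0..<T}. u t = v t)))"

definition global_exponential_convergence ::
  "('a::real_normed_vector \<Rightarrow> 'a) \<Rightarrow> 'a set \<Rightarrow> 'a \<Rightarrow> 'a \<Rightarrow> bool" where
  "global_exponential_convergence X D u0 l \<longleftrightarrow>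
     exists_for_all_time X D u0 \<and>
     (\<forall>u. flow_solution X D {0..} u0 u \<longrightarrow> converges_exponentially u l)"

end

theory Submission
  imports Defs
begin

text \<open>
  In a single triangle the matrix of derivatives of the angles with respect to the conformal
  factors is symmetric with vanishing row sums, and it is negative semidefinite with kernel
  spanned by \<open>(1, 1, 1)\<close> because the power centre of the three vertex circles lies inside the
  circumcircle. Hence \<open>L\<close> is positive semidefinite with kernel the constants. The
  Gauss-Bonnet formula for \<open>K\<close> needs \<open>3 |F| = 2 |E|\<close>, which comes from invariance of domain.
  A limit of the flow is a zero of the vector field, so there \<open>K - Kbar\<close> is constant with sum zero.
  Near \<open>ubar\<close> the flow is \<open>x' = - L\<^sup>s L x + o(|x|)\<close> for \<open>x = u - ubar\<close> orthogonal to the constants,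
  so \<open>|x|\<^sup>2\<close> is a Lyapunov function which decays exponentially.
\<close>

subsection \<open>Exponential stability of equilibria\<close>

text \<open>Extension of every local solution and convergence of every global one rest on the field
  being Lipschitz near \<open>ubar\<close>, and the obstacle is \<open>L^s\<close>: for
  \<open>s < 1\<close>, \<open>s \<noteq> 0\<close>, the scalar power is not Lipschitz at 0, and 0
  is always an eigenvalue of \<open>L\<close>. The way out is that the kernel is the same line at
  every admissible point. By compactness the other eigenvalues stay, near a given point, in an
  interval \<open>{m..M}\<close> with \<open>0 < m\<close>, and on \<open>insert 0 {m..M}\<close>
  the power is Lipschitz for every real \<open>s\<close>, negative ones included. The direction of
  the constants is neutral, since scaling all radii leaves the angles unchanged; it is removed by
  the conserved sum of the coordinates of \<open>u\<close>, which is why the initial value must have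
  the same sum as \<open>ubar\<close>. The ordinary Calabi flow is treated as the case
  \<open>s = 1\<close>.\<close>

lemma has_real_derivative_inner_self:
  fixes f :: "real \<Rightarrow> 'a::real_inner"
  assumes "(f has_vector_derivative f') (at t within S)"
  shows "((\<lambda>t. f t \<bullet> f t) has_real_derivative 2 * (f t \<bullet> f')) (at t within S)"
proof -
  have "((\<lambda>t. f t \<bullet> f t) has_derivative (\<lambda>h. f t \<bullet> (h *\<^sub>R f') + (h *\<^sub>R f') \<bullet> f t)) (at t within S)"
    using assms unfolding has_vector_derivative_def by (rule has_derivative_inner) (use assms in \<open>simp add: has_vector_derivative_def\<close>)
  then show ?thesis
    unfolding has_field_derivative_def by (rule has_derivative_eq_rhs) (auto simp: inner_commute)
qed

text \<open>The integrating factor \<open>exp (- k * t)\<close> makes the product with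
  \<open>g\<close> nonincreasing.\<close>

lemma gronwall_le:
  fixes g :: "real \<Rightarrow> real"
  assumes "0 \<le> b"
    and deriv: "\<And>t. t \<in> {0..b} \<Longrightarrow> (g has_real_derivative g' t) (at t within {0..b})"
    and le: "\<And>t. t \<in> {0..b} \<Longrightarrow> g' t \<le> k * g t"
  shows "g b \<le> g 0 * exp (k * b)"
proof -
  define h where "h t = g t * exp (- k * t)" for t
  have dh: "(h has_real_derivative (g' t - k * g t) * exp (- k * t)) (at t within {0..b})"
    if "t \<in> {0..b}" for t
    unfolding h_def by (rule derivative_eq_intros deriv[OF that] refl)+ (simp add: algebra_simps)
  have "h b \<le> h 0"
  proof (rule DERIV_nonpos_imp_decreasing_open[OF \<open>0 \<le> b\<close>])
    show "continuous_on {0..b} h"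
      using dh DERIV_continuous continuous_on_eq_continuous_within by blast
    fix t assume t: "0 < t" "t < b"
    then have "(h has_real_derivative (g' t - k * g t) * exp (- k * t)) (at t)"
      using dh[of t] at_within_Icc_at[of 0 t b] by simp
    moreover have "(g' t - k * g t) * exp (- k * t) \<le> 0"
      using le[of t] t by (intro mult_nonpos_nonneg) auto
    ultimately show "\<exists>y. DERIV h t :> y \<and> y \<le> 0" by blast
  qed
  then have "g b * exp (- k * b) * exp (k * b) \<le> g 0 * exp (k * b)"
    unfolding h_def by (intro mult_right_mono) auto
  then show ?thesis by (simp add: mult.assoc flip: exp_add)
qed

text \<open>Up to the first time at which \<open>g\<close> reaches \<open>R\<close> it is
  nonincreasing, hence still at most \<open>g 0\<close>. The sign of \<open>g'\<close> is assumed
  only below the barrier because dissipation will be known only inside a ball.\<close>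

lemma barrier:
  fixes g :: "real \<Rightarrow> real"
  assumes "0 \<le> b"
    and deriv: "\<And>t. t \<in> {0..b} \<Longrightarrow> (g has_real_derivative g' t) (at t within {0..b})"
    and le: "\<And>t. t \<in> {0..b} \<Longrightarrow> g t \<le> R \<Longrightarrow> g' t \<le> 0"
    and init: "g 0 < R" and t: "t \<in> {0..b}"
  shows "g t < R"
proof (rule ccontr)
  assume not: "\<not> g t < R"
  have contg: "continuous_on {0..b} g"
    using deriv DERIV_continuous continuous_on_eq_continuous_within by blast
  define H where "H = {0..b} \<inter> g -` {R..}"
  have "closed H" unfolding H_def
    by (rule continuous_closed_preimage[OF contg]) auto
  moreover have "bounded H" unfolding H_def by (rule bounded_subset[of "{0..b}"]) auto
  ultimately have "compact H" by (simp add: compact_eq_bounded_closed)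
  moreover have "H \<noteq> {}" using not t by (auto simp: H_def)
  ultimately have "\<exists>c\<in>H. \<forall>x\<in>H. c \<le> x" by (rule compact_attains_inf)
  then obtain c where c: "c \<in> H" "\<And>x. x \<in> H \<Longrightarrow> c \<le> x" by metis
  have cb: "c \<in> {0..b}" "R \<le> g c" using c(1) by (auto simp: H_def)
  have below: "g x < R" if "x \<in> {0..<c}" for x
    using that c(2)[of x] cb by (force simp: H_def)
  have "g c \<le> g 0"
  proof (rule DERIV_nonpos_imp_decreasing_open[of 0 c g])
    show "0 \<le> c" "continuous_on {0..c} g"
      using cb contg by (auto elim: continuous_on_subset)
    fix x assume x: "0 < x" "x < c"
    then have "(g has_real_derivative g' x) (at x)"
      using deriv[of x] at_within_Icc_at[of 0 x b] cb by simp
    moreover have "g' x \<le> 0" using le[of x] below[of x] x cb by auto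
    ultimately show "\<exists>y. DERIV g x :> y \<and> y \<le> 0" by blast
  qed
  then show False using init cb by simp
qed

section \<open>Uniqueness and global existence for Lipschitz fields\<close>

lemma lipschitz_ode_unique:
  fixes Y :: "'a::real_inner \<Rightarrow> 'a"
  assumes lip: "L-lipschitz_on UNIV Y" and "0 \<le> b"
    and u: "\<And>t. t \<in> {0..b} \<Longrightarrow> (u has_vector_derivative Y (u t)) (at t within {0..b})"
    and v: "\<And>t. t \<in> {0..b} \<Longrightarrow> (v has_vector_derivative Y (v t)) (at t within {0..b})"
    and init: "u 0 = v 0"
  shows "u b = v b"
proof -
  define g where "g t = (u t - v t) \<bullet> (u t - v t)" for t
  have "g b \<le> g 0 * exp ((2 * L) * b)"
  proof (rule gronwall_le[OF \<open>0 \<le> b\<close>])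
    fix t assume t: "t \<in> {0..b}"
    show "(g has_real_derivative 2 * ((u t - v t) \<bullet> (Y (u t) - Y (v t)))) (at t within {0..b})"
      unfolding g_def by (intro has_real_derivative_inner_self has_vector_derivative_diff u v t)
    have "(u t - v t) \<bullet> (Y (u t) - Y (v t)) \<le> norm (u t - v t) * norm (Y (u t) - Y (v t))"
      by (rule norm_cauchy_schwarz)
    also have "\<dots> \<le> norm (u t - v t) * (L * norm (u t - v t))"
      using lipschitz_on_normD[OF lip] by (intro mult_left_mono) auto
    also have "\<dots> = L * g t" by (simp add: g_def power2_norm_eq_inner[symmetric] power2_eq_square)
    finally show "2 * ((u t - v t) \<bullet> (Y (u t) - Y (v t))) \<le> (2 * L) * g t" by simp
  qed
  then have "g b \<le> 0" by (simp add: g_def init)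
  then have "(u b - v b) \<bullet> (u b - v b) = 0" using inner_ge_zero[of "u b - v b"] unfolding g_def by linarith
  then show ?thesis by simp
qed

text \<open>The maximum with 0 extends the integral to negative times, so that Picard iterates
  become bounded continuous functions on the whole line.\<close>

lemma continuous_on_integral_max:
  fixes f :: "real \<Rightarrow> 'a::banach"
  assumes f: "continuous_on UNIV f"
  shows "continuous_on UNIV (\<lambda>t. integral {0..max 0 t} f)"
proof -
  have "continuous_on (\<Union>b\<in>UNIV. {..<b}) (\<lambda>t. integral {0..max 0 t} f)"
  proof (rule continuous_on_open_UN)
    fix b :: real
    have "continuous_on {0..max 0 b} (\<lambda>x. integral {0..x} f)"
      using f by (intro indefinite_integral_continuous_1 integrable_continuous_real)
        (auto elim: continuous_on_subset)
    then show "continuous_on {..<b} (\<lambda>t. integral {0..max 0 t} f)"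
      by (rule continuous_on_compose2) (auto intro!: continuous_intros)
  qed auto
  moreover have "(\<Union>b\<in>(UNIV::real set). {..<b}) = UNIV"
    by (auto intro: gt_ex)
  ultimately show ?thesis by simp
qed

text \<open>
  In the rescaled unknown \<open>w t = exp (- 2 L t) (u t - u0)\<close> the Picard operator is a
  \<open>1/2\<close>-contraction for the supremum norm on the whole half line.
\<close>

lemma lipschitz_ode_exists:
  fixes Y :: "'a::banach \<Rightarrow> 'a"
  assumes lipY: "L-lipschitz_on UNIV Y" and bdd: "\<And>x. norm (Y x) \<le> M"
  shows "\<exists>u. u 0 = u0 \<and> (\<forall>t\<ge>0. (u has_vector_derivative Y (u t)) (at t within {0..}))"
proof -
  define k where "k = max L 1"
  have k: "k > 0" and lip: "k-lipschitz_on UNIV Y"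
    using lipschitz_on_mono[OF lipY] by (auto simp: k_def)
  have contY: "continuous_on S (\<lambda>x. Y (f x))" if "continuous_on S f" for S and f :: "real \<Rightarrow> 'a"
    using continuous_on_compose2[OF lipschitz_on_continuous_on[OF lip] that] by auto
  have M: "M \<ge> 0" using bdd[of 0] norm_ge_zero order_trans by blast
  \<comment> \<open>\<open>y w\<close> is the velocity along the trajectory encoded by
    \<open>w\<close>; \<open>G w\<close> is the rescaled Picard integral, which is 0 at negative
    times.\<close>
  define y where "y w s = Y (u0 + exp (2 * k * s) *\<^sub>R w s)" for w :: "real \<Rightarrow> 'a" and s
  define G where "G w t = exp (- (2 * k * max 0 t)) *\<^sub>R integral {0..max 0 t} (y w)" for w t
  have conty: "continuous_on S (y w)" if "continuous_on UNIV w" for w S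
    unfolding y_def using that by (intro contY continuous_intros) (auto elim: continuous_on_subset)
  have inty: "y w integrable_on {a..b}" if "continuous_on UNIV w" for w a b
    using conty[OF that] by (rule integrable_continuous_real)
  have G_in: "G w \<in> bcontfun" if w: "continuous_on UNIV w" for w
  proof (rule bcontfun_normI)
    show "continuous_on UNIV (G w)" unfolding G_def
      by (intro continuous_intros continuous_on_integral_max conty w)
    fix t :: real
    define m where "m = max 0 t"
    have "norm (integral {0..m} (y w)) \<le> M * (m - 0)"
      by (rule integral_bound) (auto simp: m_def y_def bdd intro!: conty[OF w, unfolded y_def])
    then have "norm (G w t) \<le> exp (- (2 * k * m)) * (M * m)"
      unfolding G_def m_def[symmetric] by (simp add: mult_left_mono)
    also have "\<dots> = M / (2 * k) * (exp (- (2 * k * m)) * (2 * k * m))" using k by simp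
    also have "\<dots> \<le> M / (2 * k) * (exp (- (2 * k * m)) * exp (2 * k * m))"
      using k M order_trans[OF _ exp_ge_add_one_self[of "2 * k * m"], of "2 * k * m"]
      by (intro mult_left_mono) auto
    also have "\<dots> = M / (2 * k)" by (simp flip: exp_add)
    finally show "norm (G w t) \<le> M / (2 * k)" .
  qed
  define T where "T w = Bcontfun (G (apply_bcontfun w))" for w :: "real \<Rightarrow>\<^sub>C 'a"
  have T: "apply_bcontfun (T w) = G (apply_bcontfun w)" for w
    unfolding T_def by (rule Bcontfun_inverse) (auto intro: G_in)
  have "dist (T w1) (T w2) \<le> (1/2) * dist w1 w2" for w1 w2
  proof (rule dist_bound)
    fix t :: real
    define m where "m = max 0 t"
    have m: "m \<ge> 0" by (simp add: m_def)
    define d where "d = dist w1 w2"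
    \<comment> \<open>The weight grows at twice the Lipschitz rate \<open>k\<close>, so integrating
      \<open>k * exp (2 * k * s)\<close> yields only half of \<open>exp (2 * k * m)\<close>. This is
      the contraction factor 1/2.\<close>
    have I: "((\<lambda>s. k * (exp (2 * k * s) * d)) has_integral
        exp (2 * k * m) * d / 2 - exp (2 * k * 0) * d / 2) {0..m}"
      using m k by (intro fundamental_theorem_of_calculus)
        (auto intro!: derivative_eq_intros simp: has_real_derivative_iff_has_vector_derivative[symmetric])
    have "norm (integral {0..m} (\<lambda>s. y w1 s - y w2 s)) \<le> integral {0..m} (\<lambda>s. k * (exp (2 * k * s) * d))"
    proof (rule integral_norm_bound_integral)
      show "(\<lambda>s. y w1 s - y w2 s) integrable_on {0..m}" by (intro integrable_diff inty) auto
      show "(\<lambda>s. k * (exp (2 * k * s) * d)) integrable_on {0..m}" using I by blast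
      fix s
      have "norm (y w1 s - y w2 s) \<le> k * norm (exp (2 * k * s) *\<^sub>R w1 s - exp (2 * k * s) *\<^sub>R w2 s)"
        unfolding y_def using lipschitz_on_normD[OF lip, of "u0 + exp (2 * k * s) *\<^sub>R w1 s" "u0 + exp (2 * k * s) *\<^sub>R w2 s"]
        by simp
      also have "\<dots> = k * (exp (2 * k * s) * dist (w1 s) (w2 s))"
        by (simp add: dist_norm flip: scaleR_diff_right)
      also have "\<dots> \<le> k * (exp (2 * k * s) * d)"
        using k dist_bounded[of w1 s w2] by (simp add: d_def)
      finally show "norm (y w1 s - y w2 s) \<le> k * (exp (2 * k * s) * d)" .
    qed
    also have "\<dots> \<le> exp (2 * k * m) * d / 2"
      using integral_unique[OF I] by (simp add: d_def)
    finally have "norm (integral {0..m} (y w1) - integral {0..m} (y w2)) \<le> exp (2 * k * m) * d / 2"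
      by (simp add: integral_diff inty)
    then have "exp (- (2 * k * m)) * norm (integral {0..m} (y w1) - integral {0..m} (y w2))
        \<le> exp (- (2 * k * m)) * (exp (2 * k * m) * d / 2)"
      by (intro mult_left_mono) auto
    also have "\<dots> = d / 2" by (simp flip: exp_add)
    finally show "dist (T w1 t) (T w2 t) \<le> 1/2 * dist w1 w2"
      by (simp add: T G_def d_def dist_norm flip: m_def scaleR_diff_right)
  qed
  then have "\<exists>!w. T w = w" by (intro banach_fix_type[of "1/2"]) auto
  then obtain w where "T w = w" by blast
  then have w: "G (apply_bcontfun w) t = w t" for t by (metis T)
  define u where "u t = u0 + exp (2 * k * t) *\<^sub>R w t" for t
  have u: "u t = u0 + integral {0..t} (\<lambda>s. Y (u s))" if "t \<ge> 0" for t
  proof -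
    have "exp (2 * k * t) *\<^sub>R w t = integral {0..t} (y w)"
      using that by (simp add: w[symmetric] G_def flip: exp_add)
    then show ?thesis by (simp add: u_def y_def[abs_def])
  qed
  have contu: "continuous_on S (\<lambda>s. Y (u s))" for S
    unfolding u_def by (intro contY continuous_intros) auto
  have "(u has_vector_derivative Y (u t)) (at t within {0..})" if "t \<ge> 0" for t
  proof -
    \<comment> \<open>On \<open>{0..t+1}\<close> the point \<open>t\<close> is not the right end, so
      the one-sided statement for a compact interval gives the derivative within
      \<open>{0..}\<close>.\<close>
    have "((\<lambda>t. u0 + integral {0..t} (\<lambda>s. Y (u s))) has_vector_derivative 0 + Y (u t)) (at t within {0..t+1})"
      (is "(?g has_vector_derivative _) _")
      using that by (intro has_vector_derivative_add has_vector_derivative_const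
        integral_has_vector_derivative contu) auto
    then have "(u has_vector_derivative Y (u t)) (at t within {0..t+1})"
      using that u by (intro has_vector_derivative_transform[of t _ u ?g]) auto
    moreover have "at t within {0..t+1} = at t within {0..}"
      by (rule at_within_nhd[where S = "{..<t+1}"]) auto
    ultimately show ?thesis by simp
  qed
  moreover have "u 0 = u0" using u[of 0] by simp
  ultimately show ?thesis by blast
qed


text \<open>On the hyperplane through \<open>z\<close> orthogonal to \<open>w\<close>, the squared
  distance to \<open>z\<close> decays at rate \<open>2 * c\<close> inside the ball, so a trajectory
  starting there never reaches the boundary. A globally Lipschitz field that agrees with
  \<open>X\<close> on the ball therefore has the same trajectories, and its existence and uniqueness
  carry over to \<open>X\<close>.\<close>

theorem local_exponential_stability:
  fixes X :: "'a::euclidean_space \<Rightarrow> 'a"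
  assumes "0 < \<rho>" and ball: "cball z \<rho> \<subseteq> D"
    and lip: "L-lipschitz_on (cball z \<rho>) X"
    and tangent: "\<And>u. u \<in> D \<Longrightarrow> w \<bullet> X u = 0"
    and "0 < c"
    and dissip: "\<And>u. u \<in> cball z \<rho> \<Longrightarrow> w \<bullet> (u - z) = 0 \<Longrightarrow>
                    (u - z) \<bullet> X u \<le> - c * (norm (u - z))\<^sup>2"
    and u0: "norm (u0 - z) < \<rho>" "w \<bullet> (u0 - z) = 0"
  shows "global_exponential_convergence X D u0 z"
proof -
  \<comment> \<open>The nearest-point projection onto the ball is 1-Lipschitz, so the cut-off field
    keeps the constant \<open>L\<close> and is bounded.\<close>
  define Y where "Y = X \<circ> closest_point (cball z \<rho>)"
  have cp: "closest_point (cball z \<rho>) x \<in> cball z \<rho>" for x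
    using \<open>0 < \<rho>\<close> by (intro closest_point_in_set) auto
  have YX: "Y x = X x" if "x \<in> cball z \<rho>" for x
    using closest_point_self[OF that] by (simp add: Y_def)
  have lipY: "L-lipschitz_on UNIV Y"
  proof (rule lipschitz_onI)
    fix x y
    have "dist (Y x) (Y y) \<le> L * dist (closest_point (cball z \<rho>) x) (closest_point (cball z \<rho>) y)"
      unfolding Y_def o_def by (intro lipschitz_onD[OF lip] cp)
    also have "\<dots> \<le> L * dist x y"
      using \<open>0 < \<rho>\<close> lipschitz_on_nonneg[OF lip]
      by (intro mult_left_mono closest_point_lipschitz) auto
    finally show "dist (Y x) (Y y) \<le> L * dist x y" .
  qed (rule lipschitz_on_nonneg[OF lip])
  have "bounded (X ` cball z \<rho>)"
    by (intro compact_imp_bounded compact_continuous_image lipschitz_on_continuous_on[OF lip] compact_cball)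
  then obtain M where "\<And>x. x \<in> cball z \<rho> \<Longrightarrow> norm (X x) \<le> M"
    unfolding bounded_iff by blast
  then have bddY: "norm (Y x) \<le> M" for x
    using cp by (simp add: Y_def)
  have tangentY: "w \<bullet> Y x = 0" for x
    using tangent[OF subsetD[OF ball cp]] by (simp add: Y_def)
  \<comment> \<open>Stated for any \<open>Z\<close> that agrees with \<open>X\<close> on the ball,
    because it serves twice: for the cut-off field, and for \<open>X\<close> itself, whose solutions
    in \<open>D\<close> are not yet known to remain in the ball.\<close>
  have decay: "norm (u b - z) < \<rho> \<and> norm (u b - z) \<le> norm (u0 - z) * exp (- c * b)"
    if "0 \<le> b" and u: "\<And>t. t \<in> {0..b} \<Longrightarrow> (u has_vector_derivative Z (u t)) (at t within {0..b})"
      and "u 0 = u0" and ZX: "\<And>x. x \<in> cball z \<rho> \<Longrightarrow> Z x = X x"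
      and tangentZ: "\<And>t. t \<in> {0..b} \<Longrightarrow> w \<bullet> Z (u t) = 0"
    for b Z u
  proof -
    have orth: "w \<bullet> (u t - z) = 0" if t: "t \<in> {0..b}" for t
    proof -
      have "((\<lambda>t. w \<bullet> (u t - z)) has_derivative (\<lambda>h. 0)) (at s within {0..b})" if "s \<in> {0..b}" for s
      proof -
        have "((\<lambda>t. w \<bullet> (u t - z)) has_derivative (\<lambda>h. w \<bullet> (h *\<^sub>R Z (u s) - 0))) (at s within {0..b})"
          using u[OF that] unfolding has_vector_derivative_def
          by (intro has_derivative_inner_right has_derivative_diff has_derivative_const)
        then show ?thesis using tangentZ[OF that] by simp
      qed
      then have "w \<bullet> (u t - z) = w \<bullet> (u 0 - z)"
        using t \<open>0 \<le> b\<close> by (intro has_derivative_zero_unique[of "{0..b}"]) auto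
      then show ?thesis using u0 \<open>u 0 = u0\<close> by simp
    qed
    define g where "g t = (u t - z) \<bullet> (u t - z)" for t
    have g: "g t = (norm (u t - z))\<^sup>2" for t by (simp add: g_def power2_norm_eq_inner)
    have dg: "(g has_real_derivative 2 * ((u t - z) \<bullet> Z (u t))) (at t within {0..b})"
      if "t \<in> {0..b}" for t
    proof -
      have "((\<lambda>t. u t - z) has_vector_derivative Z (u t) - 0) (at t within {0..b})"
        by (intro has_vector_derivative_diff has_vector_derivative_const u that)
      then show ?thesis unfolding g_def by (intro has_real_derivative_inner_self) simp
    qed
    have le: "2 * ((u t - z) \<bullet> Z (u t)) \<le> (- 2 * c) * g t" if t: "t \<in> {0..b}" and "g t \<le> \<rho>\<^sup>2" for t
    proof -
      have "norm (u t - z) \<le> \<rho>"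
        by (rule power2_le_imp_le) (use \<open>g t \<le> \<rho>\<^sup>2\<close> \<open>0 < \<rho>\<close> in \<open>simp_all add: g\<close>)
      then have "u t \<in> cball z \<rho>" by (simp add: dist_norm norm_minus_commute)
      then show ?thesis using dissip[OF _ orth[OF t]] ZX by (simp add: g)
    qed
    have "0 \<le> g t" for t by (simp add: g)
    have lt: "g t < \<rho>\<^sup>2" if "t \<in> {0..b}" for t
    proof (rule barrier[OF \<open>0 \<le> b\<close> dg _ _ that])
      show "g 0 < \<rho>\<^sup>2" using u0 \<open>u 0 = u0\<close> by (simp add: g power_strict_mono)
      show "2 * ((u t - z) \<bullet> Z (u t)) \<le> 0" if "t \<in> {0..b}" "g t \<le> \<rho>\<^sup>2" for t
      proof -
        have "0 \<le> c * g t" using \<open>0 < c\<close> \<open>0 \<le> g t\<close> by simp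
        then show ?thesis using le[OF that] by simp
      qed
    qed
    have "g b \<le> g 0 * exp ((- 2 * c) * b)"
      by (rule gronwall_le[OF \<open>0 \<le> b\<close> dg]) (use le lt in \<open>auto simp: less_imp_le\<close>)
    also have "\<dots> = (norm (u0 - z) * exp (- c * b))\<^sup>2"
      by (simp add: g \<open>u 0 = u0\<close> power_mult_distrib flip: exp_double)
    finally have "norm (u b - z) \<le> norm (u0 - z) * exp (- c * b)"
      unfolding g by (rule power2_le_imp_le) simp
    moreover have "norm (u b - z) < \<rho>"
      by (rule power2_less_imp_less) (use lt[of b] \<open>0 \<le> b\<close> \<open>0 < \<rho>\<close> in \<open>simp_all add: g\<close>)
    ultimately show ?thesis by simp
  qed
  obtain U where U0: "U 0 = u0"
    and U: "\<And>t. 0 \<le> t \<Longrightarrow> (U has_vector_derivative Y (U t)) (at t within {0..})"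
    using lipschitz_ode_exists[OF lipY bddY, of u0] by blast
  have UI: "(U has_vector_derivative Y (U t)) (at t within {0..b})" if "t \<in> {0..b}" for t b
    by (rule has_vector_derivative_within_subset[OF U]) (use that in auto)
  have U_ball: "U t \<in> cball z \<rho>" if "0 \<le> t" for t
    using decay[OF that UI U0 YX tangentY] by (simp add: dist_norm norm_minus_commute)
  have flowU: "flow_solution X D {0..} u0 U"
    unfolding flow_solution_def using U0 U U_ball YX ball by force
  have sol: "v t \<in> cball z \<rho> \<and> norm (v t - z) \<le> norm (u0 - z) * exp (- c * t)"
    if v: "flow_solution X D J u0 v" and t: "0 \<le> t" "{0..t} \<subseteq> J" for v J t
  proof -
    have "(v has_vector_derivative X (v s)) (at s within {0..t})" if "s \<in> {0..t}" for s
      by (rule has_vector_derivative_within_subset[of _ _ _ J])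
        (use v t that in \<open>auto simp: flow_solution_def\<close>)
    moreover have "w \<bullet> X (v s) = 0" if "s \<in> {0..t}" for s
      using v t that tangent unfolding flow_solution_def by blast
    ultimately show ?thesis
      using decay[OF t(1), of v X] v by (simp add: flow_solution_def dist_norm norm_minus_commute)
  qed
  \<comment> \<open>By \<open>sol\<close> an arbitrary solution of \<open>X\<close> stays in the
    ball, so it also solves the cut-off equation, where uniqueness identifies it with
    \<open>U\<close>.\<close>
  have "v t = U t" if v: "flow_solution X D {0..<T} u0 v" and t: "t \<in> {0..<T}" for v t T
  proof (rule lipschitz_ode_unique[OF lipY])
    show "0 \<le> t" using t by simp
    show "v 0 = U 0" using v U0 by (simp add: flow_solution_def)
    fix s assume s: "s \<in> {0..t}"
    show "(U has_vector_derivative Y (U s)) (at s within {0..t})" by (rule UI[OF s])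
    have "{0..s} \<subseteq> {0..<T}" using s t by auto
    then have Yv: "Y (v s) = X (v s)" using sol[OF v, of s] s by (intro YX) simp
    show "(v has_vector_derivative Y (v s)) (at s within {0..t})"
      by (rule has_vector_derivative_within_subset[of v "Y (v s)" s "{0..<T}"])
        (use v t s Yv in \<open>auto simp: flow_solution_def\<close>)
  qed
  then have ex: "exists_for_all_time X D u0"
    unfolding exists_for_all_time_def using flowU by metis
  have "converges_exponentially v z" if v: "flow_solution X D {0..} u0 v" for v
  proof -
    have "norm (v t - z) \<le> \<rho> * exp (- c * t)" if "0 \<le> t" for t
    proof -
      have "norm (v t - z) \<le> norm (u0 - z) * exp (- c * t)" using sol[OF v, of t] that by auto
      also have "\<dots> \<le> \<rho> * exp (- c * t)" using u0 by (intro mult_right_mono) auto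
      finally show ?thesis .
    qed
    then show ?thesis unfolding converges_exponentially_def using \<open>0 < \<rho>\<close> \<open>0 < c\<close> by blast
  qed
  with ex show ?thesis unfolding global_exponential_convergence_def by blast
qed

text \<open>If \<open>a = X l\<close> were nonzero, the velocity component along \<open>a\<close>
  would eventually exceed half of \<open>a \<bullet> a\<close>, while the displacement over unit
  time tends to 0.\<close>

lemma flow_limit_stationary:
  fixes X :: "'a::euclidean_space \<Rightarrow> 'a"
  assumes u: "flow_solution X D {0..} u0 u" and lim: "(u \<longlongrightarrow> l) at_top"
    and cont: "isCont X l"
  shows "X l = 0"
proof -
  define a where "a = X l"
  have "((\<lambda>t. X (u t)) \<longlongrightarrow> a) at_top"
    unfolding a_def by (rule isCont_tendsto_compose[OF cont lim])
  then have lim1: "((\<lambda>t. a \<bullet> X (u t)) \<longlongrightarrow> a \<bullet> a) at_top"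
    by (intro tendsto_intros)
  have "filterlim (\<lambda>t::real. t + 1) at_top at_top"
    using filterlim_tendsto_add_at_top[OF tendsto_const[of 1] filterlim_ident] by (simp add: add.commute)
  then have lim2: "((\<lambda>t. a \<bullet> (u (t + 1) - u t)) \<longlongrightarrow> a \<bullet> (l - l)) at_top"
    by (intro tendsto_intros lim filterlim_compose[OF lim])
  have "a \<bullet> a \<le> 0"
  proof (rule ccontr)
    assume "\<not> a \<bullet> a \<le> 0"
    then have pos: "0 < a \<bullet> a / 2" by linarith
    have "eventually (\<lambda>t. a \<bullet> a / 2 < a \<bullet> X (u t)) at_top"
      by (rule order_tendstoD[OF lim1]) (use pos in \<open>simp del: inner_gt_zero_iff\<close>)
    then obtain N where N: "\<And>t. N \<le> t \<Longrightarrow> a \<bullet> a / 2 < a \<bullet> X (u t)"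
      unfolding eventually_at_top_linorder by blast
    have "eventually (\<lambda>t. a \<bullet> (u (t + 1) - u t) < a \<bullet> a / 2) at_top"
      by (rule order_tendstoD[OF lim2]) (use pos in \<open>simp del: inner_gt_zero_iff\<close>)
    then obtain N' where N': "\<And>t. N' \<le> t \<Longrightarrow> a \<bullet> (u (t + 1) - u t) < a \<bullet> a / 2"
      unfolding eventually_at_top_linorder by blast
    define t where "t = max 0 (max N N') + 1"
    have "\<exists>x. t < x \<and> x < t + 1 \<and> a \<bullet> u (t + 1) - a \<bullet> u t = (t + 1 - t) * (a \<bullet> X (u x))"
    proof (rule MVT2)
      fix x assume x: "t \<le> x" "x \<le> t + 1"
      then have "x > 0" by (simp add: t_def)
      then have "at x within {0..} = at x" by (intro at_within_interior) simp
      moreover have "(u has_vector_derivative X (u x)) (at x within {0..})"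
        using u \<open>x > 0\<close> by (simp add: flow_solution_def)
      ultimately have "(u has_vector_derivative X (u x)) (at x)" by simp
      then have "((\<lambda>t. a \<bullet> u t) has_derivative (\<lambda>h. a \<bullet> (h *\<^sub>R X (u x)))) (at x)"
        unfolding has_vector_derivative_def by (rule has_derivative_inner_right)
      then show "((\<lambda>t. a \<bullet> u t) has_real_derivative a \<bullet> X (u x)) (at x)"
        unfolding has_field_derivative_def by (rule has_derivative_eq_rhs) auto
    qed simp
    then obtain x where "t < x" "a \<bullet> (u (t + 1) - u t) = a \<bullet> X (u x)"
      by (auto simp: inner_diff_right)
    moreover have "N \<le> t" "N' \<le> t" by (auto simp: t_def max_def)
    ultimately show False using N[of x] N'[of t] by simp
  qed
  then have "a \<bullet> a = 0" using inner_ge_zero[of a] by linarith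
  then show ?thesis by (simp add: a_def)
qed

subsection \<open>Symmetric matrices and their powers\<close>

lemma symmetric_matrix_inner:
  fixes A :: "real^'n^'n"
  assumes "transpose A = A"
  shows "(A *v x) \<bullet> y = x \<bullet> (A *v y)"
  using assms by (metis dot_lmul_matrix transpose_matrix_vector)

lemma linear_term_zero:
  fixes b c :: real
  assumes "\<And>t. 2 * t * b + t\<^sup>2 * c \<le> 0" and "0 \<le> b"
  shows "b = 0"
proof (rule ccontr)
  assume "b \<noteq> 0"
  then have b: "b > 0" using assms by simp
  \<comment> \<open>Small enough that \<open>t * \<bar>c\<bar> < b\<close>, so the quadratic term
    cannot compensate the linear one.\<close>
  define t where "t = b / (\<bar>c\<bar> + 1)"
  have t: "t > 0" unfolding t_def using b by (intro divide_pos_pos) auto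
  have "t * (2 * b + t * c) \<le> 0" using assms(1)[of t] by (simp add: power2_eq_square algebra_simps)
  then have "2 * b + t * c \<le> 0" using t by (simp add: mult_le_0_iff)
  moreover have "t * (\<bar>c\<bar> + 1) = b" unfolding t_def by simp
  moreover have "- (t * c) \<le> t * \<bar>c\<bar>" using t mult_left_mono[of "- c" "\<bar>c\<bar>" t] by simp
  ultimately show False using b t by (simp add: algebra_simps)
qed

text \<open>A maximizer of the Rayleigh quotient on an invariant subspace is an eigenvector.\<close>

lemma symmetric_matrix_eigenvector:
  fixes A :: "real^'n^'n"
  assumes sym: "transpose A = A" and S: "subspace S" "S \<noteq> {0}"
    and inv: "\<And>x. x \<in> S \<Longrightarrow> A *v x \<in> S"
  shows "\<exists>x\<in>S. \<exists>c. norm x = 1 \<and> A *v x = c *\<^sub>R x"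
proof -
  let ?q = "\<lambda>x. x \<bullet> (A *v x)"
  have "compact (S \<inter> sphere 0 1)"
    by (intro closed_Int_compact closed_subspace S) simp
  moreover obtain y where y: "y \<in> S" "y \<noteq> 0" using S subspace_0 by blast
  then have "(1 / norm y) *\<^sub>R y \<in> S \<inter> sphere 0 1" using S by (simp add: subspace_scale)
  then have "S \<inter> sphere 0 1 \<noteq> {}" by blast
  moreover have "continuous_on (S \<inter> sphere 0 1) ?q"
    by (intro continuous_intros matrix_vector_mult_linear_continuous_on)
  ultimately have "\<exists>x\<in>S \<inter> sphere 0 1. \<forall>z\<in>S \<inter> sphere 0 1. ?q z \<le> ?q x"
    by (rule continuous_attains_sup)
  then obtain x where x: "x \<in> S" "norm x = 1" and max: "\<And>z. z \<in> S \<Longrightarrow> norm z = 1 \<Longrightarrow> ?q z \<le> ?q x"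
    by auto
  define c where "c = ?q x"
  have le: "?q z \<le> c * (z \<bullet> z)" if "z \<in> S" for z
  proof (cases "z = 0")
    case False
    have "?q ((1 / norm z) *\<^sub>R z) \<le> c" unfolding c_def
      by (rule max) (use that S False in \<open>auto simp: subspace_scale\<close>)
    then have "?q z / (norm z * norm z) \<le> c" by (simp add: matrix_vector_mult_scaleR)
    then show ?thesis using False
      by (simp add: divide_le_eq power2_norm_eq_inner[symmetric] power2_eq_square)
  qed simp
  \<comment> \<open>Half the gradient of the Rayleigh quotient at the unit vector \<open>x\<close>.
    Moving along \<open>h\<close> stays in \<open>S\<close>, and the first order gain
    \<open>2 * t * (h \<bullet> h)\<close> contradicts maximality unless
    \<open>h = 0\<close>.\<close>
  define h where "h = A *v x - c *\<^sub>R x"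
  have h: "h \<in> S" unfolding h_def using x S inv by (intro subspace_diff subspace_scale)
  have "2 * t * (h \<bullet> h) + t\<^sup>2 * (?q h - c * (h \<bullet> h)) \<le> 0" for t
  proof -
    have "x + t *\<^sub>R h \<in> S" using x h S by (intro subspace_add subspace_scale)
    then have "?q (x + t *\<^sub>R h) \<le> c * ((x + t *\<^sub>R h) \<bullet> (x + t *\<^sub>R h))" by (rule le)
    moreover have "x \<bullet> (A *v h) = h \<bullet> (A *v x)"
      using symmetric_matrix_inner[OF sym, of x h] by (simp add: inner_commute)
    then have "?q (x + t *\<^sub>R h) = c + 2 * t * (h \<bullet> (A *v x)) + t\<^sup>2 * ?q h"
      by (simp add: matrix_vector_right_distrib matrix_vector_mult_scaleR inner_add_left inner_add_right
          c_def power2_eq_square algebra_simps)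
    moreover have "(x + t *\<^sub>R h) \<bullet> (x + t *\<^sub>R h) = 1 + 2 * t * (h \<bullet> x) + t\<^sup>2 * (h \<bullet> h)"
      using x by (simp add: inner_add_left inner_add_right norm_eq_1 inner_commute[of x h] power2_eq_square algebra_simps)
    ultimately have "2 * t * (h \<bullet> (A *v x)) + t\<^sup>2 * ?q h \<le> c * (2 * t * (h \<bullet> x) + t\<^sup>2 * (h \<bullet> h))"
      by (simp add: distrib_left)
    moreover have hh: "h \<bullet> h = h \<bullet> (A *v x) - c * (h \<bullet> x)"
      by (subst (2) h_def) (simp add: inner_diff_right)
    have "2 * t * (h \<bullet> h) = 2 * t * (h \<bullet> (A *v x)) - c * (2 * t * (h \<bullet> x))"
      unfolding hh by (simp add: right_diff_distrib)
    ultimately show ?thesis by (simp only: distrib_left right_diff_distrib mult.left_commute[of c "t\<^sup>2"])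
  qed
  then have "h \<bullet> h = 0" by (rule linear_term_zero) simp
  then show ?thesis using x by (auto simp: h_def)
qed

text \<open>The orthogonal complement of a set of eigenvectors is invariant under a symmetric matrix
  and nonzero as long as the set has fewer than \<open>CARD('n)\<close> elements, so it contains a
  further eigenvector.\<close>

lemma symmetric_matrix_orthonormal_eigenvectors:
  fixes A :: "real^'n^'n"
  assumes sym: "transpose A = A" and "k \<le> CARD('n)"
  shows "\<exists>B. finite B \<and> card B = k \<and> pairwise orthogonal B \<and>
             (\<forall>x\<in>B. norm x = 1 \<and> (\<exists>c. A *v x = c *\<^sub>R x))"
  using \<open>k \<le> CARD('n)\<close>
proof (induction k)
  case 0
  show ?case by (intro exI[of _ "{}"]) auto
next
  case (Suc k)
  then obtain B where B: "finite B" "card B = k" "pairwise orthogonal B"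
    and e: "\<And>x. x \<in> B \<Longrightarrow> norm x = 1" "\<And>x. x \<in> B \<Longrightarrow> \<exists>c. A *v x = c *\<^sub>R x" by auto
  define S where "S = {x. \<forall>b\<in>B. b \<bullet> x = 0}"
  have S: "subspace S" unfolding S_def subspace_def by (auto simp: inner_add_right)
  have "dim B < DIM(real^'n)" using dim_le_card'[OF B(1)] B(2) Suc.prems by simp
  then obtain x where "x \<noteq> 0" "\<And>y. y \<in> span B \<Longrightarrow> orthogonal x y"
    using orthogonal_to_subspace_exists by blast
  then have "x \<in> S" by (auto simp: S_def orthogonal_def inner_commute span_base)
  with \<open>x \<noteq> 0\<close> have "S \<noteq> {0}" by auto
  moreover have "A *v x \<in> S" if "x \<in> S" for x
    unfolding S_def
  proof safe
    fix b assume "b \<in> B"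
    then obtain c where "A *v b = c *\<^sub>R b" using e by blast
    then show "b \<bullet> (A *v x) = 0"
      using symmetric_matrix_inner[OF sym, of b x] that \<open>b \<in> B\<close> by (simp add: S_def)
  qed
  ultimately obtain v c where v: "v \<in> S" "norm v = 1" "A *v v = c *\<^sub>R v"
    using symmetric_matrix_eigenvector[OF sym S] by blast
  have "v \<notin> B" using v by (auto simp: S_def norm_eq_1)
  moreover have "orthogonal v b" "orthogonal b v" if "b \<in> B" for b
    using v that by (auto simp: S_def orthogonal_def inner_commute)
  ultimately show ?case
    using B e v by (intro exI[of _ "insert v B"]) (auto simp: pairwise_insert)
qed

text \<open>The eigenvectors become the rows of \<open>P\<close>. The last two conclusions record
  that each \<open>d $ i\<close> belongs to a unit eigenvector, so that bounds on the spectrum apply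
  to the diagonal entries.\<close>

theorem symmetric_matrix_diagonalization:
  fixes A :: "real^'n^'n"
  assumes sym: "transpose A = A"
  obtains P d where "orthogonal_matrix P" "A = transpose P ** diag_matrix d ** P"
    "\<And>i. A *v (P $ i) = d $ i *\<^sub>R P $ i" "\<And>i. norm (P $ i) = 1"
proof -
  obtain B where B: "finite B" "card B = CARD('n)" "pairwise orthogonal B"
    and e: "\<And>x. x \<in> B \<Longrightarrow> norm x = 1" "\<And>x. x \<in> B \<Longrightarrow> \<exists>c. A *v x = c *\<^sub>R x"
    using symmetric_matrix_orthonormal_eigenvectors[OF sym order_refl] by auto
  obtain h where h: "bij_betw h (UNIV :: 'n set) B"
    using finite_same_card_bij[of "UNIV :: 'n set" B] B by auto
  then have hB: "h i \<in> B" for i by (auto simp: bij_betw_def)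
  then have "\<forall>i. \<exists>c. A *v h i = c *\<^sub>R h i" using e by blast
  then obtain c where c: "\<And>i. A *v h i = c i *\<^sub>R h i" by metis
  define P where "P = (\<chi> i. h i)"
  define d where "d = (\<chi> i. c i)"
  have P: "P $ i = h i" for i by (simp add: P_def)
  have "orthogonal (h i) (h j)" if "i \<noteq> j" for i j
    using that h hB B(3) by (metis UNIV_I bij_betw_imp_inj_on inj_onD pairwiseD)
  then have oP: "orthogonal_matrix P"
    unfolding orthogonal_matrix_orthonormal_rows using e hB by (simp add: row_def P vec_nth_inverse)
  have "(P ** A) $ i $ j = (diag_matrix d ** P) $ i $ j" for i j
  proof -
    have "A $ k $ j = A $ j $ k" for k using sym by (simp add: transpose_def vec_eq_iff)
    then have "(P ** A) $ i $ j = (A *v h i) $ j"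
      by (simp add: matrix_matrix_mult_def matrix_vector_mult_def P mult.commute)
    then show ?thesis by (simp add: c diag_matrix_mult_left P d_def)
  qed
  then have "P ** A = diag_matrix d ** P" by (simp add: vec_eq_iff)
  then have "A = transpose P ** diag_matrix d ** P"
    using oP by (metis matrix_mul_assoc matrix_mul_lid orthogonal_matrix_def)
  with oP show ?thesis using c e hB by (intro that[of P d]) (auto simp: P d_def)
qed

section \<open>Fractional powers of positive semidefinite matrices\<close>

definition psd_matrix :: "real^'n^'n \<Rightarrow> bool" where
  "psd_matrix A \<longleftrightarrow> transpose A = A \<and> (\<forall>x. 0 \<le> x \<bullet> (A *v x))"

text \<open>One diagonalization serves all exponents: since the power is unique, the description
  operator in \<open>fractional_power\<close> can be evaluated in any eigenbasis.\<close>

lemma psd_matrix_diagonalization: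
  fixes A :: "real^'n^'n"
  assumes "psd_matrix A"
  obtains P d where "orthogonal_matrix P" "\<And>i. 0 \<le> d $ i"
    "\<And>i. A *v (P $ i) = d $ i *\<^sub>R P $ i" "\<And>i. norm (P $ i) = 1"
    "A = transpose P ** diag_matrix d ** P"
    "\<And>s. fractional_power A s = transpose P ** diag_matrix (\<chi> i. eigenvalue_power (d $ i) s) ** P"
proof -
  obtain P d where P: "orthogonal_matrix P" "A = transpose P ** diag_matrix d ** P"
    "\<And>i. A *v (P $ i) = d $ i *\<^sub>R P $ i" "\<And>i. norm (P $ i) = 1"
    using assms symmetric_matrix_diagonalization unfolding psd_matrix_def by metis
  have d: "0 \<le> d $ i" for i
  proof -
    have "0 \<le> P $ i \<bullet> (A *v (P $ i))" using assms by (simp add: psd_matrix_def)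
    then show ?thesis using P(4)[of i] by (simp add: P(3) norm_eq_1)
  qed
  have "is_fractional_power A s (transpose P ** diag_matrix (\<chi> i. eigenvalue_power (d $ i) s) ** P)" for s
    unfolding is_fractional_power_def using P d by blast
  then have "fractional_power A s = transpose P ** diag_matrix (\<chi> i. eigenvalue_power (d $ i) s) ** P" for s
    unfolding fractional_power_def using is_fractional_power_unique by blast
  then show ?thesis using that P d by blast
qed

lemma diag_matrix_vector: "(diag_matrix d *v x) $ i = d $ i * x $ i"
  by (simp add: matrix_vector_mult_def diag_matrix_def if_distrib[of "\<lambda>x. x * _"] cong: if_cong)

lemma transpose_diag_matrix: "transpose (diag_matrix d) = diag_matrix d"
  by (simp add: transpose_def diag_matrix_def vec_eq_iff)

lemma conj_diag_vector_eq_0: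
  assumes "orthogonal_matrix P"
  shows "(transpose P ** diag_matrix d ** P) *v x = 0 \<longleftrightarrow> (\<forall>i. d $ i * (P *v x) $ i = 0)"
proof -
  have "(transpose P ** diag_matrix d ** P) *v x = transpose P *v (diag_matrix d *v (P *v x))"
    by (simp add: matrix_vector_mul_assoc matrix_mul_assoc)
  also have "\<dots> = 0 \<longleftrightarrow> diag_matrix d *v (P *v x) = 0"
  proof -
    have "P *v (transpose P *v y) = y" for y
      using assms by (simp add: matrix_vector_mul_assoc orthogonal_matrix_def del: transpose_matrix_vector)
    then show ?thesis by (metis matrix_vector_mult_0_right)
  qed
  finally show ?thesis by (simp add: vec_eq_iff diag_matrix_vector)
qed

lemma conj_diag_transpose:
  "transpose (transpose P ** diag_matrix d ** P) = transpose P ** diag_matrix d ** P"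
  by (simp add: matrix_transpose_mul transpose_diag_matrix matrix_mul_assoc)

lemma transpose_fractional_power:
  assumes "psd_matrix A"
  shows "transpose (fractional_power A s) = fractional_power A s"
  by (rule psd_matrix_diagonalization[OF assms]) (simp only: conj_diag_transpose)

lemma fractional_power_0:
  assumes "psd_matrix A"
  shows "fractional_power A 0 = mat 1"
proof -
  obtain P d where P: "orthogonal_matrix P" and d: "\<And>i. 0 \<le> d $ i"
    and eig: "\<And>i. A *v (P $ i) = d $ i *\<^sub>R P $ i" "\<And>i. norm (P $ i) = 1"
    and A: "A = transpose P ** diag_matrix d ** P"
    and f: "\<And>s. fractional_power A s = transpose P ** diag_matrix (\<chi> i. eigenvalue_power (d $ i) s) ** P"
    by (rule psd_matrix_diagonalization[OF assms]) (rule that; assumption)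
  have "diag_matrix (\<chi> i. eigenvalue_power (d $ i) 0) = mat 1"
    by (simp add: diag_matrix_def mat_def eigenvalue_power_def vec_eq_iff)
  then show ?thesis using P by (simp add: f orthogonal_matrix)
qed

lemma fractional_power_1:
  assumes "psd_matrix A"
  shows "fractional_power A 1 = A"
proof -
  obtain P d where P: "orthogonal_matrix P" and d: "\<And>i. 0 \<le> d $ i"
    and eig: "\<And>i. A *v (P $ i) = d $ i *\<^sub>R P $ i" "\<And>i. norm (P $ i) = 1"
    and A: "A = transpose P ** diag_matrix d ** P"
    and f: "\<And>s. fractional_power A s = transpose P ** diag_matrix (\<chi> i. eigenvalue_power (d $ i) s) ** P"
    by (rule psd_matrix_diagonalization[OF assms]) (rule that; assumption)
  have "(\<chi> i. eigenvalue_power (d $ i) 1) = d"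
    using d by (simp add: eigenvalue_power_def vec_eq_iff)
  then show ?thesis by (simp only: f A[symmetric])
qed

text \<open>For \<open>s \<noteq> 0\<close> the scalar power vanishes exactly at 0, for negative
  \<open>s\<close> by the convention \<open>0 powr s = 0\<close>. Both diagonal matrices thus have
  the same zero entries.\<close>

lemma fractional_power_kernel:
  assumes "psd_matrix A" "s \<noteq> 0"
  shows "fractional_power A s *v x = 0 \<longleftrightarrow> A *v x = 0"
proof -
  obtain P d where P: "orthogonal_matrix P" and d: "\<And>i. 0 \<le> d $ i"
    and eig: "\<And>i. A *v (P $ i) = d $ i *\<^sub>R P $ i" "\<And>i. norm (P $ i) = 1"
    and A: "A = transpose P ** diag_matrix d ** P"
    and f: "\<And>s. fractional_power A s = transpose P ** diag_matrix (\<chi> i. eigenvalue_power (d $ i) s) ** P"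
    by (rule psd_matrix_diagonalization[OF assms(1)]) (rule that; assumption)
  have "A *v x = 0 \<longleftrightarrow> (\<forall>i. d $ i * (P *v x) $ i = 0)"
    using conj_diag_vector_eq_0[OF P, of d x] by (simp only: A[symmetric])
  then show ?thesis
    using assms(2) by (simp add: f conj_diag_vector_eq_0[OF P] eigenvalue_power_def)
qed

text \<open>In the eigencoordinates \<open>P *v x\<close> the form is a sum of squares with
  coefficients \<open>e i * d $ i\<close>, where \<open>e i\<close> is the power of
  \<open>d $ i\<close>. These are nonnegative, and \<open>e i\<close> can vanish only if
  \<open>d $ i\<close> does.\<close>

lemma fractional_power_mult_inner:
  assumes "psd_matrix A"
  shows "0 \<le> x \<bullet> (fractional_power A s *v (A *v x))"
    and "x \<bullet> (fractional_power A s *v (A *v x)) = 0 \<Longrightarrow> A *v x = 0"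
proof -
  obtain P d where P: "orthogonal_matrix P" and d: "\<And>i. 0 \<le> d $ i"
    and eig: "\<And>i. A *v (P $ i) = d $ i *\<^sub>R P $ i" "\<And>i. norm (P $ i) = 1"
    and A: "A = transpose P ** diag_matrix d ** P"
    and f: "\<And>s. fractional_power A s = transpose P ** diag_matrix (\<chi> i. eigenvalue_power (d $ i) s) ** P"
    by (rule psd_matrix_diagonalization[OF assms]) (rule that; assumption)
  define e where "e i = eigenvalue_power (d $ i) s" for i
  have PP: "P ** transpose P = mat 1" using P by (simp add: orthogonal_matrix_def)
  have adj: "x \<bullet> (transpose P *v y) = (P *v x) \<bullet> y" for x y
    by (metis dot_lmul_matrix transpose_matrix_vector transpose_transpose)
  have "A *v x = transpose P *v (diag_matrix d *v (P *v x))"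
    by (simp only: matrix_vector_mul_assoc matrix_mul_assoc A[symmetric])
  then have PA: "P *v (A *v x) = diag_matrix d *v (P *v x)"
    by (metis PP matrix_vector_mul_assoc matrix_vector_mul_lid)
  have "fractional_power A s *v (A *v x)
      = transpose P *v (diag_matrix (\<chi> i. e i) *v (P *v (A *v x)))"
    by (simp only: f e_def matrix_vector_mul_assoc matrix_mul_assoc)
  then have "x \<bullet> (fractional_power A s *v (A *v x))
      = (P *v x) \<bullet> (diag_matrix (\<chi> i. e i) *v (diag_matrix d *v (P *v x)))"
    by (simp only: adj PA)
  also have "\<dots> = (\<Sum>i\<in>UNIV. e i * d $ i * ((P *v x) $ i)\<^sup>2)"
    by (simp add: inner_vec_def diag_matrix_vector power2_eq_square mult_ac)
  finally have eq: "x \<bullet> (fractional_power A s *v (A *v x)) = (\<Sum>i\<in>UNIV. e i * d $ i * ((P *v x) $ i)\<^sup>2)" .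
  have e: "0 \<le> e i" "e i = 0 \<Longrightarrow> d $ i = 0" for i
    by (auto simp: e_def eigenvalue_power_def split: if_splits)
  have nonneg: "0 \<le> e i * d $ i * ((P *v x) $ i)\<^sup>2" for i using e d by simp
  show "0 \<le> x \<bullet> (fractional_power A s *v (A *v x))"
    unfolding eq by (intro sum_nonneg nonneg)
  assume "x \<bullet> (fractional_power A s *v (A *v x)) = 0"
  then have "e i * d $ i * ((P *v x) $ i)\<^sup>2 = 0" for i
    unfolding eq using nonneg by (simp add: sum_nonneg_eq_0_iff)
  then have "d $ i * (P *v x) $ i = 0" for i using e(2)[of i] by auto
  then show "A *v x = 0"
    using conj_diag_vector_eq_0[OF P, of d x] by (simp only: A[symmetric]) simp
qed

section \<open>The Frobenius norm and Lipschitz dependence of the power on the matrix\<close>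

lemma norm_matrix_squared:
  fixes A :: "real^'n^'m"
  shows "(norm A)\<^sup>2 = (\<Sum>i\<in>UNIV. \<Sum>j\<in>UNIV. (A $ i $ j)\<^sup>2)"
  by (simp add: norm_vec_def L2_set_def sum_nonneg)

lemma matrix_diff_ldistrib: "A ** (B - C) = A ** B - A ** (C :: real^'n^'m)"
  by (simp add: matrix_matrix_mult_def vec_eq_iff sum_subtractf right_diff_distrib)

lemma matrix_diff_rdistrib: "(B - C) ** A = B ** A - (C :: real^'n^'m) ** A"
  by (simp add: matrix_matrix_mult_def vec_eq_iff sum_subtractf left_diff_distrib)

lemma norm_transpose: "norm (transpose A) = norm (A :: real^'n^'m)"
proof -
  have "(norm (transpose A))\<^sup>2 = (norm A)\<^sup>2"
    by (simp only: norm_matrix_squared transpose_def vec_lambda_beta) (rule sum.swap)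
  then show ?thesis by simp
qed

text \<open>Right multiplication by \<open>Q\<close> acts on each row as the isometry
  \<open>transpose Q\<close>.\<close>

lemma norm_matrix_mult_orthogonal:
  fixes A :: "real^'n^'m"
  assumes "orthogonal_matrix Q"
  shows "norm (A ** Q) = norm A"
proof -
  have "(A ** Q) $ i = transpose Q *v (A $ i)" for i
    by (simp add: vec_eq_iff matrix_matrix_mult_def matrix_vector_mult_def transpose_def mult.commute)
  moreover have "norm (transpose Q *v x) = norm x" for x
    using assms orthogonal_transformation_norm orthogonal_transformation_matrix
    by (metis matrix_of_matrix_vector_mul matrix_vector_mul_linear orthogonal_matrix_transpose)
  ultimately show ?thesis by (simp add: norm_vec_def)
qed

lemma norm_orthogonal_conj:
  fixes A :: "real^'n^'n"
  assumes "orthogonal_matrix P" "orthogonal_matrix Q"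
  shows "norm (P ** A ** transpose Q) = norm A"
proof -
  have "norm (P ** A ** transpose Q) = norm (transpose (P ** A))"
    using assms(2) by (simp add: norm_matrix_mult_orthogonal orthogonal_matrix_transpose norm_transpose)
  also have "\<dots> = norm (transpose A ** transpose P)" by (simp add: matrix_transpose_mul)
  also have "\<dots> = norm A"
    using assms(1) by (simp add: norm_matrix_mult_orthogonal orthogonal_matrix_transpose norm_transpose)
  finally show ?thesis .
qed

text \<open>
  In eigenbases of \<open>A\<close> and \<open>B\<close>, the entries of \<open>A - B\<close> and of \<open>A\<^sup>s - B\<^sup>s\<close> are
  \<open>(d\<^sub>i - e\<^sub>j) M\<^sub>i\<^sub>j\<close> and \<open>(d\<^sub>i\<^sup>s - e\<^sub>j\<^sup>s) M\<^sub>i\<^sub>j\<close> with the same orthogonal matrix \<open>M\<close>. So a Lipschitz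
  constant of the scalar function is one of the matrix function in the Frobenius norm.
\<close>

lemma fractional_power_lipschitz:
  fixes A B :: "real^'n^'n"
  assumes A: "psd_matrix A" and B: "psd_matrix B"
    and specA: "\<And>x c. norm x = 1 \<Longrightarrow> A *v x = c *\<^sub>R x \<Longrightarrow> c \<in> \<Lambda>"
    and specB: "\<And>x c. norm x = 1 \<Longrightarrow> B *v x = c *\<^sub>R x \<Longrightarrow> c \<in> \<Lambda>"
    and lip: "C-lipschitz_on \<Lambda> (\<lambda>x. eigenvalue_power x s)"
  shows "norm (fractional_power A s - fractional_power B s) \<le> C * norm (A - B)"
proof -
obtain P d where P: "orthogonal_matrix P" and d: "\<And>i. 0 \<le> d $ i"
    and eigA: "\<And>i. A *v (P $ i) = d $ i *\<^sub>R P $ i" "\<And>i. norm (P $ i) = 1"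
    and A_eq: "A = transpose P ** diag_matrix d ** P"
    and fA: "\<And>s. fractional_power A s = transpose P ** diag_matrix (\<chi> i. eigenvalue_power (d $ i) s) ** P"
    by (rule psd_matrix_diagonalization[OF A]) (rule that; assumption)
  obtain Q e where Q: "orthogonal_matrix Q" and e: "\<And>i. 0 \<le> e $ i"
    and eigB: "\<And>i. B *v (Q $ i) = e $ i *\<^sub>R Q $ i" "\<And>i. norm (Q $ i) = 1"
    and B_eq: "B = transpose Q ** diag_matrix e ** Q"
    and fB: "\<And>s. fractional_power B s = transpose Q ** diag_matrix (\<chi> i. eigenvalue_power (e $ i) s) ** Q"
    by (rule psd_matrix_diagonalization[OF B]) (rule that; assumption)
  define M where "M = P ** transpose Q"
  have PP: "P ** transpose P = mat 1" and QQ: "Q ** transpose Q = mat 1"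
    using P Q by (auto simp: orthogonal_matrix_def)
  have left: "P ** (transpose P ** X ** P) ** transpose Q = X ** M" for X
    unfolding M_def using PP by (metis matrix_mul_assoc matrix_mul_lid)
  have right: "P ** (transpose Q ** X ** Q) ** transpose Q = M ** X" for X
    unfolding M_def using QQ by (metis matrix_mul_assoc matrix_mul_rid)
  have entry: "(P ** (transpose P ** diag_matrix x ** P - transpose Q ** diag_matrix y ** Q) ** transpose Q) $ i $ j
      = (x $ i - y $ j) * M $ i $ j" for x y i j
    by (simp add: matrix_diff_ldistrib matrix_diff_rdistrib left right diag_matrix_mult_left diag_matrix_mult_right
        algebra_simps)
  have nrm: "(norm (X - Y))\<^sup>2 = (\<Sum>i\<in>UNIV. \<Sum>j\<in>UNIV. ((x $ i - y $ j) * M $ i $ j)\<^sup>2)"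
    if "X = transpose P ** diag_matrix x ** P" "Y = transpose Q ** diag_matrix y ** Q" for X Y x y
  proof -
    have "(norm (X - Y))\<^sup>2 = (norm (P ** (X - Y) ** transpose Q))\<^sup>2"
      by (simp only: norm_orthogonal_conj[OF P Q])
    then show ?thesis by (simp only: norm_matrix_squared that entry)
  qed
  have C: "0 \<le> C" by (rule lipschitz_on_nonneg[OF lip])
  have "(norm (fractional_power A s - fractional_power B s))\<^sup>2
      = (\<Sum>i\<in>UNIV. \<Sum>j\<in>UNIV. ((eigenvalue_power (d $ i) s - eigenvalue_power (e $ j) s) * M $ i $ j)\<^sup>2)"
    by (subst nrm[OF fA fB]) simp
  also have "\<dots> \<le> (\<Sum>i\<in>UNIV. \<Sum>j\<in>UNIV. C\<^sup>2 * ((d $ i - e $ j) * M $ i $ j)\<^sup>2)"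
  proof (intro sum_mono)
    fix i j
    have "\<bar>eigenvalue_power (d $ i) s - eigenvalue_power (e $ j) s\<bar> \<le> C * \<bar>d $ i - e $ j\<bar>"
      using lipschitz_onD[OF lip specA[OF eigA(2,1), of i] specB[OF eigB(2,1), of j]] by (simp add: dist_real_def)
    then have "(eigenvalue_power (d $ i) s - eigenvalue_power (e $ j) s)\<^sup>2 \<le> (C * (d $ i - e $ j))\<^sup>2"
      by (intro abs_le_square_iff[THEN iffD1]) (use C in \<open>simp add: abs_mult\<close>)
    then show "((eigenvalue_power (d $ i) s - eigenvalue_power (e $ j) s) * M $ i $ j)\<^sup>2
        \<le> C\<^sup>2 * ((d $ i - e $ j) * M $ i $ j)\<^sup>2"
      by (simp add: power_mult_distrib mult_right_mono flip: mult.assoc)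
  qed
  also have "\<dots> = (C * norm (A - B))\<^sup>2"
    by (simp add: power_mult_distrib nrm[OF A_eq B_eq] sum_distrib_left)
  finally show ?thesis by (rule power2_le_imp_le) (use C in simp)
qed

subsection \<open>Lipschitz maps\<close>

text \<open>The constant is hidden so that closure rules can be chained by \<open>intro\<close>, in
  the way continuity proofs are.\<close>

definition lipschitz_map_on :: "'a::metric_space set \<Rightarrow> ('a \<Rightarrow> 'b::metric_space) \<Rightarrow> bool" where
  "lipschitz_map_on S f \<longleftrightarrow> (\<exists>C. C-lipschitz_on S f)"

lemma lipschitz_map_on_continuous: "lipschitz_map_on S f \<Longrightarrow> continuous_on S f"
  unfolding lipschitz_map_on_def using lipschitz_on_continuous_on by blast

lemma lipschitz_map_onI:
  fixes f :: "'a::real_normed_vector \<Rightarrow> 'b::real_normed_vector"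
  assumes "\<And>x y. x \<in> S \<Longrightarrow> y \<in> S \<Longrightarrow> norm (f x - f y) \<le> C * norm (x - y)" "0 \<le> C"
  shows "lipschitz_map_on S f"
  unfolding lipschitz_map_on_def using assms by (intro exI[of _ C] lipschitz_onI) (auto simp: dist_norm)

lemma lipschitz_map_on_const: "lipschitz_map_on S (\<lambda>x. c)"
  unfolding lipschitz_map_on_def using lipschitz_on_constant by blast

lemma lipschitz_map_on_add:
  fixes f g :: "'a::metric_space \<Rightarrow> 'b::real_normed_vector"
  shows "lipschitz_map_on S f \<Longrightarrow> lipschitz_map_on S g \<Longrightarrow> lipschitz_map_on S (\<lambda>x. f x + g x)"
  unfolding lipschitz_map_on_def by (blast intro: lipschitz_on_add)

lemma lipschitz_map_on_diff:
  fixes f g :: "'a::metric_space \<Rightarrow> 'b::real_normed_vector"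
  shows "lipschitz_map_on S f \<Longrightarrow> lipschitz_map_on S g \<Longrightarrow> lipschitz_map_on S (\<lambda>x. f x - g x)"
  unfolding lipschitz_map_on_def by (blast intro: lipschitz_on_diff)

lemma lipschitz_map_on_minus:
  fixes f :: "'a::metric_space \<Rightarrow> 'b::real_normed_vector"
  shows "lipschitz_map_on S f \<Longrightarrow> lipschitz_map_on S (\<lambda>x. - f x)"
  unfolding lipschitz_map_on_def by (blast intro: lipschitz_on_minus)

lemma lipschitz_map_on_sum:
  fixes f :: "'i \<Rightarrow> 'a::metric_space \<Rightarrow> 'b::real_normed_vector"
  assumes "\<And>i. i \<in> A \<Longrightarrow> lipschitz_map_on S (f i)"
  shows "lipschitz_map_on S (\<lambda>x. \<Sum>i\<in>A. f i x)"
  using assms by (induction A rule: infinite_finite_induct)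
    (auto intro: lipschitz_map_on_const lipschitz_map_on_add)

text \<open>The difference is split as in the product rule; compactness bounds the factor that is
  not differenced.\<close>

lemma lipschitz_map_on_bilinear:
  fixes f :: "'a::real_normed_vector \<Rightarrow> 'b::real_normed_vector" and g :: "'a \<Rightarrow> 'c::real_normed_vector"
    and B :: "'b \<Rightarrow> 'c \<Rightarrow> 'd::real_normed_vector"
  assumes S: "compact S" and "bounded_bilinear B"
    and f: "lipschitz_map_on S f" and g: "lipschitz_map_on S g"
  shows "lipschitz_map_on S (\<lambda>x. B (f x) (g x))"
proof -
  interpret bounded_bilinear B by fact
  obtain K where K: "0 < K" "\<And>a b. norm (B a b) \<le> norm a * norm b * K" using pos_bounded by blast
  obtain Cf Cg where C: "Cf-lipschitz_on S f" "Cg-lipschitz_on S g"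
    using f g unfolding lipschitz_map_on_def by blast
  have "bounded (f ` S)" "bounded (g ` S)"
    using f g S by (auto intro: compact_imp_bounded compact_continuous_image lipschitz_map_on_continuous)
  then obtain Mf Mg where M: "0 < Mf" "\<And>x. x \<in> S \<Longrightarrow> norm (f x) \<le> Mf"
      "0 < Mg" "\<And>x. x \<in> S \<Longrightarrow> norm (g x) \<le> Mg"
    unfolding bounded_pos by auto
  have Cnn: "0 \<le> Cf" "0 \<le> Cg" using C by (auto intro: lipschitz_on_nonneg)
  show ?thesis
  proof (rule lipschitz_map_onI)
    fix x y assume xy: "x \<in> S" "y \<in> S"
    have "norm (B (f x) (g x) - B (f y) (g y)) = norm (B (f x) (g x - g y) + B (f x - f y) (g y))"
      by (simp add: diff_left diff_right)
    also have "\<dots> \<le> norm (f x) * norm (g x - g y) * K + norm (f x - f y) * norm (g y) * K"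
      by (intro norm_triangle_le add_mono K)
    also have "\<dots> \<le> Mf * (Cg * norm (x - y)) * K + (Cf * norm (x - y)) * Mg * K"
      using K(1) M xy Cnn lipschitz_on_normD[OF C(1)] lipschitz_on_normD[OF C(2)]
      by (intro add_mono mult_mono mult_nonneg_nonneg) auto
    also have "\<dots> = (Mf * Cg * K + Cf * Mg * K) * norm (x - y)" by (simp add: algebra_simps)
    finally show "norm (B (f x) (g x) - B (f y) (g y)) \<le> (Mf * Cg * K + Cf * Mg * K) * norm (x - y)" .
  qed (use K(1) M Cnn in auto)
qed

lemmas lipschitz_map_on_mult = lipschitz_map_on_bilinear[OF _ bounded_bilinear_mult]

lemma lipschitz_map_on_C1:
  fixes \<phi> :: "real \<Rightarrow> real"
  assumes deriv: "\<And>y. y \<in> A \<Longrightarrow> (\<phi> has_real_derivative \<phi>' y) (at y)" and cont: "continuous_on A \<phi>'"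
    and "compact A" "convex A"
  shows "lipschitz_map_on A \<phi>"
proof -
  have "bounded (\<phi>' ` A)" using \<open>compact A\<close> cont by (intro compact_imp_bounded compact_continuous_image)
  then obtain B where B: "0 < B" "\<And>y. y \<in> A \<Longrightarrow> norm (\<phi>' y) \<le> B" unfolding bounded_pos by auto
  show ?thesis
  proof (rule lipschitz_map_onI)
    fix x y assume "x \<in> A" "y \<in> A"
    then show "norm (\<phi> x - \<phi> y) \<le> B * norm (x - y)"
      by (intro field_differentiable_bound[OF \<open>convex A\<close>, of \<phi> \<phi>' B] B)
        (auto intro: has_field_derivative_at_within deriv)
  qed (use B in simp)
qed

text \<open>The convex hull of the image of \<open>f\<close> is a compact subset of
  \<open>A\<close>. There \<open>\<phi>'\<close> is bounded, and convexity allows the mean value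
  inequality.\<close>

lemma lipschitz_map_on_compose_C1:
  fixes \<phi> :: "real \<Rightarrow> real" and f :: "'a::metric_space \<Rightarrow> real"
  assumes S: "compact S" and f: "lipschitz_map_on S f" and A: "convex A" "\<And>x. x \<in> S \<Longrightarrow> f x \<in> A"
    and deriv: "\<And>y. y \<in> A \<Longrightarrow> (\<phi> has_real_derivative \<phi>' y) (at y)" and cont: "continuous_on A \<phi>'"
  shows "lipschitz_map_on S (\<lambda>x. \<phi> (f x))"
proof -
  have "compact (f ` S)" using S lipschitz_map_on_continuous[OF f] by (intro compact_continuous_image)
  then have "compact (convex hull (f ` S))" by (rule compact_convex_hull)
  moreover have sub: "convex hull (f ` S) \<subseteq> A" using A by (intro hull_minimal) auto
  ultimately have "lipschitz_map_on (convex hull (f ` S)) \<phi>"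
    using deriv cont by (intro lipschitz_map_on_C1[of _ _ \<phi>']) (auto elim: continuous_on_subset)
  then obtain C C' where "C-lipschitz_on (convex hull (f ` S)) \<phi>" and C': "C'-lipschitz_on S f"
    using f unfolding lipschitz_map_on_def by blast
  then have "C-lipschitz_on (f ` S) \<phi>" by (meson hull_subset lipschitz_on_subset)
  from lipschitz_on_compose2[OF C' this] show ?thesis unfolding lipschitz_map_on_def by blast
qed

lemma lipschitz_map_on_exp:
  "compact S \<Longrightarrow> lipschitz_map_on S f \<Longrightarrow> lipschitz_map_on S (\<lambda>x. exp (f x :: real))"
  by (rule lipschitz_map_on_compose_C1[where A = UNIV and \<phi>' = exp])
    (auto intro!: derivative_eq_intros continuous_intros)

lemma lipschitz_map_on_sqrt:
  "compact S \<Longrightarrow> lipschitz_map_on S f \<Longrightarrow> (\<And>x. x \<in> S \<Longrightarrow> 0 < f x) \<Longrightarrow> lipschitz_map_on S (\<lambda>x. sqrt (f x))"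
  by (rule lipschitz_map_on_compose_C1[where A = "{0<..}" and \<phi>' = "\<lambda>x. inverse (sqrt x) / 2"])
    (auto intro!: derivative_eq_intros continuous_intros)

lemma lipschitz_map_on_inverse:
  "compact S \<Longrightarrow> lipschitz_map_on S f \<Longrightarrow> (\<And>x. x \<in> S \<Longrightarrow> 0 < f x) \<Longrightarrow> lipschitz_map_on S (\<lambda>x. inverse (f x :: real))"
  by (rule lipschitz_map_on_compose_C1[where A = "{0<..}" and \<phi>' = "\<lambda>x. - inverse (x\<^sup>2)"])
    (auto intro!: derivative_eq_intros continuous_intros simp: power2_eq_square)

lemma lipschitz_map_on_arccos:
  assumes "compact S" "lipschitz_map_on S f" "\<And>x. x \<in> S \<Longrightarrow> - 1 < f x" "\<And>x. x \<in> S \<Longrightarrow> f x < 1"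
  shows "lipschitz_map_on S (\<lambda>x. arccos (f x))"
proof (rule lipschitz_map_on_compose_C1[where A = "{-1<..<1}" and \<phi> = arccos and \<phi>' = "\<lambda>x. inverse (- sqrt (1 - x\<^sup>2))"])
  show "(arccos has_real_derivative inverse (- sqrt (1 - y\<^sup>2))) (at y)" if "y \<in> {-1<..<1}" for y
    using that by (intro DERIV_arccos) auto
  show "continuous_on {-1<..<1::real} (\<lambda>x. inverse (- sqrt (1 - x\<^sup>2)))"
    by (intro continuous_intros) (auto simp: abs_square_eq_1)
qed (use assms in auto)

lemma lipschitz_map_on_vec:
  fixes f :: "'a::real_normed_vector \<Rightarrow> 'b::real_normed_vector ^ 'n"
  assumes "\<And>i. lipschitz_map_on S (\<lambda>x. f x $ i)"
  shows "lipschitz_map_on S f"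
proof -
  have "\<forall>i. \<exists>C. C-lipschitz_on S (\<lambda>x. f x $ i)" using assms unfolding lipschitz_map_on_def by blast
  then obtain C where C: "\<And>i. (C i)-lipschitz_on S (\<lambda>x. f x $ i)" by metis
  show ?thesis
  proof (rule lipschitz_map_onI)
    fix x y assume "x \<in> S" "y \<in> S"
    then have "norm (f x $ i - f y $ i) \<le> C i * norm (x - y)" for i
      using lipschitz_on_normD[OF C] by blast
    then have "(\<Sum>i\<in>UNIV. norm ((f x - f y) $ i)) \<le> (\<Sum>i\<in>UNIV. C i * norm (x - y))"
      by (intro sum_mono) simp
    moreover have "norm (f x - f y) \<le> (\<Sum>i\<in>UNIV. norm ((f x - f y) $ i))"
      unfolding norm_vec_def by (rule L2_set_le_sum) simp
    ultimately show "norm (f x - f y) \<le> (\<Sum>i\<in>UNIV. C i) * norm (x - y)" by (simp add: sum_distrib_right)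
  qed (intro sum_nonneg lipschitz_on_nonneg[OF C])
qed

lemma norm_matrix_vector_mult_le:
  fixes A :: "real^'n^'m"
  shows "norm (A *v x) \<le> norm A * norm x"
proof -
  have "norm (A *v x) = L2_set (\<lambda>i. norm ((A *v x) $ i)) UNIV" by (rule norm_vec_def)
  also have "\<dots> \<le> L2_set (\<lambda>i. norm (A $ i) * norm x) UNIV"
    by (intro L2_set_mono) (auto simp: matrix_vector_mul_component intro: Cauchy_Schwarz_ineq2)
  also have "\<dots> = norm A * norm x" by (simp add: norm_vec_def[of A] L2_set_left_distrib)
  finally show ?thesis .
qed

lemma bounded_bilinear_matrix_vector_mult:
  "bounded_bilinear ((*v) :: real^'n^'m \<Rightarrow> real^'n \<Rightarrow> real^'m)"
proof
  show "\<exists>K. \<forall>A x. norm ((A :: real^'n^'m) *v x) \<le> norm A * norm x * K"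
    by (intro exI[of _ 1]) (simp add: norm_matrix_vector_mult_le)
qed (simp_all add: matrix_vector_mult_add_rdistrib matrix_vector_right_distrib
    matrix_vector_mult_scaleR scaleR_matrix_vector_assoc)

text \<open>The set has the shape of the spectrum of \<open>L\<close> over a compact set of
  admissible points. The gap between 0 and \<open>m\<close> absorbs the bad behaviour of the power
  near 0: a bounded jump across a gap of length \<open>m\<close> is a Lipschitz increment.\<close>

lemma eigenvalue_power_lipschitz:
  assumes "0 < m"
  shows "lipschitz_map_on (insert 0 {m..M}) (\<lambda>x. eigenvalue_power x s)"
proof (cases "s = 0")
  case True
  then show ?thesis by (simp add: eigenvalue_power_def lipschitz_map_on_const)
next
  case False
  have "lipschitz_map_on {m..M} (\<lambda>x. x powr s)"
  proof (rule lipschitz_map_on_C1)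
    show "((\<lambda>x. x powr s) has_real_derivative s * y powr (s - 1)) (at y)" if "y \<in> {m..M}" for y
      using that \<open>0 < m\<close> by (intro has_real_derivative_powr) simp
    show "continuous_on {m..M} (\<lambda>y. s * y powr (s - 1))"
      using \<open>0 < m\<close> by (intro continuous_intros) auto
  qed auto
  then obtain C where C: "C-lipschitz_on {m..M} (\<lambda>x. x powr s)" unfolding lipschitz_map_on_def by blast
  have "bounded ((\<lambda>x. x powr s) ` {m..M})"
    by (intro compact_imp_bounded compact_continuous_image lipschitz_on_continuous_on[OF C]) auto
  then obtain B where B: "0 < B" "\<And>x. x \<in> {m..M} \<Longrightarrow> norm (x powr s) \<le> B"
    unfolding bounded_pos by auto
  \<comment> \<open>\<open>B / m\<close> handles the pairs with one point at 0, since
    \<open>B \<le> (B / m) * x\<close> for \<open>m \<le> x\<close>.\<close>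
  define D where "D = max C (B / m)"
  have D: "C \<le> D" "B \<le> D * m" using \<open>0 < m\<close> by (auto simp: D_def max_def field_simps)
  have Dnn: "0 \<le> D" using D(1) lipschitz_on_nonneg[OF C] by linarith
  have zero: "x powr s \<le> D * x" if "x \<in> {m..M}" for x
  proof -
    have "x powr s \<le> B" using B(2)[OF that] by simp
    also have "\<dots> \<le> D * m" by (rule D)
    also have "\<dots> \<le> D * x" using that Dnn by (intro mult_left_mono) auto
    finally show ?thesis .
  qed
  show ?thesis
  proof (rule lipschitz_map_onI[OF _ Dnn])
    fix x y assume "x \<in> insert 0 {m..M}" "y \<in> insert 0 {m..M}"
    then consider "x = 0" "y = 0" | "x = 0" "y \<in> {m..M}" | "x \<in> {m..M}" "y = 0" | "x \<in> {m..M}" "y \<in> {m..M}"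
      by blast
    then show "norm (eigenvalue_power x s - eigenvalue_power y s) \<le> D * norm (x - y)"
    proof cases
      case 4
      then have "norm (x powr s - y powr s) \<le> C * norm (x - y)" by (rule lipschitz_on_normD[OF C])
      also have "\<dots> \<le> D * norm (x - y)" by (intro mult_right_mono D) simp
      finally show ?thesis using False by (simp add: eigenvalue_power_def)
    qed (use False zero \<open>0 < m\<close> in \<open>auto simp: eigenvalue_power_def\<close>)
  qed
qed

text \<open>By homogeneity only unit vectors matter, and the form attains a positive minimum over
  the compact set of pairs \<open>(u, x)\<close>. Letting \<open>u\<close> vary makes the spectral
  gap uniform.\<close>

lemma quadratic_form_uniform_bound:
  fixes A :: "'a::metric_space \<Rightarrow> real^'n^'n"
  assumes S: "compact S" and A: "continuous_on S A"
    and pos: "\<And>u x. u \<in> S \<Longrightarrow> w \<bullet> x = 0 \<Longrightarrow> x \<noteq> 0 \<Longrightarrow> 0 < x \<bullet> (A u *v x)"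
  obtains m where "0 < m" "\<And>u x. u \<in> S \<Longrightarrow> w \<bullet> x = 0 \<Longrightarrow> m * (norm x)\<^sup>2 \<le> x \<bullet> (A u *v x)"
proof -
  define T where "T = {x. w \<bullet> x = 0} \<inter> sphere 0 1"
  have "compact T" unfolding T_def by (intro closed_Int_compact closed_hyperplane) simp
  define q where "q z = snd z \<bullet> (A (fst z) *v snd z)" for z
  have "\<exists>m>0. \<forall>z\<in>S \<times> T. m \<le> q z"
  proof (cases "S \<times> T = {}")
    case False
    have "continuous_on (S \<times> T) (\<lambda>z. A (fst z))"
      by (rule continuous_on_compose2[OF A]) (auto intro!: continuous_intros)
    then have "continuous_on (S \<times> T) q" unfolding q_def
      by (intro continuous_intros bounded_bilinear.continuous_on[OF bounded_bilinear_matrix_vector_mult])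
    moreover have "compact (S \<times> T)" using S \<open>compact T\<close> by (rule compact_Times)
    ultimately obtain z where z: "z \<in> S \<times> T" "\<forall>y\<in>S \<times> T. q z \<le> q y"
      using continuous_attains_inf False by metis
    have "0 < q z" unfolding q_def using z(1) by (intro pos) (auto simp: T_def)
    then show ?thesis using z(2) by blast
  qed (auto intro!: exI[of _ 1])
  then obtain m where m: "0 < m" "\<And>z. z \<in> S \<times> T \<Longrightarrow> m \<le> q z" by blast
  have "m * (norm x)\<^sup>2 \<le> x \<bullet> (A u *v x)" if "u \<in> S" "w \<bullet> x = 0" for u x
  proof (cases "x = 0")
    case False
    have "m \<le> q (u, (1 / norm x) *\<^sub>R x)"
      using that False by (intro m) (auto simp: T_def)
    also have "\<dots> = (x \<bullet> (A u *v x)) / (norm x)\<^sup>2"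
      by (simp add: q_def matrix_vector_mult_scaleR power2_eq_square)
    finally show ?thesis using False by (simp add: field_simps)
  qed simp
  with m(1) show ?thesis using that by blast
qed

subsection \<open>Triangulated closed surfaces\<close>

text \<open>The vertices are the unit vectors, so the barycentric coordinates of a point are its own
  coordinates. Which faces contain a point can be read off from its nonzero coordinates.\<close>

lemma mem_standard_simplex:
  fixes f :: "'v::finite set"
  shows "y \<in> convex hull ((\<lambda>i. axis i 1 :: real^'v) ` f) \<longleftrightarrow>
    (\<forall>i. 0 \<le> y $ i) \<and> (\<forall>i. i \<notin> f \<longrightarrow> y $ i = 0) \<and> (\<Sum>i\<in>f. y $ i) = 1"
proof
  let ?C = "{y :: real^'v. (\<forall>i. 0 \<le> y $ i) \<and> (\<forall>i. i \<notin> f \<longrightarrow> y $ i = 0) \<and> (\<Sum>i\<in>f. y $ i) = 1}"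
  assume "y \<in> convex hull ((\<lambda>i. axis i 1) ` f)"
  moreover have "convex hull ((\<lambda>i. axis i 1) ` f) \<subseteq> ?C"
  proof (rule hull_minimal)
    show "(\<lambda>i. axis i 1) ` f \<subseteq> ?C" by (auto simp: axis_def)
    show "convex ?C"
      by (auto simp: convex_def sum.distrib simp flip: sum_distrib_left)
  qed
  ultimately show "(\<forall>i. 0 \<le> y $ i) \<and> (\<forall>i. i \<notin> f \<longrightarrow> y $ i = 0) \<and> (\<Sum>i\<in>f. y $ i) = 1"
    by blast
next
  assume y: "(\<forall>i. 0 \<le> y $ i) \<and> (\<forall>i. i \<notin> f \<longrightarrow> y $ i = 0) \<and> (\<Sum>i\<in>f. y $ i) = 1"
  have "(\<Sum>i\<in>f. y $ i *\<^sub>R axis i 1) \<in> convex hull ((\<lambda>i. axis i 1 :: real^'v) ` f)"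
    using y by (intro convex_sum) (auto intro: hull_inc)
  moreover have "(\<Sum>i\<in>f. y $ i *\<^sub>R axis i 1) = y"
    using y by (auto simp: vec_eq_iff axis_def if_distrib[of "\<lambda>x. _ * x"] cong: if_cong)
  ultimately show "y \<in> convex hull ((\<lambda>i. axis i 1) ` f)" by simp
qed

text \<open>The chart maps onto the whole plane, so its inverse \<open>g\<close> is total. This
  provides maps between plane sets, to which invariance of domain applies.\<close>

lemma closed_surface_chart:
  fixes R :: "'a::t2_space set"
  assumes S: "closed_surface S" and hom: "top_of_set R homeomorphic_space S" and "x \<in> R"
  obtains O' \<psi> g where "open O'" "x \<in> O'" "homeomorphism (R \<inter> O') (UNIV :: (real^2) set) \<psi> g"
proof -
  obtain h where h: "homeomorphic_map (top_of_set R) S h"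
    using hom homeomorphic_space by blast
  then have "h x \<in> topspace S"
    using homeomorphic_imp_surjective_map \<open>x \<in> R\<close> by fastforce
  then obtain U where U: "openin S U" "h x \<in> U"
    and chart: "subtopology S U homeomorphic_space (euclidean :: (real^2) topology)"
    using S unfolding closed_surface_def by blast
  have "continuous_map (top_of_set R) S h" using h by (simp add: homeomorphic_imp_continuous_map)
  then have "openin (top_of_set R) {y \<in> topspace (top_of_set R). h y \<in> U}"
    using U by (intro openin_continuous_map_preimage)
  then obtain O' where O': "open O'" "{y \<in> R. h y \<in> U} = R \<inter> O'"
    by (auto simp: openin_open)
  have "homeomorphic_map (subtopology (top_of_set R) (R \<inter> O')) (subtopology S U) h"
    by (rule homeomorphic_map_subtopologies_alt[OF h]) (use O' in auto)
  then have "subtopology (top_of_set R) (R \<inter> O') homeomorphic_space subtopology S U"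
    using homeomorphic_space by blast
  then have "top_of_set (R \<inter> O') homeomorphic_space (euclidean :: (real^2) topology)"
    using chart by (simp add: subtopology_subtopology homeomorphic_space_trans)
  then obtain \<psi> g where "homeomorphic_maps (top_of_set (R \<inter> O')) (euclidean :: (real^2) topology) \<psi> g"
    unfolding homeomorphic_space_def by blast
  then have "homeomorphism (R \<inter> O') UNIV \<psi> g"
    unfolding homeomorphic_maps_def
    by (intro homeomorphismI) (auto simp: continuous_map_in_subtopology)
  then show ?thesis using that O' U \<open>x \<in> R\<close> by blast
qed

lemma open_plane_below:
  fixes T :: "(real^2) set"
  assumes "open T" "0 \<in> T"
  shows "\<exists>z\<in>T. z $ 2 < 0"
proof -
  obtain e where e: "e > 0" "ball 0 e \<subseteq> T" using assms open_contains_ball by blast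
  have "- (e / 2) *\<^sub>R axis 2 1 \<in> T" using e by (intro subsetD[OF e(2)]) (auto simp: dist_norm)
  then show ?thesis using e by (intro bexI[of _ "- (e / 2) *\<^sub>R axis 2 1"]) auto
qed

lemma third_vertex:
  assumes "card f = 3" "{a, b} \<subseteq> f" "a \<noteq> b"
  obtains c where "f = {a, b, c}" "c \<noteq> a" "c \<noteq> b"
proof -
  have "finite f" using assms(1) by (simp add: card_ge_0_finite)
  then have "card (f - {a, b}) = 1" using assms by (simp add: card_Diff_subset)
  then obtain c where "f - {a, b} = {c}" by (rule card_1_singletonE)
  then show ?thesis using that assms by blast
qed

context
  fixes F :: "'v::finite set set" and S :: "'s topology"
  assumes S: "closed_surface S" and hom: "top_of_set (realization F) homeomorphic_space S"
    and card3: "\<forall>f\<in>F. card f = 3"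
begin

text \<open>
  If an edge lies in a single triangle, then a neighbourhood of its midpoint embeds in a half
  plane as an open set of the plane which meets the boundary line.
\<close>

lemma edge_in_second_face:
  assumes ab: "a \<noteq> b" and f: "f \<in> F" "{a, b} \<subseteq> f"
  shows "\<exists>f'\<in>F. {a, b} \<subseteq> f' \<and> f' \<noteq> f"
proof (rule ccontr)
  assume "\<not> ?thesis"
  then have only: "f' = f" if "f' \<in> F" "a \<in> f'" "b \<in> f'" for f' using that by auto
  obtain c where c: "f = {a, b, c}" "c \<noteq> a" "c \<noteq> b" using third_vertex card3 f ab by metis
  define x :: "real^'v" where "x = (\<chi> i. if i = a \<or> i = b then 1/2 else 0)"
  have "x \<in> realization F" unfolding realization_def UN_iff mem_standard_simplex
    using f ab c by (intro bexI[of _ f]) (auto simp: x_def)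
  then obtain O' \<psi> g where O': "open O'" "x \<in> O'"
    and \<psi>: "homeomorphism (realization F \<inter> O') (UNIV :: (real^2) set) \<psi> g"
    using closed_surface_chart[OF S hom] by metis
  have gR: "g z \<in> realization F" for z using \<psi> by (auto simp: homeomorphism_def)
  have contg: "continuous_on UNIV g" and \<psi>g: "\<And>z. \<psi> (g z) = z"
    using \<psi> by (auto simp: homeomorphism_def)
  have g\<psi>: "g (\<psi> x) = x" using \<psi> O' \<open>x \<in> realization F\<close> by (auto simp: homeomorphism_def)
  \<comment> \<open>Points with positive coordinates at \<open>a\<close> and \<open>b\<close> lie
    only in faces containing both vertices, hence only in \<open>f\<close>.\<close>
  define V where "V = {z. 0 < g z $ a \<and> 0 < g z $ b}"
  have "open V" unfolding V_def
    by (intro open_Collect_conj open_Collect_less continuous_intros contg)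
  \<comment> \<open>The triangle \<open>f\<close> is laid out linearly in the plane, with the edge
    \<open>ab\<close> on the horizontal axis and \<open>c\<close> above it.\<close>
  define p :: "real^2 \<Rightarrow> real^2" where "p z = (\<chi> i. if i = 1 then g z $ a - g z $ b else g z $ c)" for z
  have coords: "(\<forall>i. 0 \<le> g z $ i) \<and> (\<forall>i. i \<notin> f \<longrightarrow> g z $ i = 0) \<and> g z $ a + g z $ b + g z $ c = 1"
    if "z \<in> V" for z
  proof -
    obtain f' where f': "f' \<in> F" "(\<forall>i. 0 \<le> g z $ i) \<and> (\<forall>i. i \<notin> f' \<longrightarrow> g z $ i = 0) \<and> (\<Sum>i\<in>f'. g z $ i) = 1"
      using gR[of z] unfolding realization_def UN_iff mem_standard_simplex by blast
    moreover have "a \<in> f'" "b \<in> f'" using f'(2) that unfolding V_def by force+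
    ultimately have "f' = f" using only by blast
    then show ?thesis using f' c ab by auto
  qed
  have "inj_on p V"
  proof (rule inj_onI)
    fix z z' assume z: "z \<in> V" "z' \<in> V" "p z = p z'"
    then have "p z $ 1 = p z' $ 1" "p z $ 2 = p z' $ 2" by simp_all
    then have "g z $ a - g z $ b = g z' $ a - g z' $ b" "g z $ c = g z' $ c"
      by (simp_all add: p_def)
    moreover note coords[OF z(1)] coords[OF z(2)]
    ultimately have "g z $ i = g z' $ i" for i
      using c by (cases "i \<in> f") auto
    then have "g z = g z'" by (simp add: vec_eq_iff)
    then show "z = z'" using \<psi>g by metis
  qed
  moreover have "continuous_on V p" unfolding p_def
  proof (intro continuous_on_vec_lambda)
    fix i :: 2
    show "continuous_on V (\<lambda>z. if i = 1 then g z $ a - g z $ b else g z $ c)"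
      by (cases "i = 1") (auto intro!: continuous_intros continuous_on_subset[OF contg subset_UNIV])
  qed
  ultimately have "open (p ` V)" using \<open>open V\<close> by (intro invariance_of_domain)
  moreover have "x $ a = 1/2" "x $ b = 1/2" "x $ c = 0"
    using c by (simp_all add: x_def)
  then have "p (\<psi> x) = 0" "\<psi> x \<in> V"
    by (simp_all add: V_def p_def g\<psi> vec_eq_iff)
  then have "0 \<in> p ` V" by (metis imageI)
  ultimately obtain z where "z \<in> V" "p z $ 2 < 0" using open_plane_below by blast
  then show False using coords[of z] by (auto simp: p_def not_le[symmetric])
qed

text \<open>
  If an edge lies in three triangles, then two of them form an open disc around its midpoint,
  hence by invariance of domain a neighbourhood of the midpoint, which misses the third one.
\<close>

lemma edge_not_in_three_faces:
  assumes ab: "a \<noteq> b" and f: "{a, b} \<subseteq> f1" "{a, b} \<subseteq> f2" "{a, b} \<subseteq> f3"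
    and F: "f1 \<in> F" "f2 \<in> F" "f3 \<in> F" and dist: "f1 \<noteq> f2" "f1 \<noteq> f3" "f2 \<noteq> f3"
  shows False
proof -
  obtain c where c: "f1 = {a, b, c}" "c \<noteq> a" "c \<noteq> b" using third_vertex card3 F f ab by metis
  obtain d where d: "f2 = {a, b, d}" "d \<noteq> a" "d \<noteq> b" using third_vertex card3 F f ab by metis
  obtain e where e: "f3 = {a, b, e}" "e \<noteq> a" "e \<noteq> b" using third_vertex card3 F f ab by metis
  have cde: "c \<noteq> d" "c \<noteq> e" "d \<noteq> e" using c d e dist by auto
  \<comment> \<open>\<open>h\<close> folds the diamond \<open>Q\<close> onto the two triangles,
    upper half into \<open>f1\<close> and lower half into \<open>f2\<close>, with the edge
    \<open>ab\<close> on the horizontal axis. The path \<open>k\<close> leaves the midpoint of the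
    edge towards \<open>e\<close> in \<open>f3\<close>, where the coordinate at \<open>e\<close>
    separates it from the image of \<open>h\<close>.\<close>
  define h :: "real^2 \<Rightarrow> real^'v" where
    "h z = (\<chi> i. if i = a then (1 - \<bar>z $ 2\<bar> + z $ 1) / 2 else if i = b then (1 - \<bar>z $ 2\<bar> - z $ 1) / 2
      else if i = c then max (z $ 2) 0 else if i = d then max (- z $ 2) 0 else 0)" for z
  define k :: "real \<Rightarrow> real^'v" where
    "k t = (\<chi> i. if i = a \<or> i = b then (1 - t) / 2 else if i = e then t else 0)" for t
  have h: "h z $ a = (1 - \<bar>z $ 2\<bar> + z $ 1) / 2" "h z $ b = (1 - \<bar>z $ 2\<bar> - z $ 1) / 2"
    "h z $ c = max (z $ 2) 0" "h z $ d = max (- z $ 2) 0" "h z $ e = 0" for z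
    using ab c d e cde by (auto simp: h_def)
  define Q where "Q = {z :: real^2. \<bar>z $ 1\<bar> + \<bar>z $ 2\<bar> < 1}"
  have hR: "h z \<in> realization F" if "z \<in> Q" for z
  proof (cases "z $ 2 \<ge> 0")
    case True
    have "h z \<in> convex hull ((\<lambda>i. axis i 1) ` f1)" unfolding mem_standard_simplex
    proof (intro conjI allI impI)
      show "0 \<le> h z $ i" for i using that by (auto simp: h_def Q_def)
      show "h z $ i = 0" if "i \<notin> f1" for i using that True c d by (auto simp: h_def)
      show "(\<Sum>i\<in>f1. h z $ i) = 1" using True ab c by (simp add: h field_simps)
    qed
    then show ?thesis using F by (auto simp: realization_def)
  next
    case False
    have "h z \<in> convex hull ((\<lambda>i. axis i 1) ` f2)" unfolding mem_standard_simplex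
    proof (intro conjI allI impI)
      show "0 \<le> h z $ i" for i using that by (auto simp: h_def Q_def)
      show "h z $ i = 0" if "i \<notin> f2" for i using that False c d by (auto simp: h_def)
      show "(\<Sum>i\<in>f2. h z $ i) = 1" using False ab d by (simp add: h field_simps)
    qed
    then show ?thesis using F by (auto simp: realization_def)
  qed
  have kR: "k t \<in> realization F" if "0 \<le> t" "t < 1" for t
  proof -
    have "k t \<in> convex hull ((\<lambda>i. axis i 1) ` f3)" unfolding mem_standard_simplex
    proof (intro conjI allI impI)
      show "0 \<le> k t $ i" for i using that by (auto simp: k_def)
      show "k t $ i = 0" if "i \<notin> f3" for i using that e by (auto simp: k_def)
      show "(\<Sum>i\<in>f3. k t $ i) = 1" using ab e by (simp add: k_def)
    qed
    then show ?thesis using F by (auto simp: realization_def)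
  qed
  have hk: "h 0 = k 0" using ab c d e cde by (auto simp: h_def k_def vec_eq_iff)
  have "0 \<in> Q" by (simp add: Q_def)
  obtain O' \<psi> g where O': "open O'" "h 0 \<in> O'"
    and \<psi>: "homeomorphism (realization F \<inter> O') (UNIV :: (real^2) set) \<psi> g"
    using closed_surface_chart[OF S hom hR[OF \<open>0 \<in> Q\<close>]] by metis
  have cont\<psi>: "continuous_on (realization F \<inter> O') \<psi>" using \<psi> by (simp add: homeomorphism_def)
  have inj\<psi>: "y = y'" if "\<psi> y = \<psi> y'" "y \<in> realization F \<inter> O'" "y' \<in> realization F \<inter> O'" for y y'
    using \<psi> that unfolding homeomorphism_def by metis
  have conth: "continuous_on UNIV h" unfolding h_def
  proof (intro continuous_on_vec_lambda)
    fix i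
    show "continuous_on UNIV (\<lambda>z :: real^2. if i = a then (1 - \<bar>z $ 2\<bar> + z $ 1) / 2 else if i = b then (1 - \<bar>z $ 2\<bar> - z $ 1) / 2
      else if i = c then max (z $ 2) 0 else if i = d then max (- z $ 2) 0 else 0)"
      by (cases "i = a"; cases "i = b"; cases "i = c"; cases "i = d") (auto intro!: continuous_intros)
  qed
  define Q0 where "Q0 = Q \<inter> h -` O'"
  have "open Q" unfolding Q_def by (intro open_Collect_less continuous_intros)
  then have "open Q0" unfolding Q0_def using conth O'(1) by (intro open_Int open_vimage)
  have hW: "h z \<in> realization F \<inter> O'" if "z \<in> Q0" for z
    using that hR by (auto simp: Q0_def)
  have "continuous_on Q0 (\<psi> \<circ> h)"
    using conth cont\<psi> hW by (intro continuous_on_compose)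
      (auto elim: continuous_on_subset)
  moreover have "inj_on (\<psi> \<circ> h) Q0"
  proof (rule inj_onI)
    fix z z' assume "z \<in> Q0" "z' \<in> Q0" "(\<psi> \<circ> h) z = (\<psi> \<circ> h) z'"
    then have "h z = h z'" using inj\<psi> hW by simp
    then have "h z $ c - h z $ d = h z' $ c - h z' $ d" "h z $ a - h z $ b = h z' $ a - h z' $ b" by simp_all
    then have "z $ 2 = z' $ 2" "z $ 1 = z' $ 1" unfolding h by (auto simp: max_def field_simps split: if_splits)
    then show "z = z'" by (simp add: vec_eq_iff forall_2)
  qed
  ultimately have op: "open ((\<psi> \<circ> h) ` Q0)" using \<open>open Q0\<close> by (intro invariance_of_domain)
  have "continuous_on UNIV k" unfolding k_def
  proof (intro continuous_on_vec_lambda)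
    fix i
    show "continuous_on UNIV (\<lambda>t::real. if i = a \<or> i = b then (1 - t) / 2 else if i = e then t else 0)"
      by (cases "i = a \<or> i = b"; cases "i = e") (auto intro!: continuous_intros)
  qed
  then have "(k \<longlongrightarrow> k 0) (at_right 0)"
    by (simp add: continuous_on_eq_continuous_at isCont_def filterlim_at_split)
  then have limk: "(k \<longlongrightarrow> h 0) (at_right 0)" by (simp add: hk)
  have evt: "eventually (\<lambda>t::real. 0 < t \<and> t < 1) (at_right 0)"
    by (rule eventually_at_rightI[of 0 1]) auto
  moreover have "eventually (\<lambda>t. k t \<in> O') (at_right 0)"
    using limk O' topological_tendstoD by blast
  ultimately have evW: "eventually (\<lambda>t. k t \<in> realization F \<inter> O') (at_right 0)"
    by eventually_elim (use kR in auto)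
  have "((\<lambda>t. \<psi> (k t)) \<longlongrightarrow> \<psi> (h 0)) (at_right 0)"
    using O' hR[OF \<open>0 \<in> Q\<close>] by (intro continuous_on_tendsto_compose[OF cont\<psi> limk _ evW]) auto
  moreover have "\<psi> (h 0) \<in> (\<psi> \<circ> h) ` Q0" using O' \<open>0 \<in> Q\<close> by (auto simp: Q0_def)
  ultimately have "eventually (\<lambda>t. \<psi> (k t) \<in> (\<psi> \<circ> h) ` Q0) (at_right 0)"
    using op topological_tendstoD by blast
  with evt evW have "eventually (\<lambda>t. False) (at_right (0::real))"
  proof eventually_elim
    case (elim t)
    then obtain z where "z \<in> Q0" "\<psi> (k t) = \<psi> (h z)" by auto
    then have "k t = h z" using inj\<psi> hW elim by blast
    then have "k t $ e = h z $ e" by simp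
    then show False using elim e by (simp add: h k_def)
  qed
  then show False by simp
qed

lemma card_faces_at_edge:
  assumes ab: "a \<noteq> b" and f: "f \<in> F" "{a, b} \<subseteq> f"
  shows "card {f \<in> F. {a, b} \<subseteq> f} = 2"
proof -
  obtain f' where f': "f' \<in> F" "{a, b} \<subseteq> f'" "f' \<noteq> f" using edge_in_second_face[OF assms] by blast
  have "{f \<in> F. {a, b} \<subseteq> f} = {f, f'}"
    using f f' edge_not_in_three_faces[OF ab] by auto
  then show ?thesis using f'(3) by simp
qed

text \<open>Incident pairs of an edge and a face are counted in two ways: three edges per face, two
  faces per edge.\<close>

lemma faces_edges_count:
  assumes E: "E = {e. card e = 2 \<and> (\<exists>f\<in>F. e \<subseteq> f)}"
  shows "3 * card F = 2 * card E"
proof -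
  have "(\<Sum>f\<in>F. card {e \<in> E. e \<subseteq> f}) = 2 * card E"
  proof (rule sum_multicount)
    show "\<forall>e\<in>E. card {f \<in> F. e \<subseteq> f} = 2"
    proof
      fix e assume "e \<in> E"
      then obtain a b f where "e = {a, b}" "a \<noteq> b" "f \<in> F" "e \<subseteq> f"
        unfolding E by (auto simp: card_2_iff)
      then show "card {f \<in> F. e \<subseteq> f} = 2" using card_faces_at_edge by blast
    qed
  qed auto
  moreover have "card {e \<in> E. e \<subseteq> f} = 3" if "f \<in> F" for f
  proof -
    have "{e \<in> E. e \<subseteq> f} = {e. e \<subseteq> f \<and> card e = 2}" using that by (auto simp: E)
    then show ?thesis using n_subsets[of f 2] card3 that by (simp add: choose_two)
  qed
  ultimately show ?thesis by simp
qed

end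

text \<open>The sum of the coordinates in \<open>A\<close> is continuous and equals 1 on a face
  inside \<open>A\<close> and 0 on a face disjoint from it. If \<open>A\<close> were proper, both
  values would occur, and by connectedness so would 1/2.\<close>

lemma connected_realization_faces:
  fixes F :: "'v::finite set set"
  assumes conn: "connected (realization F)" and cover: "\<Union>F = UNIV"
    and A: "\<And>f. f \<in> F \<Longrightarrow> f \<subseteq> A \<or> f \<inter> A = {}" and "a \<in> A"
  shows "A = UNIV"
proof (rule ccontr)
  assume "A \<noteq> UNIV"
  then obtain b where b: "b \<notin> A" by blast
  define \<phi> :: "real^'v \<Rightarrow> real" where "\<phi> y = (\<Sum>i\<in>A. y $ i)" for y
  have "continuous_on (realization F) \<phi>" unfolding \<phi>_def by (intro continuous_intros)
  then have "connected (\<phi> ` realization F)" by (rule connected_continuous_image[OF _ conn])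
  moreover have ax: "axis i 1 \<in> realization F" for i
  proof -
    have "i \<in> \<Union>F" using cover by simp
    then obtain f where "f \<in> F" "i \<in> f" by blast
    moreover from \<open>i \<in> f\<close> have "axis i 1 \<in> convex hull ((\<lambda>i. axis i 1 :: real^'v) ` f)"
      by (intro hull_inc imageI)
    ultimately show ?thesis unfolding realization_def by blast
  qed
  have "\<phi> (axis a 1) = 1" "\<phi> (axis b 1) = 0"
    using \<open>a \<in> A\<close> b by (simp_all add: \<phi>_def axis_def)
  then have "1 \<in> \<phi> ` realization F" "0 \<in> \<phi> ` realization F" using ax by (metis imageI)+
  ultimately have "{0..1} \<subseteq> \<phi> ` realization F" by (intro connected_contains_Icc)
  then have "1/2 \<in> \<phi> ` realization F" by (rule subsetD) auto
  then obtain y where y: "\<phi> y = 1/2" "y \<in> realization F" by auto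
  then obtain f where f: "f \<in> F" "y \<in> convex hull ((\<lambda>i. axis i 1) ` f)"
    unfolding realization_def by blast
  then have yf: "\<forall>i. i \<notin> f \<longrightarrow> y $ i = 0" "(\<Sum>i\<in>f. y $ i) = 1"
    unfolding mem_standard_simplex by auto
  from A[OF f(1)] have "\<phi> y = 1 \<or> \<phi> y = 0"
  proof
    assume "f \<subseteq> A"
    then have "\<phi> y = (\<Sum>i\<in>f. y $ i)" unfolding \<phi>_def using yf by (intro sum.mono_neutral_right) auto
    then show ?thesis using yf by simp
  next
    assume "f \<inter> A = {}"
    then have "\<phi> y = 0" unfolding \<phi>_def using yf by (intro sum.neutral) auto
    then show ?thesis ..
  qed
  then show False using y by simp
qed

subsection \<open>A triangle with circles at its vertices\<close>

text \<open>Sixteen times the squared area of the triangle with squared side lengths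
  \<open>p\<close>, \<open>q\<close>, \<open>w\<close>.\<close>

definition heron :: "real \<Rightarrow> real \<Rightarrow> real \<Rightarrow> real" where
  "heron p q w = 4 * w * q - (w + q - p)\<^sup>2"

lemma heron_perm: "heron p q w = heron q p w" "heron p q w = heron p w q"
  by (simp_all add: heron_def power2_eq_square algebra_simps)

lemma heron_triangle:
  fixes a b c :: real
  assumes "0 < a" "0 < b" "0 < c" "c < a + b" "b < a + c" "a < b + c"
  shows "0 < heron (c\<^sup>2) (b\<^sup>2) (a\<^sup>2)"
proof -
  have "heron (c\<^sup>2) (b\<^sup>2) (a\<^sup>2) = (a + b + c) * (a + b - c) * (a + c - b) * (b + c - a)"
    by (simp add: heron_def power2_eq_square algebra_simps)
  also have "\<dots> > 0" using assms by (intro mult_pos_pos) auto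
  finally show ?thesis .
qed

text \<open>
  In terms of squared side lengths: \<open>p\<close> is opposite to the angle, \<open>w\<close> and \<open>q\<close> are adjacent to it.
\<close>

definition cos_angle :: "real \<Rightarrow> real \<Rightarrow> real \<Rightarrow> real" where
  "cos_angle p q w = (w + q - p) / (2 * sqrt w * sqrt q)"

lemma one_minus_cos_angle_sq:
  assumes "0 < q" "0 < w"
  shows "1 - (cos_angle p q w)\<^sup>2 = heron p q w / (4 * w * q)"
  using assms by (simp add: cos_angle_def heron_def power_divide power_mult_distrib field_simps)

lemma cos_angle_bounds:
  assumes "0 < q" "0 < w" "0 < heron p q w"
  shows "- 1 < cos_angle p q w" "cos_angle p q w < 1"
    and "sqrt (1 - (cos_angle p q w)\<^sup>2) = sqrt (heron p q w) / (2 * sqrt w * sqrt q)"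
proof -
  have "0 < 1 - (cos_angle p q w)\<^sup>2"
    unfolding one_minus_cos_angle_sq[OF assms(1,2)] using assms by simp
  then have "(cos_angle p q w)\<^sup>2 < 1" by simp
  then have "\<bar>cos_angle p q w\<bar> < 1" by (simp add: abs_square_less_1)
  then show "- 1 < cos_angle p q w" "cos_angle p q w < 1" by auto
  show "sqrt (1 - (cos_angle p q w)\<^sup>2) = sqrt (heron p q w) / (2 * sqrt w * sqrt q)"
    unfolding one_minus_cos_angle_sq[OF assms(1,2)]
    by (simp add: real_sqrt_divide real_sqrt_mult)
qed

text \<open>For the first two angles \<open>x\<close> and \<open>y\<close>, positivity of
  \<open>sin (x + y)\<close> gives \<open>x + y < pi\<close>. So \<open>x + y\<close> is determined
  by its cosine, which is minus that of the third angle.\<close>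

lemma arccos_sum_triangle:
  assumes pos: "0 < p" "0 < q" "0 < w" and D: "0 < heron p q w"
  shows "arccos (cos_angle p q w) + arccos (cos_angle q p w) + arccos (cos_angle w q p) = pi"
proof -
  define a b c s where "a = sqrt w" and "b = sqrt q" and "c = sqrt p" and "s = sqrt (heron p q w)"
  have abc: "0 < a" "0 < b" "0 < c" "0 < s" "w = a\<^sup>2" "q = b\<^sup>2" "p = c\<^sup>2" "s\<^sup>2 = heron p q w"
    using pos D by (auto simp: a_def b_def c_def s_def)
  have D': "heron q p w = heron p q w" "heron w q p = heron p q w" by (metis heron_perm)+
  define x y where "x = arccos (cos_angle p q w)" and "y = arccos (cos_angle q p w)"
  note bx = cos_angle_bounds[OF pos(2,3) D]
  note byy = cos_angle_bounds[OF pos(1,3) D[folded D'(1)]]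
  note bz = cos_angle_bounds[OF pos(2,1) D[folded D'(2)]]
  have x: "0 < x" "x < pi" "cos x = cos_angle p q w" "sin x = s / (2 * a * b)"
    using bx by (auto simp: x_def arccos_lbound arccos_lt_bounded sin_arccos a_def b_def s_def)
  have y: "0 < y" "y < pi" "cos y = cos_angle q p w" "sin y = s / (2 * a * c)"
    using byy by (auto simp: y_def arccos_lt_bounded sin_arccos a_def c_def s_def D')
  have cx: "cos_angle p q w = (a\<^sup>2 + b\<^sup>2 - c\<^sup>2) / (2 * a * b)"
    and cy: "cos_angle q p w = (a\<^sup>2 + c\<^sup>2 - b\<^sup>2) / (2 * a * c)"
    and cz: "cos_angle w q p = (c\<^sup>2 + b\<^sup>2 - a\<^sup>2) / (2 * c * b)"
    using abc(1-3) unfolding abc(5-7) cos_angle_def by simp_all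
  have "sin (x + y) = s / (2 * b * c)"
    unfolding sin_add x y cx cy using abc(1-4) by (simp add: field_simps power2_eq_square)
  then have "0 < sin (x + y)" using abc by simp
  then have lt: "x + y < pi" using sin_le_zero[of "x + y"] x y by force
  have s2: "s * s = 4 * a\<^sup>2 * b\<^sup>2 - (a\<^sup>2 + b\<^sup>2 - c\<^sup>2)\<^sup>2"
    using abc(8) unfolding heron_def abc(5-7) by (simp add: power2_eq_square)
  have "cos (x + y) = ((a\<^sup>2 + b\<^sup>2 - c\<^sup>2) * (a\<^sup>2 + c\<^sup>2 - b\<^sup>2) - s * s) / (4 * a\<^sup>2 * b * c)"
    unfolding cos_add x y cx cy using abc(1-4) by (simp add: field_simps power2_eq_square)
  also have "(a\<^sup>2 + b\<^sup>2 - c\<^sup>2) * (a\<^sup>2 + c\<^sup>2 - b\<^sup>2) - s * s = - 2 * a\<^sup>2 * (c\<^sup>2 + b\<^sup>2 - a\<^sup>2)"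
    unfolding s2 by (simp add: power2_eq_square algebra_simps)
  also have "\<dots> / (4 * a\<^sup>2 * b * c) = - cos_angle w q p"
    unfolding cz using abc(1-3) by (simp add: field_simps)
  finally have "x + y = arccos (- cos_angle w q p)"
    using arccos_cos[of "x + y"] x y lt by simp
  also have "\<dots> = pi - arccos (cos_angle w q p)"
    using bz by (intro arccos_minus) auto
  finally show ?thesis by (simp add: x_def y_def)
qed

text \<open>The differentiated law of cosines in squared lengths; the denominator is four times the
  area.\<close>

lemma has_derivative_arccos_cos_angle:
  fixes P Q W :: "'a::real_normed_vector \<Rightarrow> real"
  assumes P: "(P has_derivative P') (at u)" and Q: "(Q has_derivative Q') (at u)"
    and W: "(W has_derivative W') (at u)"
    and pos: "0 < Q u" "0 < W u" and D: "0 < heron (P u) (Q u) (W u)"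
  shows "((\<lambda>u. arccos (cos_angle (P u) (Q u) (W u))) has_derivative
    (\<lambda>h. (P' h - (P u + Q u - W u) / (2 * Q u) * Q' h - (P u + W u - Q u) / (2 * W u) * W' h)
          / sqrt (heron (P u) (Q u) (W u)))) (at u)"
proof -
  note b = cos_angle_bounds[OF pos D]
  define a c where "a = sqrt (W u)" and "c = sqrt (Q u)"
  have ac: "0 < a" "0 < c" "W u = a\<^sup>2" "Q u = c\<^sup>2" using pos by (auto simp: a_def c_def)
  have s: "((\<lambda>u. sqrt (W u)) has_derivative (\<lambda>h. W' h / (2 * a))) (at u)"
    "((\<lambda>u. sqrt (Q u)) has_derivative (\<lambda>h. Q' h / (2 * c))) (at u)"
    unfolding a_def c_def using pos by (auto intro!: derivative_eq_intros W Q simp: field_simps)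
  have N: "((\<lambda>u. W u + Q u - P u) has_derivative (\<lambda>h. W' h + Q' h - P' h)) (at u)"
    by (intro derivative_intros W Q P)
  have M: "((\<lambda>u. 2 * sqrt (W u) * sqrt (Q u)) has_derivative
      (\<lambda>h. 2 * a * (Q' h / (2 * c)) + 2 * (W' h / (2 * a)) * c)) (at u)"
    using has_derivative_mult[OF has_derivative_mult_right[OF s(1), of 2] s(2)]
    by (simp add: a_def c_def)
  have "((W' + Q' - P') * (2 * a * c) - (a\<^sup>2 + c\<^sup>2 - p) * (2 * a * (Q' / (2 * c)) + 2 * (W' / (2 * a)) * c))
        / (2 * a * c * (2 * a * c))
      = - (P' - (p + c\<^sup>2 - a\<^sup>2) / (2 * c\<^sup>2) * Q' - (p + a\<^sup>2 - c\<^sup>2) / (2 * a\<^sup>2) * W') / (2 * a * c)"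
    for P' Q' W' p
    using ac(1,2) by (simp add: field_simps power2_eq_square)
  with has_derivative_divide'[OF N M]
  have "((\<lambda>u. cos_angle (P u) (Q u) (W u)) has_derivative
      (\<lambda>h. - (P' h - (P u + Q u - W u) / (2 * Q u) * Q' h - (P u + W u - Q u) / (2 * W u) * W' h)
          / (2 * a * c))) (at u)"
    using ac(1,2) unfolding cos_angle_def by (simp add: a_def[symmetric] c_def[symmetric] ac(3,4))
  from DERIV_compose_FDERIV[OF DERIV_arccos[OF b(1,2)] this]
  show ?thesis
    by (rule has_derivative_eq_rhs)
      (use ac(1,2) D in \<open>simp add: fun_eq_iff b(3) a_def[symmetric] c_def[symmetric] field_simps\<close>)
qed

text \<open>
  The derivative of the angle at \<open>i\<close> in a triangle \<open>ijk\<close> with respect to the conformal factor at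
  \<open>j\<close>, where \<open>x, y, z\<close> are the squared radii at \<open>i, j, k\<close>. It equals \<open>h / l\<close>, where \<open>l\<close> is the
  length of the edge \<open>ij\<close> and \<open>h\<close> the signed distance of the power centre from it.
\<close>

definition conductance :: "real \<Rightarrow> real \<Rightarrow> real \<Rightarrow> real \<Rightarrow> real \<Rightarrow> real \<Rightarrow> real" where
  "conductance p q w x y z =
     (w * (p + q - w) + y * (w + q - p) + x * (w + p - q) - 2 * w * z) / (2 * w * sqrt (heron p q w))"

text \<open>The symmetry of the matrix of angle derivatives within one triangle: exchanging
  \<open>i\<close> and \<open>j\<close> exchanges \<open>p\<close> with \<open>q\<close> and
  \<open>x\<close> with \<open>y\<close>.\<close>

lemma conductance_sym: "conductance p q w x y z = conductance q p w y x z"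
  by (simp add: conductance_def heron_perm(1)[of p] algebra_simps)

text \<open>The brackets are the derivatives of the three squared lengths in direction
  \<open>h\<close>. Only differences of \<open>hi\<close>, \<open>hj\<close>, \<open>hk\<close>
  survive, as angles are invariant under scaling.\<close>

lemma angle_derivative_identity:
  assumes "0 < q" "0 < w"
  shows "(((p + y - z) * hj + (p + z - y) * hk) - (p + q - w) / (2 * q) * ((q + x - z) * hi + (q + z - x) * hk)
      - (p + w - q) / (2 * w) * ((w + x - y) * hi + (w + y - x) * hj)) / sqrt (heron p q w)
    = conductance p q w x y z * (hj - hi) + conductance p w q x z y * (hk - hi)"
proof -
  have "((p + y - z) * hj + (p + z - y) * hk) - (p + q - w) / (2 * q) * ((q + x - z) * hi + (q + z - x) * hk)
      - (p + w - q) / (2 * w) * ((w + x - y) * hi + (w + y - x) * hj)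
    = (w * (p + q - w) + y * (w + q - p) + x * (w + p - q) - 2 * w * z) / (2 * w) * (hj - hi)
      + (q * (p + w - q) + z * (q + w - p) + x * (q + p - w) - 2 * q * y) / (2 * q) * (hk - hi)"
    using assms by (simp add: field_simps)
  then show ?thesis
    unfolding conductance_def heron_perm(2)[of p w q] by (simp add: add_divide_distrib)
qed

text \<open>
  Up to a positive factor, the expression is minus the power of the power centre with respect to
  the circumcircle. As a polynomial in the radii and the weights it has positive coefficients.
\<close>

lemma power_center_inside_circumcircle:
  fixes a b c I1 I2 I3 :: real
  assumes pos: "0 < a" "0 < b" "0 < c" "0 < I1" "0 < I2" "0 < I3"
    and p: "p = b\<^sup>2 + c\<^sup>2 + 2 * I1 * b * c" and q: "q = a\<^sup>2 + c\<^sup>2 + 2 * I2 * a * c"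
    and w: "w = a\<^sup>2 + b\<^sup>2 + 2 * I3 * a * b"
  shows "0 < p * q * w - p * (a\<^sup>2 - b\<^sup>2) * (a\<^sup>2 - c\<^sup>2) - q * (b\<^sup>2 - a\<^sup>2) * (b\<^sup>2 - c\<^sup>2)
             - w * (c\<^sup>2 - a\<^sup>2) * (c\<^sup>2 - b\<^sup>2)" (is "0 < ?E")
proof -
  have "?E = 8 * a\<^sup>2 * b\<^sup>2 * c\<^sup>2 * (1 + I1 * I2 * I3)
      + 4 * I1 * b * c * a\<^sup>2 * (b\<^sup>2 + c\<^sup>2) + 4 * I2 * a * c * b\<^sup>2 * (a\<^sup>2 + c\<^sup>2) + 4 * I3 * a * b * c\<^sup>2 * (a\<^sup>2 + b\<^sup>2)
      + 4 * I1 * I2 * a * b * c\<^sup>2 * (a\<^sup>2 + b\<^sup>2) + 4 * I1 * I3 * a * c * b\<^sup>2 * (a\<^sup>2 + c\<^sup>2)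
      + 4 * I2 * I3 * b * c * a\<^sup>2 * (b\<^sup>2 + c\<^sup>2)"
    unfolding p q w by (simp add: power2_eq_square algebra_simps)
  also have "\<dots> > 0"
    using pos by (intro add_pos_pos mult_pos_pos) auto
  finally show ?thesis .
qed

text \<open>The first expression is the principal minor of the Laplacian of the triangle with edge
  weights \<alpha>, \<beta>, \<gamma>; up to positive factors it is the power of the power centre,
  with the sign reversed. The second is twice the area of the triangle, since the triangles spanned
  by the power centre and the sides have signed areas adding up to it.\<close>

lemma conductance_minor_pos:
  fixes a b c I1 I2 I3 :: real
  assumes pos: "0 < a" "0 < b" "0 < c" "0 < I1" "0 < I2" "0 < I3"
    and p: "p = b\<^sup>2 + c\<^sup>2 + 2 * I1 * b * c" and q: "q = a\<^sup>2 + c\<^sup>2 + 2 * I2 * a * c"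
    and w: "w = a\<^sup>2 + b\<^sup>2 + 2 * I3 * a * b" and D: "0 < heron p q w"
    and \<alpha>: "\<alpha> = conductance p q w (a\<^sup>2) (b\<^sup>2) (c\<^sup>2)"
    and \<beta>: "\<beta> = conductance p w q (a\<^sup>2) (c\<^sup>2) (b\<^sup>2)"
    and \<gamma>: "\<gamma> = conductance q w p (b\<^sup>2) (c\<^sup>2) (a\<^sup>2)"
  shows "0 < \<alpha> * \<beta> + \<alpha> * \<gamma> + \<beta> * \<gamma>" and "0 < w * \<alpha> + q * \<beta> + p * \<gamma>"
proof -
  have pqw: "0 < p" "0 < q" "0 < w" unfolding p q w using pos by (auto intro!: add_pos_pos mult_pos_pos)
  define s where "s = sqrt (heron p q w)"
  have s: "0 < s" "s * s = heron p q w" using D by (auto simp: s_def)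
  define x y z where "x = a\<^sup>2" and "y = b\<^sup>2" and "z = c\<^sup>2"
  define n1 where "n1 = w * (p + q - w) + y * (w + q - p) + x * (w + p - q) - 2 * w * z"
  define n2 where "n2 = q * (p + w - q) + z * (q + w - p) + x * (q + p - w) - 2 * q * y"
  define n3 where "n3 = p * (q + w - p) + z * (p + w - q) + y * (p + q - w) - 2 * p * x"
  have h: "heron p w q = heron p q w" "heron q w p = heron p q w" by (metis heron_perm)+
  have n: "\<alpha> = n1 / (2 * w * s)" "\<beta> = n2 / (2 * q * s)" "\<gamma> = n3 / (2 * p * s)"
    by (simp_all add: \<alpha> \<beta> \<gamma> conductance_def h s_def n1_def n2_def n3_def x_def y_def z_def)
  have "w * \<alpha> + q * \<beta> + p * \<gamma> = (n1 + n2 + n3) / (2 * s)"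
    unfolding n using pqw s by (simp add: field_simps)
  also have "n1 + n2 + n3 = heron p q w"
    unfolding n1_def n2_def n3_def heron_def by (simp add: power2_eq_square algebra_simps)
  finally show "0 < w * \<alpha> + q * \<beta> + p * \<gamma>" using D s by simp
  define E where "E = p * q * w - p * (x - y) * (x - z) - q * (y - x) * (y - z) - w * (z - x) * (z - y)"
  have E: "0 < E"
    unfolding E_def x_def y_def z_def by (rule power_center_inside_circumcircle[OF pos p q w])
  have "n1 = 2 * w * s * \<alpha>" "n2 = 2 * q * s * \<beta>" "n3 = 2 * p * s * \<gamma>"
    unfolding n using pqw s(1) by simp_all
  then have "n1 * n2 * p + n1 * n3 * q + n2 * n3 * w
      = (4 * p * q * w * (s * s)) * (\<alpha> * \<beta> + \<alpha> * \<gamma> + \<beta> * \<gamma>)"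
    by (simp add: distrib_left mult_ac)
  then have "(4 * p * q * w * (s * s)) * (\<alpha> * \<beta> + \<alpha> * \<gamma> + \<beta> * \<gamma>)
      = n1 * n2 * p + n1 * n3 * q + n2 * n3 * w" by (rule sym)
  also have "\<dots> = heron p q w * E"
    unfolding n1_def n2_def n3_def heron_def E_def by (simp add: power2_eq_square algebra_simps)
  also have "\<dots> > 0" by (rule mult_pos_pos[OF D E])
  finally have "0 < (4 * p * q * w * (s * s)) * (\<alpha> * \<beta> + \<alpha> * \<gamma> + \<beta> * \<gamma>)" .
  moreover have "0 < 4 * p * q * w * (s * s)" using pqw s(1) by simp
  ultimately show "0 < \<alpha> * \<beta> + \<alpha> * \<gamma> + \<beta> * \<gamma>"
    by (metis zero_less_mult_pos)
qed

text \<open>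
  The squared side lengths \<open>w, q, p\<close> enter as a test: summed over the coordinates of the
  vertices, the quadratic form takes the positive value \<open>w \<alpha> + q \<beta> + p \<gamma>\<close>, which excludes
  a negative definite form.
\<close>

lemma triangle_form_pos:
  fixes \<alpha> \<beta> \<gamma> :: real
  assumes minor: "0 < \<alpha> * \<beta> + \<alpha> * \<gamma> + \<beta> * \<gamma>" and test: "0 < w * \<alpha> + q * \<beta> + p * \<gamma>"
    and "0 < w" "0 < q" "0 < heron p q w"
  shows "0 \<le> \<alpha> * (hi - hj)\<^sup>2 + \<beta> * (hi - hk)\<^sup>2 + \<gamma> * (hj - hk)\<^sup>2" (is "0 \<le> ?f")
    and "\<alpha> * (hi - hj)\<^sup>2 + \<beta> * (hi - hk)\<^sup>2 + \<gamma> * (hj - hk)\<^sup>2 = 0 \<Longrightarrow> hi = hj \<and> hi = hk"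
proof -
  define \<delta> where "\<delta> = \<alpha> * \<beta> + \<alpha> * \<gamma> + \<beta> * \<gamma>"
  \<comment> \<open>The squared norm of \<open>(\<alpha> + \<gamma>) a - \<gamma> b\<close> for the
    edge vectors \<open>a\<close>, \<open>b\<close> from \<open>i\<close> to \<open>j\<close> and
    \<open>k\<close>, of squared lengths \<open>w\<close> and \<open>q\<close>. It is the completed
    square in \<open>sq\<close>, summed over the vertex coordinates.\<close>
  define B where "B = (\<alpha> + \<gamma>)\<^sup>2 * w - \<gamma> * (\<alpha> + \<gamma>) * (w + q - p) + \<gamma>\<^sup>2 * q"
  have "4 * w * B = (2 * w * (\<alpha> + \<gamma>) - \<gamma> * (w + q - p))\<^sup>2 + \<gamma>\<^sup>2 * heron p q w"
    by (simp add: B_def heron_def power2_eq_square algebra_simps)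
  also have "\<dots> \<ge> 0" using assms(5) by simp
  finally have "0 \<le> B" using \<open>0 < w\<close> by (simp add: zero_le_mult_iff)
  moreover have "(\<alpha> + \<gamma>) * (w * \<alpha> + q * \<beta> + p * \<gamma>) = B + \<delta> * q"
    by (simp add: B_def \<delta>_def power2_eq_square algebra_simps)
  ultimately have "0 < (\<alpha> + \<gamma>) * (w * \<alpha> + q * \<beta> + p * \<gamma>)"
    using minor \<open>0 < q\<close> by (simp add: \<delta>_def add_nonneg_pos)
  then have ag: "0 < \<alpha> + \<gamma>" using test by (simp add: zero_less_mult_iff)
  have sq: "(\<alpha> + \<gamma>) * ?f = ((\<alpha> + \<gamma>) * (hi - hj) - \<gamma> * (hi - hk))\<^sup>2 + \<delta> * (hi - hk)\<^sup>2"
    by (simp add: \<delta>_def power2_eq_square algebra_simps)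
  have "0 \<le> (\<alpha> + \<gamma>) * ?f" unfolding sq using minor by (simp add: \<delta>_def)
  then show "0 \<le> ?f" using ag by (simp add: zero_le_mult_iff)
  assume "?f = 0"
  then have z: "((\<alpha> + \<gamma>) * (hi - hj) - \<gamma> * (hi - hk))\<^sup>2 + \<delta> * (hi - hk)\<^sup>2 = 0" using sq by simp
  moreover have "0 \<le> \<delta> * (hi - hk)\<^sup>2" using minor by (simp add: \<delta>_def)
  ultimately have "\<delta> * (hi - hk)\<^sup>2 = 0"
    using zero_le_power2[of "(\<alpha> + \<gamma>) * (hi - hj) - \<gamma> * (hi - hk)"] by linarith
  then have "hi = hk" using minor by (simp add: \<delta>_def)
  then show "hi = hj \<and> hi = hk" using z ag by simp
qed

subsection \<open>Curvature of a circle packing\<close>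

lemma has_derivative_vec:
  fixes f :: "'a::real_normed_vector \<Rightarrow> real^'n"
  assumes "\<And>i. ((\<lambda>x. f x $ i) has_derivative (\<lambda>h. f' h $ i)) (at a)"
  shows "(f has_derivative f') (at a)"
  unfolding has_derivative_componentwise_within[of f] using assms
  by (auto simp: Basis_vec_def inner_axis)

text \<open>\<open>connected_faces\<close> is the form in which connectedness enters the kernel
  computation, where \<open>A\<close> is a level set of a vector in the kernel.\<close>

locale circle_packing =
  fixes F :: "'v::finite set set" and I :: "'v set \<Rightarrow> real" and r :: "'v \<Rightarrow> real"
  assumes card_face: "f \<in> F \<Longrightarrow> card f = 3"
    and weight_pos: "f \<in> F \<Longrightarrow> e \<subseteq> f \<Longrightarrow> card e = 2 \<Longrightarrow> 0 < I e"
    and radius_pos: "0 < r i"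
    and connected_faces: "a \<in> A \<Longrightarrow> (\<And>f. f \<in> F \<Longrightarrow> f \<subseteq> A \<or> f \<inter> A = {}) \<Longrightarrow> A = UNIV"
begin

abbreviation "\<Omega> \<equiv> admissible F I r"
abbreviation "R \<equiv> scaled_radius r"

text \<open>Over ordered triples, so that every face is counted six times.\<close>

definition face_sum :: "('v \<Rightarrow> 'v \<Rightarrow> 'v \<Rightarrow> real) \<Rightarrow> real" where
  "face_sum g = (\<Sum>i\<in>UNIV. \<Sum>j\<in>UNIV. \<Sum>k\<in>UNIV. if {i, j, k} \<in> F then g i j k else 0)"

lemma face_sum_swap12: "face_sum (\<lambda>i j k. g j i k) = face_sum g"
  unfolding face_sum_def by (subst sum.swap) (simp add: insert_commute)

lemma face_sum_swap23: "face_sum (\<lambda>i j k. g i k j) = face_sum g"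
proof -
  have "(\<Sum>j\<in>UNIV. \<Sum>k\<in>UNIV. if {i, j, k} \<in> F then g i k j else 0)
      = (\<Sum>j\<in>UNIV. \<Sum>k\<in>UNIV. if {i, j, k} \<in> F then g i j k else 0)" for i
    by (subst sum.swap) (simp add: insert_commute)
  then show ?thesis by (simp add: face_sum_def)
qed

lemma face_sum_rotate: "face_sum (\<lambda>i j k. g j k i) = face_sum g"
  using face_sum_swap12[of "\<lambda>i j k. g i k j"] face_sum_swap23[of g] by simp

lemma face_sum_add: "face_sum (\<lambda>i j k. f i j k + g i j k) = face_sum f + face_sum g"
  unfolding face_sum_def sum.distrib[symmetric] by (intro sum.cong refl) simp

lemma face_sum_cong: "(\<And>i j k. {i, j, k} \<in> F \<Longrightarrow> f i j k = g i j k) \<Longrightarrow> face_sum f = face_sum g"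
  unfolding face_sum_def by (intro sum.cong refl) auto

lemma face_sum_nonneg: "(\<And>i j k. {i, j, k} \<in> F \<Longrightarrow> 0 \<le> g i j k) \<Longrightarrow> 0 \<le> face_sum g"
  unfolding face_sum_def by (intro sum_nonneg) auto

lemma face_sum_eq_0D:
  assumes "face_sum g = 0" "\<And>i j k. {i, j, k} \<in> F \<Longrightarrow> 0 \<le> g i j k" "{i, j, k} \<in> F"
  shows "g i j k = 0"
proof -
  let ?h = "\<lambda>i j k. if {i, j, k} \<in> F then g i j k else 0"
  have nn: "0 \<le> ?h i j k" for i j k using assms(2) by simp
  have "(\<Sum>j\<in>UNIV. \<Sum>k\<in>UNIV. ?h i j k) = 0"
    using assms(1) nn unfolding face_sum_def by (simp add: sum_nonneg_eq_0_iff sum_nonneg del: if_split)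
  then have "(\<Sum>k\<in>UNIV. ?h i j k) = 0"
    using nn by (simp add: sum_nonneg_eq_0_iff sum_nonneg del: if_split)
  then have "?h i j k = 0"
    using nn by (simp add: sum_nonneg_eq_0_iff del: if_split)
  then show ?thesis using assms(3) by simp
qed

text \<open>A face at \<open>i\<close> arises from exactly two ordered pairs of its other
  vertices.\<close>

lemma sum_faces_at:
  fixes g :: "'v set \<Rightarrow> real"
  shows "(\<Sum>f | f \<in> F \<and> i \<in> f. g f)
    = (\<Sum>j\<in>UNIV. \<Sum>k\<in>UNIV. if {i, j, k} \<in> F then g {i, j, k} else 0) / 2"
proof -
  let ?P = "{x \<in> UNIV \<times> UNIV. {i, fst x, snd x} \<in> F}" and ?G = "{f. f \<in> F \<and> i \<in> f}"
  have "(\<Sum>j\<in>UNIV. \<Sum>k\<in>UNIV. if {i, j, k} \<in> F then g {i, j, k} else 0)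
      = (\<Sum>x\<in>UNIV \<times> UNIV. if {i, fst x, snd x} \<in> F then g {i, fst x, snd x} else 0)"
    by (simp add: sum.cartesian_product case_prod_unfold)
  also have "\<dots> = (\<Sum>x\<in>?P. g {i, fst x, snd x})" by (simp add: sum.If_cases Collect_conj_eq)
  also have "\<dots> = (\<Sum>f\<in>?G. \<Sum>x\<in>{x \<in> ?P. {i, fst x, snd x} = f}. g {i, fst x, snd x})"
    by (rule sum.group[symmetric]) auto
  also have "\<dots> = (\<Sum>f\<in>?G. 2 * g f)"
  proof (rule sum.cong[OF refl])
    fix f assume f: "f \<in> ?G"
    then have "card (f - {i}) = 2" using card_face by (simp add: card_Diff_singleton)
    then obtain a b where ab: "f - {i} = {a, b}" "a \<noteq> b" by (auto simp: card_2_iff)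
    then have fab: "f = {i, a, b}" "i \<noteq> a" "i \<noteq> b" using f by auto
    have pairs: "{i, c, d} = f \<longleftrightarrow> c = a \<and> d = b \<or> c = b \<and> d = a" for c d
    proof
      assume eq: "{i, c, d} = f"
      have "a \<in> {i, c, d}" "b \<in> {i, c, d}" unfolding eq fab(1) by auto
      then show "c = a \<and> d = b \<or> c = b \<and> d = a" using fab(2,3) ab(2) by blast
    next
      assume "c = a \<and> d = b \<or> c = b \<and> d = a"
      then show "{i, c, d} = f" unfolding fab(1) by blast
    qed
    have "{x \<in> ?P. {i, fst x, snd x} = f} = {x. {i, fst x, snd x} = f}" using f by auto
    also have "\<dots> = {(a, b), (b, a)}" unfolding pairs by (auto simp: prod_eq_iff)
    finally have "{x \<in> ?P. {i, fst x, snd x} = f} = {(a, b), (b, a)}" .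
    then show "(\<Sum>x\<in>{x \<in> ?P. {i, fst x, snd x} = f}. g {i, fst x, snd x}) = 2 * g f"
      using ab(2) fab(1) by (simp add: insert_commute)
  qed
  finally show ?thesis by (simp add: sum_distrib_left[symmetric])
qed

lemma face_sum_1: "face_sum (\<lambda>i j k. 1) = 6 * real (card F)"
proof -
  have "face_sum (\<lambda>i j k. 1) = (\<Sum>i\<in>UNIV. 2 * real (card {f \<in> F. i \<in> f}))"
  proof -
    have "(\<Sum>j\<in>UNIV. \<Sum>k\<in>UNIV. if {i, j, k} \<in> F then 1 else 0) = 2 * real (card {f \<in> F. i \<in> f})" for i
      using sum_faces_at[of "\<lambda>f. 1" i] by simp
    then show ?thesis by (simp add: face_sum_def)
  qed
  also have "\<dots> = 2 * real (\<Sum>i\<in>UNIV. card {f \<in> F. i \<in> f})" by (simp add: sum_distrib_left)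
  also have "(\<Sum>i\<in>UNIV. card {f \<in> F. i \<in> f}) = 3 * card F"
    by (rule sum_multicount) (auto simp: card_face)
  finally show ?thesis by simp
qed

lemma face_distinct:
  assumes "{i, j, k} \<in> F" shows "i \<noteq> j" "i \<noteq> k" "j \<noteq> k"
  using card_face[OF assms] by (auto simp: card_insert_if split: if_splits)

lemma face_perm:
  assumes "{i, j, k} \<in> F" shows "{i, k, j} \<in> F" "{j, i, k} \<in> F" "{j, k, i} \<in> F" "{k, i, j} \<in> F" "{k, j, i} \<in> F"
  using assms by (simp_all add: insert_commute)

lemma R_pos: "0 < R u i" by (simp add: scaled_radius_def radius_pos)

section \<open>Side lengths, angles and the total curvature\<close>

definition sq_length :: "real^'v \<Rightarrow> 'v \<Rightarrow> 'v \<Rightarrow> real" where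
  "sq_length u i j = (R u i)\<^sup>2 + (R u j)\<^sup>2 + 2 * I {i, j} * R u i * R u j"

lemma sq_length_commute: "sq_length u i j = sq_length u j i"
  by (simp add: sq_length_def insert_commute)

lemma edge_length_sq_length: "edge_length I r u i j = sqrt (sq_length u i j)"
  by (simp add: edge_length_def sq_length_def)

lemma face_weight_pos:
  assumes "{i, j, k} \<in> F" shows "0 < I {i, j}"
  using assms face_distinct[OF assms] by (intro weight_pos[of "{i, j, k}"]) auto

lemma sq_length_pos:
  assumes "{i, j, k} \<in> F" shows "0 < sq_length u i j"
  unfolding sq_length_def using face_weight_pos[OF assms] R_pos[of u i] R_pos[of u j]
  by (intro add_pos_pos mult_pos_pos zero_less_power) auto

lemma heron_pos:
  assumes u: "u \<in> \<Omega>" and f: "{i, j, k} \<in> F"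
  shows "0 < heron (sq_length u j k) (sq_length u i k) (sq_length u i j)"
proof -
  have pos: "0 < sq_length u j k" "0 < sq_length u i k" "0 < sq_length u i j" using face_perm[OF f] f sq_length_pos by blast+
  have tri: "edge_length I r u b c < edge_length I r u a b + edge_length I r u a c" if "{a, b, c} \<in> F" for a b c
    using u that by (simp add: admissible_def)
  have "0 < heron ((edge_length I r u j k)\<^sup>2) ((edge_length I r u i k)\<^sup>2) ((edge_length I r u i j)\<^sup>2)"
    using tri[OF f] tri[of j i k] tri[of k i j] face_perm[OF f] pos
    by (intro heron_triangle) (auto simp: edge_length_sq_length sq_length_commute)
  then show ?thesis using pos by (simp add: edge_length_sq_length)
qed

definition angle :: "real^'v \<Rightarrow> 'v \<Rightarrow> 'v \<Rightarrow> 'v \<Rightarrow> real" where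
  "angle u i j k = arccos (cos_angle (sq_length u j k) (sq_length u i k) (sq_length u i j))"

lemma curvature_angle:
  "curvature F I r u $ i = 2 * pi - (\<Sum>j\<in>UNIV. \<Sum>k\<in>UNIV. if {i, j, k} \<in> F then angle u i j k else 0) / 2"
proof -
  have "face_angle I r u {i, j, k} i = angle u i j k" if "{i, j, k} \<in> F" for j k
    using sq_length_pos[of i j k u] sq_length_pos[of i k j u] sq_length_pos[of j k i u] that face_perm[OF that]
    by (simp add: face_angle_eq[OF card_face[OF that]] triangle_angle_def edge_length_sq_length angle_def cos_angle_def)
  then have "(\<Sum>j\<in>UNIV. \<Sum>k\<in>UNIV. if {i, j, k} \<in> F then face_angle I r u {i, j, k} i else 0)
      = (\<Sum>j\<in>UNIV. \<Sum>k\<in>UNIV. if {i, j, k} \<in> F then angle u i j k else 0)"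
    by (intro sum.cong refl) auto
  then show ?thesis by (simp add: curvature_def sum_faces_at)
qed

lemma angle_sum:
  assumes "u \<in> \<Omega>" "{i, j, k} \<in> F"
  shows "angle u i j k + angle u j i k + angle u k j i = pi"
  using arccos_sum_triangle[of "sq_length u j k" "sq_length u i k" "sq_length u i j"] heron_pos[OF assms]
    sq_length_pos[of i j k u] sq_length_pos[of i k j u] sq_length_pos[of j k i u] assms(2) face_perm[OF assms(2)]
  by (simp add: angle_def sq_length_commute[of u j i] sq_length_commute[of u k i] sq_length_commute[of u k j])

lemma curvature_sum:
  assumes "u \<in> \<Omega>"
  shows "(\<Sum>i\<in>UNIV. curvature F I r u $ i) = 2 * pi * real CARD('v) - pi * real (card F)"
proof -
  have "face_sum (angle u) + face_sum (\<lambda>i j k. angle u j i k) + face_sum (\<lambda>i j k. angle u k j i)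
      = face_sum (\<lambda>i j k. angle u i j k + angle u j i k + angle u k j i)"
    by (simp only: face_sum_add)
  also have "\<dots> = face_sum (\<lambda>i j k. pi * 1)" using angle_sum[OF assms] by (intro face_sum_cong) simp
  also have "\<dots> = pi * face_sum (\<lambda>i j k. 1)"
    unfolding face_sum_def sum_distrib_left by (intro sum.cong refl) simp
  finally have "face_sum (angle u) + face_sum (\<lambda>i j k. angle u j i k) + face_sum (\<lambda>i j k. angle u k j i) = 6 * pi * real (card F)"
    by (simp add: face_sum_1)
  moreover have "face_sum (\<lambda>i j k. angle u j i k) = face_sum (angle u)" by (rule face_sum_swap12)
  moreover have "face_sum (\<lambda>i j k. angle u k j i) = face_sum (angle u)"
    using face_sum_swap12[of "\<lambda>i j k. angle u k i j"] face_sum_rotate[of "\<lambda>i j k. angle u j k i"] face_sum_rotate[of "angle u"] by simp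
  ultimately have "face_sum (angle u) = 2 * pi * real (card F)" by simp
  then show ?thesis
    unfolding curvature_angle face_sum_def by (simp add: sum_subtractf flip: sum_divide_distrib)
qed

section \<open>The derivative of the curvature\<close>

definition edge_conductance :: "real^'v \<Rightarrow> 'v \<Rightarrow> 'v \<Rightarrow> 'v \<Rightarrow> real" where
  "edge_conductance u i j k = conductance (sq_length u j k) (sq_length u i k) (sq_length u i j) ((R u i)\<^sup>2) ((R u j)\<^sup>2) ((R u k)\<^sup>2)"

lemma edge_conductance_sym: "edge_conductance u i j k = edge_conductance u j i k"
  unfolding edge_conductance_def by (subst conductance_sym) (simp add: sq_length_commute)

lemma has_derivative_R: "((\<lambda>u. R u i) has_derivative (\<lambda>h. R u i * h $ i)) (at u)"
  unfolding scaled_radius_def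
  by (auto intro!: derivative_eq_intros bounded_linear.has_derivative[OF bounded_linear_vec_nth])

text \<open>Since \<open>R u i\<close> has derivative \<open>R u i * h $ i\<close>, the coefficient
  at \<open>h $ i\<close> is \<open>2 R_i^2 + 2 I R_i R_j\<close>, rewritten through the squared
  length.\<close>

lemma has_derivative_sq_length:
  "((\<lambda>u. sq_length u i j) has_derivative (\<lambda>h. (sq_length u i j + (R u i)\<^sup>2 - (R u j)\<^sup>2) * h $ i
      + (sq_length u i j + (R u j)\<^sup>2 - (R u i)\<^sup>2) * h $ j)) (at u)"
  unfolding sq_length_def
  by (rule has_derivative_eq_rhs, (rule derivative_eq_intros has_derivative_R refl)+)
    (simp add: fun_eq_iff power2_eq_square algebra_simps)

lemma has_derivative_angle:
  assumes u: "u \<in> \<Omega>" and f: "{i, j, k} \<in> F"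
  shows "((\<lambda>u. angle u i j k) has_derivative
    (\<lambda>h. edge_conductance u i j k * (h $ j - h $ i) + edge_conductance u i k j * (h $ k - h $ i))) (at u)"
proof -
  have pos: "0 < sq_length u i k" "0 < sq_length u i j" using face_perm[OF f] f sq_length_pos by blast+
  show ?thesis
    using has_derivative_arccos_cos_angle[OF has_derivative_sq_length[of j k u] has_derivative_sq_length[of i k u]
        has_derivative_sq_length[of i j u] pos heron_pos[OF u f]]
    unfolding angle_def[abs_def] angle_derivative_identity[OF pos] by (simp add: edge_conductance_def sq_length_commute[of u k j])
qed

definition laplacian :: "real^'v \<Rightarrow> real^'v \<Rightarrow> real^'v" where
  "laplacian u h = (\<chi> i. - (\<Sum>j\<in>UNIV. \<Sum>k\<in>UNIV. if {i, j, k} \<in> F then edge_conductance u i j k * (h $ j - h $ i) else 0))"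

text \<open>Each angle at \<open>i\<close> responds to both \<open>j\<close> and \<open>k\<close>.
  Exchanging these names identifies the two contributions, which cancels the factor 1/2 from
  counting ordered pairs.\<close>

lemma has_derivative_curvature:
  assumes u: "u \<in> \<Omega>"
  shows "(curvature F I r has_derivative laplacian u) (at u)"
proof (rule has_derivative_vec)
  fix i
  let ?c = "\<lambda>h j k. edge_conductance u i j k * (h $ j - h $ i)"
  have "((\<lambda>u. if {i, j, k} \<in> F then angle u i j k else 0) has_derivative
      (\<lambda>h. if {i, j, k} \<in> F then ?c h j k + ?c h k j else 0)) (at u)" for j k
    using has_derivative_angle[OF u] by (cases "{i, j, k} \<in> F") auto
  then have "((\<lambda>u. curvature F I r u $ i) has_derivative (\<lambda>h. 0 -
      (\<Sum>j\<in>UNIV. \<Sum>k\<in>UNIV. if {i, j, k} \<in> F then ?c h j k + ?c h k j else 0) / 2)) (at u)"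
    unfolding curvature_angle divide_inverse
    by (intro has_derivative_diff has_derivative_const has_derivative_mult_left has_derivative_sum)
  moreover have "(\<Sum>j\<in>UNIV. \<Sum>k\<in>UNIV. if {i, j, k} \<in> F then ?c h j k + ?c h k j else 0)
      = 2 * (\<Sum>j\<in>UNIV. \<Sum>k\<in>UNIV. if {i, j, k} \<in> F then ?c h j k else 0)" for h :: "real^'v"
  proof -
    have "(\<Sum>j\<in>UNIV. \<Sum>k\<in>UNIV. if {i, j, k} \<in> F then ?c h j k + ?c h k j else 0)
      = (\<Sum>j\<in>UNIV. \<Sum>k\<in>UNIV. if {i, j, k} \<in> F then ?c h j k else 0)
        + (\<Sum>j\<in>UNIV. \<Sum>k\<in>UNIV. if {i, j, k} \<in> F then ?c h k j else 0)"
      unfolding sum.distrib[symmetric] by (intro sum.cong refl) simp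
    also have "(\<Sum>j\<in>UNIV. \<Sum>k\<in>UNIV. if {i, j, k} \<in> F then ?c h k j else 0)
      = (\<Sum>j\<in>UNIV. \<Sum>k\<in>UNIV. if {i, j, k} \<in> F then ?c h j k else 0)"
      by (subst sum.swap) (simp add: insert_commute)
    finally show ?thesis by simp
  qed
  ultimately show "((\<lambda>u. curvature F I r u $ i) has_derivative (\<lambda>h. laplacian u h $ i)) (at u)"
    by (simp add: laplacian_def)
qed

abbreviation "L \<equiv> curvature_jacobian F I r"

lemma L_entry:
  assumes u: "u \<in> \<Omega>"
  shows "L u $ i $ j = laplacian u (axis j 1) $ i"
proof -
  have "((\<lambda>t. u + t *\<^sub>R axis j 1) has_derivative (\<lambda>t. t *\<^sub>R axis j 1)) (at 0)"
    by (auto intro!: derivative_eq_intros)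
  from has_derivative_compose[OF this, of "curvature F I r" "laplacian u"]
  have "((\<lambda>t. curvature F I r (u + t *\<^sub>R axis j 1)) has_derivative (\<lambda>t. laplacian u (t *\<^sub>R axis j 1))) (at 0)"
    using has_derivative_curvature[OF u] by simp
  then have "((\<lambda>t. curvature F I r (u + t *\<^sub>R axis j 1) $ i) has_derivative (\<lambda>t. laplacian u (t *\<^sub>R axis j 1) $ i)) (at 0)"
    by (rule bounded_linear.has_derivative[OF bounded_linear_vec_nth])
  moreover have "linear (laplacian u)" using has_derivative_curvature[OF u] by (rule has_derivative_linear)
  then have "laplacian u (t *\<^sub>R axis j 1) $ i = laplacian u (axis j 1) $ i * t" for t by (simp add: linear_scale)
  ultimately have "((\<lambda>t. curvature F I r (u + t *\<^sub>R axis j 1) $ i) has_real_derivative laplacian u (axis j 1) $ i) (at 0)"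
    unfolding has_field_derivative_def by simp
  then show ?thesis by (simp add: curvature_jacobian_def DERIV_imp_deriv)
qed

lemma L_mult:
  assumes u: "u \<in> \<Omega>"
  shows "L u *v h = laplacian u h"
proof -
  have "linear (laplacian u)" using has_derivative_curvature[OF u] by (rule has_derivative_linear)
  then have "(\<lambda>h. matrix (laplacian u) *v h) = laplacian u" by simp
  moreover have "L u = matrix (laplacian u)" by (simp add: vec_eq_iff L_entry[OF u] matrix_def)
  ultimately show ?thesis by metis
qed

text \<open>Discrete integration by parts: the sum is averaged with its copy under the exchange of
  \<open>i\<close> and \<open>j\<close>, which preserves the conductance.\<close>

lemma L_inner:
  assumes u: "u \<in> \<Omega>"
  shows "g \<bullet> (L u *v h) = face_sum (\<lambda>i j k. edge_conductance u i j k * ((g $ i - g $ j) * (h $ i - h $ j))) / 2"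
proof -
  have "g \<bullet> (L u *v h) = face_sum (\<lambda>i j k. edge_conductance u i j k * (g $ i * (h $ i - h $ j)))"
    unfolding L_mult[OF u] inner_vec_def laplacian_def face_sum_def inner_real_def vec_lambda_beta
      sum_negf[symmetric] sum_distrib_left
    by (intro sum.cong refl) (simp add: algebra_simps)
  also have "\<dots> = (face_sum (\<lambda>i j k. edge_conductance u i j k * (g $ i * (h $ i - h $ j)))
      + face_sum (\<lambda>i j k. edge_conductance u j i k * (g $ j * (h $ j - h $ i)))) / 2"
    using face_sum_swap12[of "\<lambda>i j k. edge_conductance u i j k * (g $ i * (h $ i - h $ j))"] by simp
  also have "\<dots> = face_sum (\<lambda>i j k. edge_conductance u i j k * ((g $ i - g $ j) * (h $ i - h $ j))) / 2"
    unfolding face_sum_add[symmetric]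
    by (intro arg_cong[where f = "\<lambda>x. x / 2"] face_sum_cong) (simp add: edge_conductance_sym[of u _ _] algebra_simps)
  finally show ?thesis .
qed

section \<open>Positivity and kernel of the Jacobian\<close>

lemma edge_conductance_form:
  assumes u: "u \<in> \<Omega>" and f: "{i, j, k} \<in> F"
  shows "0 \<le> edge_conductance u i j k * (x - y)\<^sup>2 + edge_conductance u i k j * (x - z)\<^sup>2 + edge_conductance u j k i * (y - z)\<^sup>2"
    and "edge_conductance u i j k * (x - y)\<^sup>2 + edge_conductance u i k j * (x - z)\<^sup>2 + edge_conductance u j k i * (y - z)\<^sup>2 = 0 \<Longrightarrow> x = y \<and> x = z"
proof -
  note pf = face_perm[OF f]
  have w: "0 < I {j, k}" "0 < I {i, k}" "0 < I {i, j}"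
    using face_weight_pos f pf by blast+
  have pos: "0 < sq_length u i j" "0 < sq_length u i k" using f pf sq_length_pos by blast+
  have \<alpha>: "edge_conductance u i j k = conductance (sq_length u j k) (sq_length u i k) (sq_length u i j) ((R u i)\<^sup>2) ((R u j)\<^sup>2) ((R u k)\<^sup>2)"
    "edge_conductance u i k j = conductance (sq_length u j k) (sq_length u i j) (sq_length u i k) ((R u i)\<^sup>2) ((R u k)\<^sup>2) ((R u j)\<^sup>2)"
    "edge_conductance u j k i = conductance (sq_length u i k) (sq_length u i j) (sq_length u j k) ((R u j)\<^sup>2) ((R u k)\<^sup>2) ((R u i)\<^sup>2)"
    by (simp_all add: edge_conductance_def sq_length_commute[of u k j] sq_length_commute[of u j i] sq_length_commute[of u k i])
  note minor = conductance_minor_pos[OF R_pos R_pos R_pos w sq_length_def[of u j k] sq_length_def[of u i k] sq_length_def[of u i j]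
      heron_pos[OF u f] \<alpha>]
  note form = triangle_form_pos[OF minor pos heron_pos[OF u f]]
  show "0 \<le> edge_conductance u i j k * (x - y)\<^sup>2 + edge_conductance u i k j * (x - z)\<^sup>2 + edge_conductance u j k i * (y - z)\<^sup>2" by (rule form)
  show "edge_conductance u i j k * (x - y)\<^sup>2 + edge_conductance u i k j * (x - z)\<^sup>2 + edge_conductance u j k i * (y - z)\<^sup>2 = 0 \<Longrightarrow> x = y \<and> x = z"
    by (rule form)
qed

text \<open>Averaging over the three positions of the edge in a face collects its three terms,
  because positivity is available for them together and not for a single conductance.\<close>

lemma L_quadratic:
  assumes u: "u \<in> \<Omega>"
  shows "h \<bullet> (L u *v h) = face_sum (\<lambda>i j k. edge_conductance u i j k * (h $ i - h $ j)\<^sup>2 + edge_conductance u i k j * (h $ i - h $ k)\<^sup>2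
      + edge_conductance u j k i * (h $ j - h $ k)\<^sup>2) / 6"
proof -
  let ?g = "\<lambda>i j k. edge_conductance u i j k * (h $ i - h $ j)\<^sup>2"
  have "face_sum (\<lambda>i j k. ?g i k j) = face_sum ?g" by (rule face_sum_swap23)
  moreover have "face_sum (\<lambda>i j k. ?g j k i) = face_sum ?g" by (rule face_sum_rotate)
  ultimately show ?thesis
    unfolding face_sum_add L_inner[OF u] by (simp add: power2_eq_square)
qed

lemma psd_L:
  assumes u: "u \<in> \<Omega>"
  shows "psd_matrix (L u)"
  unfolding psd_matrix_def
proof
  have sym: "g \<bullet> (L u *v h) = h \<bullet> (L u *v g)" for g h
    unfolding L_inner[OF u] by (simp add: mult.commute)
  have ent: "L u $ i $ j = axis i 1 \<bullet> (L u *v axis j 1)" for i j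
    by (simp add: inner_axis' matrix_vector_mult_basis column_def)
  show "transpose (L u) = L u"
    using sym by (simp add: vec_eq_iff transpose_def ent)
  show "\<forall>x. 0 \<le> x \<bullet> (L u *v x)"
    using edge_conductance_form(1)[OF u] by (simp add: L_quadratic[OF u] face_sum_nonneg)
qed

text \<open>All face terms are nonnegative, so each vanishes and \<open>h\<close> is constant on
  every face. A level set of \<open>h\<close> then meets each face in everything or nothing.\<close>

lemma L_kernel:
  assumes u: "u \<in> \<Omega>" and h: "h \<bullet> (L u *v h) = 0"
  shows "h $ i = h $ j"
proof -
  have face: "h $ a = h $ b" if abf: "f \<in> F" "a \<in> f" "b \<in> f" for a b f
  proof (cases "a = b")
    case False
    have "{a, b} \<subseteq> f" using abf by simp
    then obtain c where c: "f = {a, b, c}" by (rule third_vertex[OF card_face[OF abf(1)] _ False])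
    define q where "q i j k = edge_conductance u i j k * (h $ i - h $ j)\<^sup>2 + edge_conductance u i k j * (h $ i - h $ k)\<^sup>2
      + edge_conductance u j k i * (h $ j - h $ k)\<^sup>2" for i j k
    have "q a b c = 0"
    proof (rule face_sum_eq_0D)
      show "face_sum q = 0" using h unfolding L_quadratic[OF u] q_def[abs_def] by simp
      show "0 \<le> q i j k" if "{i, j, k} \<in> F" for i j k
        unfolding q_def by (rule edge_conductance_form(1)[OF u that])
      show "{a, b, c} \<in> F" using abf(1) c by simp
    qed
    then have "h $ a = h $ b \<and> h $ a = h $ c"
      unfolding q_def using abf(1) c by (intro edge_conductance_form(2)[OF u]) auto
    then show ?thesis by simp
  qed simp
  have "{x. h $ x = h $ j} = UNIV"
  proof (rule connected_faces)
    show "j \<in> {x. h $ x = h $ j}" by simp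
    show "f \<subseteq> {x. h $ x = h $ j} \<or> f \<inter> {x. h $ x = h $ j} = {}" if "f \<in> F" for f
    proof (cases "\<exists>a\<in>f. h $ a = h $ j")
      case True
      then obtain a where a: "a \<in> f" "h $ a = h $ j" by blast
      have "h $ b = h $ j" if "b \<in> f" for b using face[OF \<open>f \<in> F\<close> that a(1)] a(2) by simp
      then show ?thesis by blast
    qed blast
  qed
  then show ?thesis by blast
qed

lemma L_ones: "u \<in> \<Omega> \<Longrightarrow> L u *v 1 = 0"
  by (simp add: L_mult laplacian_def vec_eq_iff cong: if_cong)

lemma L_pos:
  assumes u: "u \<in> \<Omega>" and "1 \<bullet> h = 0" "h \<noteq> 0"
  shows "0 < h \<bullet> (L u *v h)"
proof (rule ccontr)
  assume "\<not> ?thesis"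
  then have "h \<bullet> (L u *v h) = 0" using psd_L[OF u] unfolding psd_matrix_def by (meson linorder_not_less order_antisym)
  then have const: "h $ i = h $ j" for i j using L_kernel[OF u] by blast
  have "h $ j = 0" for j
  proof -
    have "(\<Sum>i\<in>UNIV. h $ i) = (\<Sum>i\<in>(UNIV :: 'v set). h $ j)" by (intro sum.cong refl const)
    then show ?thesis using \<open>1 \<bullet> h = 0\<close> by (simp add: inner_vec_def)
  qed
  then show False using \<open>h \<noteq> 0\<close> by (simp add: vec_eq_iff)
qed

lemma open_admissible: "open \<Omega>"
proof -
  have "\<Omega> = (\<Inter>i. \<Inter>j. \<Inter>k. {u. {i, j, k} \<in> F \<longrightarrow>
      edge_length I r u j k < edge_length I r u i j + edge_length I r u i k})"
    by (auto simp: admissible_def)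
  moreover have "open {u. {i, j, k} \<in> F \<longrightarrow>
      edge_length I r u j k < edge_length I r u i j + edge_length I r u i k}" for i j k
    unfolding edge_length_def scaled_radius_def
    by (cases "{i, j, k} \<in> F") (auto intro!: open_Collect_less continuous_intros)
  ultimately show ?thesis by (simp add: open_INT)
qed

section \<open>Lipschitz dependence on compact sets of admissible points\<close>

context
  fixes S :: "(real^'v) set"
  assumes S: "compact S" "S \<subseteq> \<Omega>"
begin

lemmas lip_intros = lipschitz_map_on_const lipschitz_map_on_add lipschitz_map_on_diff lipschitz_map_on_minus
  lipschitz_map_on_sum lipschitz_map_on_mult[OF S(1)]

lemma lipschitz_R: "lipschitz_map_on S (\<lambda>u. R u i)"
proof -
  have "lipschitz_map_on S (\<lambda>u. u $ i)"
    by (rule lipschitz_map_onI[of _ _ 1]) (simp_all add: component_le_norm_cart flip: vector_minus_component)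
  then show ?thesis unfolding scaled_radius_def
    by (intro lip_intros lipschitz_map_on_exp S)
qed

lemma lipschitz_sq_length: "lipschitz_map_on S (\<lambda>u. sq_length u i j)"
  unfolding sq_length_def power2_eq_square by (intro lip_intros lipschitz_R)

lemma lipschitz_heron: "lipschitz_map_on S (\<lambda>u. heron (sq_length u i j) (sq_length u k l) (sq_length u m n))"
  unfolding heron_def power2_eq_square by (intro lip_intros lipschitz_sq_length)

lemma lipschitz_edge_conductance:
  assumes f: "{i, j, k} \<in> F"
  shows "lipschitz_map_on S (\<lambda>u. edge_conductance u i j k)"
proof -
  have "0 < sq_length u i j" "0 < heron (sq_length u j k) (sq_length u i k) (sq_length u i j)" if "u \<in> S" for u
    using that f S sq_length_pos heron_pos by blast+
  then show ?thesis
    unfolding edge_conductance_def conductance_def divide_inverse power2_eq_square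
    by (intro lip_intros lipschitz_map_on_inverse lipschitz_map_on_sqrt lipschitz_R lipschitz_sq_length
        lipschitz_heron S(1)) auto
qed

lemma lipschitz_angle:
  assumes f: "{i, j, k} \<in> F"
  shows "lipschitz_map_on S (\<lambda>u. angle u i j k)"
proof -
  have pos: "0 < sq_length u i k" "0 < sq_length u i j" for u using face_perm[OF f] f sq_length_pos by blast+
  have h: "0 < heron (sq_length u j k) (sq_length u i k) (sq_length u i j)" if "u \<in> S" for u
    using that f S heron_pos by blast
  have "lipschitz_map_on S (\<lambda>u. cos_angle (sq_length u j k) (sq_length u i k) (sq_length u i j))"
    unfolding cos_angle_def divide_inverse
    by (intro lip_intros lipschitz_map_on_inverse lipschitz_map_on_sqrt lipschitz_sq_length S(1))
      (auto simp: pos)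
  then show ?thesis
    unfolding angle_def using cos_angle_bounds(1,2)[OF pos h] by (intro lipschitz_map_on_arccos S(1)) auto
qed

lemma lipschitz_curvature: "lipschitz_map_on S (curvature F I r)"
proof (rule lipschitz_map_on_vec)
  fix i
  have "lipschitz_map_on S (\<lambda>u. if {i, j, k} \<in> F then angle u i j k else 0)" for j k
    using lipschitz_angle by (cases "{i, j, k} \<in> F") (auto intro: lip_intros)
  then show "lipschitz_map_on S (\<lambda>u. curvature F I r u $ i)"
    unfolding curvature_angle divide_inverse by (intro lip_intros)
qed

lemma lipschitz_L: "lipschitz_map_on S L"
proof (intro lipschitz_map_on_vec)
  fix i j
  have "lipschitz_map_on S (\<lambda>u. if {i, l, k} \<in> F then edge_conductance u i l k * (x l - x i) else 0)" for l k and x :: "'v \<Rightarrow> real"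
    using lipschitz_edge_conductance by (cases "{i, l, k} \<in> F") (auto intro!: lip_intros)
  then have "lipschitz_map_on S (\<lambda>u. laplacian u (axis j 1) $ i)"
    unfolding laplacian_def vec_lambda_beta by (intro lip_intros)
  then show "lipschitz_map_on S (\<lambda>u. L u $ i $ j)"
    unfolding lipschitz_map_on_def lipschitz_on_def using S(2) by (simp add: L_entry subset_iff)
qed

text \<open>Because the kernel does not vary with \<open>u\<close>, compactness bounds all nonzero
  eigenvalues of \<open>L u\<close> away from 0 at once. Scalar Lipschitz continuity on
  \<open>insert 0 {m..M}\<close> then passes to the matrix power.\<close>

lemma lipschitz_fractional_power: "lipschitz_map_on S (\<lambda>u. fractional_power (L u) s)"
proof -
  have cont: "continuous_on S L" by (rule lipschitz_map_on_continuous[OF lipschitz_L])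
  obtain m where m: "0 < m" "\<And>u x. u \<in> S \<Longrightarrow> 1 \<bullet> x = 0 \<Longrightarrow> m * (norm x)\<^sup>2 \<le> x \<bullet> (L u *v x)"
    using quadratic_form_uniform_bound[OF S(1) cont, of 1] L_pos S(2) by (metis subsetD)
  have "bounded (L ` S)" using S(1) cont by (intro compact_imp_bounded compact_continuous_image)
  then obtain M where M: "\<And>u. u \<in> S \<Longrightarrow> norm (L u) \<le> M" unfolding bounded_iff by auto
  obtain C where C: "C-lipschitz_on (insert 0 {m..M}) (\<lambda>x. eigenvalue_power x s)"
    using eigenvalue_power_lipschitz[OF m(1)] unfolding lipschitz_map_on_def by blast
  \<comment> \<open>An eigenvector for a nonzero eigenvalue is orthogonal to the constants by
    symmetry, so the uniform lower bound \<open>m\<close> applies to it.\<close>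
  have spec: "c \<in> insert 0 {m..M}" if u: "u \<in> S" and x: "norm x = 1" "L u *v x = c *\<^sub>R x" for u x c
  proof (cases "c = 0")
    case False
    have u': "u \<in> \<Omega>" using u S by blast
    have "c * (1 \<bullet> x) = 1 \<bullet> (L u *v x)" by (simp add: x)
    also have "\<dots> = (L u *v 1) \<bullet> x"
      using psd_L[OF u'] by (simp add: symmetric_matrix_inner psd_matrix_def)
    also have "\<dots> = 0" by (simp add: L_ones[OF u'])
    finally have "1 \<bullet> x = 0" using False by simp
    from m(2)[OF u this] have "m \<le> c" using x by (simp add: norm_eq_1)
    moreover have "c \<le> norm (L u *v x)" by (simp add: x)
    then have "c \<le> M" using norm_matrix_vector_mult_le[of "L u" x] M[OF u] x by simp
    ultimately show ?thesis by simp
  qed simp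
  obtain D where D: "D-lipschitz_on S L" using lipschitz_L unfolding lipschitz_map_on_def by blast
  have C0: "0 \<le> C" and D0: "0 \<le> D" using C D lipschitz_on_nonneg by blast+
  show ?thesis
  proof (rule lipschitz_map_onI)
    fix u v assume uv: "u \<in> S" "v \<in> S"
    have "norm (fractional_power (L u) s - fractional_power (L v) s) \<le> C * norm (L u - L v)"
      using uv S spec psd_L by (intro fractional_power_lipschitz[OF _ _ _ _ C]) blast+
    also have "\<dots> \<le> C * (D * norm (u - v))"
      by (intro mult_left_mono lipschitz_on_normD[OF D] uv C0)
    finally show "norm (fractional_power (L u) s - fractional_power (L v) s) \<le> (C * D) * norm (u - v)"
      by (simp add: mult.assoc)
  qed (use C0 D0 in simp)
qed

lemma lipschitz_field: "lipschitz_map_on S (fractional_calabi_field F I r s Kbar)"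
  unfolding fractional_calabi_field_def[abs_def] fractional_laplace_op_def
  by (intro lip_intros lipschitz_map_on_bilinear[OF S(1) bounded_bilinear_matrix_vector_mult]
      lipschitz_fractional_power lipschitz_curvature)

end

section \<open>Limits and stability of the flows\<close>

lemma calabi_field_eq:
  assumes "u \<in> \<Omega>"
  shows "calabi_field F I r Kbar u = fractional_calabi_field F I r 1 Kbar u"
  by (simp add: calabi_field_def laplace_op_def fractional_calabi_field_def fractional_laplace_op_def
      fractional_power_1[OF psd_L[OF assms]])

lemma flow_solution_calabi:
  "flow_solution (calabi_field F I r Kbar) \<Omega> J u0 u \<longleftrightarrow> flow_solution (fractional_calabi_field F I r 1 Kbar) \<Omega> J u0 u"
  unfolding flow_solution_def using calabi_field_eq by metis

lemma field_eq_0: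
  assumes u: "u \<in> \<Omega>" and X: "fractional_calabi_field F I r s Kbar u = 0"
    and sum: "(\<Sum>i\<in>UNIV. Kbar $ i) = (\<Sum>i\<in>UNIV. curvature F I r u $ i)"
  shows "curvature F I r u = Kbar"
proof -
  define y where "y = curvature F I r u - Kbar"
  have "1 \<bullet> y = 0" using sum by (simp add: y_def inner_vec_def sum_subtractf)
  have *: "fractional_power (L u) s *v y = 0"
    using X by (simp add: fractional_calabi_field_def fractional_laplace_op_def y_def)
  have "y = 0"
  proof (cases "s = 0")
    case True
    then show ?thesis using * by (simp add: fractional_power_0[OF psd_L[OF u]])
  next
    case False
    then have "L u *v y = 0" using * by (simp add: fractional_power_kernel[OF psd_L[OF u]])
    then have "\<not> 0 < y \<bullet> (L u *v y)" by simp
    then show ?thesis using L_pos[OF u \<open>1 \<bullet> y = 0\<close>] by blast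
  qed
  then show ?thesis by (simp add: y_def)
qed

lemma flow_limit_curvature:
  assumes flow: "flow_solution (fractional_calabi_field F I r s Kbar) \<Omega> {0..} u0 u"
    and lim: "(u \<longlongrightarrow> l) at_top" and l: "l \<in> \<Omega>"
    and sum: "(\<Sum>i\<in>UNIV. Kbar $ i) = (\<Sum>i\<in>UNIV. curvature F I r l $ i)"
  shows "curvature F I r l = Kbar"
proof -
  obtain e where e: "0 < e" "cball l e \<subseteq> \<Omega>" using open_admissible l open_contains_cball by blast
  have "continuous_on (cball l e) (fractional_calabi_field F I r s Kbar)"
    by (intro lipschitz_map_on_continuous lipschitz_field compact_cball e)
  moreover have "l \<in> interior (cball l e)" using e by simp
  ultimately have "isCont (fractional_calabi_field F I r s Kbar) l" by (rule continuous_on_interior)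
  from flow_limit_stationary[OF flow lim this] show ?thesis by (intro field_eq_0 l sum)
qed

text \<open>The sum of the coordinates of \<open>u\<close> is conserved: for
  \<open>s \<noteq> 0\<close> the symmetric matrix \<open>L^s\<close> annihilates the constants, and
  for \<open>s = 0\<close> the claim is that \<open>K - Kbar\<close> has sum zero.\<close>

lemma field_tangent:
  assumes u: "u \<in> \<Omega>" and sum: "(\<Sum>i\<in>UNIV. Kbar $ i) = (\<Sum>i\<in>UNIV. curvature F I r u $ i)"
  shows "1 \<bullet> fractional_calabi_field F I r s Kbar u = 0"
proof -
  define y where "y = curvature F I r u - Kbar"
  have "1 \<bullet> y = 0" using sum by (simp add: y_def inner_vec_def sum_subtractf)
  have "1 \<bullet> (fractional_power (L u) s *v y) = 0"
  proof (cases "s = 0")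
    case True
    then show ?thesis using \<open>1 \<bullet> y = 0\<close> by (simp add: fractional_power_0[OF psd_L[OF u]])
  next
    case False
    have "1 \<bullet> (fractional_power (L u) s *v y) = (fractional_power (L u) s *v 1) \<bullet> y"
      by (rule symmetric_matrix_inner[OF transpose_fractional_power[OF psd_L[OF u]], symmetric])
    also have "fractional_power (L u) s *v 1 = 0"
      using False L_ones[OF u] by (simp add: fractional_power_kernel[OF psd_L[OF u]])
    finally show ?thesis by simp
  qed
  then show ?thesis by (simp add: fractional_calabi_field_def fractional_laplace_op_def y_def)
qed

lemma linearization_pos:
  assumes z: "z \<in> \<Omega>"
  obtains c where "0 < c"
    "\<And>x. 1 \<bullet> x = 0 \<Longrightarrow> c * (norm x)\<^sup>2 \<le> x \<bullet> (fractional_power (L z) s *v (L z *v x))"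
proof -
  let ?M = "fractional_power (L z) s ** L z"
  have pos: "0 < x \<bullet> (?M *v x)" if x: "1 \<bullet> x = 0" "x \<noteq> 0" for x
  proof -
    have "L z *v x \<noteq> 0" using L_pos[OF z x] by auto
    then have "x \<bullet> (fractional_power (L z) s *v (L z *v x)) \<noteq> 0"
      using fractional_power_mult_inner(2)[OF psd_L[OF z]] by blast
    then show ?thesis using fractional_power_mult_inner(1)[OF psd_L[OF z], of x s]
      by (simp add: less_le flip: matrix_vector_mul_assoc)
  qed
  show ?thesis
  \<comment> \<open>With a single base point the family bound becomes a bound for the one matrix
    \<open>?M\<close>.\<close>
  proof (rule quadratic_form_uniform_bound[of "{z}" "\<lambda>_. ?M" 1])
    fix m assume "0 < m" "\<And>u x. u \<in> {z} \<Longrightarrow> 1 \<bullet> x = 0 \<Longrightarrow> m * (norm x)\<^sup>2 \<le> x \<bullet> (?M *v x)"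
    then show ?thesis using that[of m] by (simp add: matrix_vector_mul_assoc)
  qed (auto intro: pos)
qed

text \<open>The deviation from the linearization splits into
  \<open>(B u - B z) *v (K u - K z)\<close>, quadratically small by two Lipschitz bounds, and
  \<open>B z\<close> applied to the Taylor remainder of \<open>K\<close>. Thus Lipschitz continuity
  of \<open>L^s\<close> serves in place of differentiability.\<close>

lemma field_dissipative:
  assumes z: "z \<in> \<Omega>" and Kz: "curvature F I r z = Kbar"
  obtains \<rho> c where "0 < \<rho>" "0 < c" "cball z \<rho> \<subseteq> \<Omega>"
    "\<And>u. u \<in> cball z \<rho> \<Longrightarrow> 1 \<bullet> (u - z) = 0 \<Longrightarrow>
      (u - z) \<bullet> fractional_calabi_field F I r s Kbar u \<le> - c * (norm (u - z))\<^sup>2"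
proof -
  define B where "B u = fractional_power (L u) s" for u
  let ?K = "curvature F I r"
  obtain c where c: "0 < c" "\<And>x. 1 \<bullet> x = 0 \<Longrightarrow> c * (norm x)\<^sup>2 \<le> x \<bullet> (B z *v (L z *v x))"
    using linearization_pos[OF z] unfolding B_def by blast
  obtain e where e: "0 < e" "cball z e \<subseteq> \<Omega>" using open_admissible z open_contains_cball by blast
  obtain CB CK where CB: "CB-lipschitz_on (cball z e) B" and CK: "CK-lipschitz_on (cball z e) ?K"
    using lipschitz_fractional_power[OF compact_cball e(2)] lipschitz_curvature[OF compact_cball e(2)]
    unfolding lipschitz_map_on_def B_def[abs_def] by blast
  have nn: "0 \<le> CB" "0 \<le> CK" using CB CK lipschitz_on_nonneg by blast+
  \<comment> \<open>\<open>\<epsilon>\<close> and \<open>\<rho>\<close> below make each of the two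
    error terms at most \<open>(c / 4) * norm x\<close>, which leaves the rate \<open>c / 2\<close>.
    Adding 1 keeps the denominators positive.\<close>
  define N where "N = norm (B z) + 1"
  have N: "0 < N" "norm (B z) \<le> N" unfolding N_def by (simp_all add: add_nonneg_pos)
  define \<epsilon> where "\<epsilon> = c / (4 * N)"
  have "0 < \<epsilon>" using c(1) N by (simp add: \<epsilon>_def)
  have "norm (B z) * \<epsilon> \<le> N * \<epsilon>" using N \<open>0 < \<epsilon>\<close> by (intro mult_right_mono) auto
  also have "\<dots> = c / 4" using N by (simp add: \<epsilon>_def)
  finally have \<epsilon>: "0 < \<epsilon>" "norm (B z) * \<epsilon> \<le> c / 4" using \<open>0 < \<epsilon>\<close> by simp_all
  obtain d where d: "0 < d" "\<And>u. norm (u - z) < d \<Longrightarrow>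
      norm (?K u - ?K z - L z *v (u - z)) \<le> \<epsilon> * norm (u - z)"
    using has_derivative_curvature[OF z] \<epsilon>(1) unfolding has_derivative_at_alt L_mult[OF z] by blast
  have CBK: "0 < CB * CK + 1" using nn by (simp add: add_nonneg_pos)
  define \<rho> where "\<rho> = min (min e (d / 2)) (c / (4 * (CB * CK + 1)))"
  have \<rho>0: "0 < \<rho>" using e d c(1) CBK by (simp add: \<rho>_def)
  have "\<rho> \<le> d / 2" "\<rho> \<le> c / (4 * (CB * CK + 1))" and \<rho>e: "\<rho> \<le> e"
    unfolding \<rho>_def by linarith+
  then have \<rho>d: "\<rho> < d" and "(CB * CK + 1) * \<rho> \<le> c / 4"
    using d(1) CBK by (linarith, simp add: pos_le_divide_eq mult_ac)
  moreover have "CB * CK * \<rho> \<le> (CB * CK + 1) * \<rho>" using \<rho>0 by (intro mult_right_mono) auto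
  ultimately have \<rho>: "0 < \<rho>" "\<rho> \<le> e" "\<rho> < d" "CB * CK * \<rho> \<le> c / 4"
    using \<rho>0 \<rho>e by linarith+
  have "(u - z) \<bullet> fractional_calabi_field F I r s Kbar u \<le> - (c / 2) * (norm (u - z))\<^sup>2"
    if u: "u \<in> cball z \<rho>" and orth: "1 \<bullet> (u - z) = 0" for u
  proof -
    define x where "x = u - z"
    have x: "norm x \<le> \<rho>" using u by (simp add: x_def dist_norm norm_minus_commute)
    have ue: "u \<in> cball z e" "z \<in> cball z e" using u \<rho> e by auto
    define v where "v = (B u - B z) *v (?K u - ?K z) + B z *v (?K u - ?K z - L z *v x)"
    have "norm v \<le> norm (B u - B z) * norm (?K u - ?K z) + norm (B z) * norm (?K u - ?K z - L z *v x)"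
      unfolding v_def by (intro norm_triangle_le add_mono norm_matrix_vector_mult_le)
    also have "\<dots> \<le> (CB * norm x) * (CK * norm x) + norm (B z) * (\<epsilon> * norm x)"
      using lipschitz_on_normD[OF CB ue] lipschitz_on_normD[OF CK ue] d(2)[of u] x \<rho>(3) nn
      by (intro add_mono mult_mono mult_left_mono) (auto simp: x_def)
    also have "\<dots> = (CB * CK * norm x) * norm x + (norm (B z) * \<epsilon>) * norm x" by simp
    also have "\<dots> \<le> (CB * CK * \<rho>) * norm x + (norm (B z) * \<epsilon>) * norm x"
      using x nn by (intro add_mono mult_right_mono mult_left_mono) auto
    also have "\<dots> \<le> (c / 4) * norm x + (c / 4) * norm x"
      using \<rho>(4) \<epsilon>(2) by (intro add_mono mult_right_mono) auto
    finally have "norm v \<le> (c / 2) * norm x" by simp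
    then have "norm x * norm v \<le> norm x * ((c / 2) * norm x)" by (intro mult_left_mono) auto
    moreover have "\<bar>x \<bullet> v\<bar> \<le> norm x * norm v" by (rule Cauchy_Schwarz_ineq2)
    moreover have "norm x * ((c / 2) * norm x) = (c / 2) * (norm x)\<^sup>2" by (simp add: power2_eq_square)
    ultimately have xv: "- (x \<bullet> v) \<le> (c / 2) * (norm x)\<^sup>2" by linarith
    have "fractional_calabi_field F I r s Kbar u = - (B z *v (L z *v x)) - v"
      by (simp add: fractional_calabi_field_def fractional_laplace_op_def B_def v_def flip: Kz)
        (simp add: algebra_simps)
    then have "x \<bullet> fractional_calabi_field F I r s Kbar u = - (x \<bullet> (B z *v (L z *v x))) - x \<bullet> v"
      by (simp add: inner_diff_right)
    also have "\<dots> \<le> - (c * (norm x)\<^sup>2) + (c / 2) * (norm x)\<^sup>2"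
      using c(2)[of x] orth xv by (simp add: x_def)
    finally show ?thesis by (simp add: x_def)
  qed
  moreover have "cball z \<rho> \<subseteq> \<Omega>" using \<rho>(2) e(2) by (meson subset_cball subset_trans)
  ultimately show ?thesis using that[of \<rho> "c / 2"] \<rho>(1) c(1) by simp
qed

lemma local_convergence:
  assumes z: "z \<in> \<Omega>" and Kz: "curvature F I r z = Kbar"
  shows "\<exists>\<rho>>0. \<forall>u0. norm (u0 - z) < \<rho> \<and> (\<Sum>i\<in>UNIV. u0 $ i) = (\<Sum>i\<in>UNIV. z $ i) \<longrightarrow>
    global_exponential_convergence (fractional_calabi_field F I r s Kbar) \<Omega> u0 z"
proof -
  let ?X = "fractional_calabi_field F I r s Kbar"
  obtain \<rho> c where \<rho>: "0 < \<rho>" "0 < c" "cball z \<rho> \<subseteq> \<Omega>"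
    and dissip: "\<And>u. u \<in> cball z \<rho> \<Longrightarrow> 1 \<bullet> (u - z) = 0 \<Longrightarrow> (u - z) \<bullet> ?X u \<le> - c * (norm (u - z))\<^sup>2"
    using field_dissipative[OF z Kz] by blast
  obtain L where L: "L-lipschitz_on (cball z \<rho>) ?X"
    using lipschitz_field[OF compact_cball \<rho>(3)] unfolding lipschitz_map_on_def by blast
  have tangent: "1 \<bullet> ?X u = 0" if "u \<in> \<Omega>" for u
    using curvature_sum[OF that] curvature_sum[OF z] by (intro field_tangent that) (simp flip: Kz)
  have "global_exponential_convergence ?X \<Omega> u0 z"
    if "norm (u0 - z) < \<rho>" "(\<Sum>i\<in>UNIV. u0 $ i) = (\<Sum>i\<in>UNIV. z $ i)" for u0
    using that(2) by (intro local_exponential_stability[OF \<rho>(1,3) L tangent \<rho>(2) dissip that(1)])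
      (auto simp: inner_vec_def sum_subtractf)
  then show ?thesis using \<rho>(1) by blast
qed

lemma global_exponential_convergence_calabi:
  "global_exponential_convergence (calabi_field F I r Kbar) \<Omega> u0 z
    \<longleftrightarrow> global_exponential_convergence (fractional_calabi_field F I r 1 Kbar) \<Omega> u0 z"
  unfolding global_exponential_convergence_def exists_for_all_time_def flow_solution_calabi ..

end

theorem theorem1p9:
  fixes S :: "'s topology"
    and E F :: "'v::finite set set"
    and I :: "'v set \<Rightarrow> real"
    and r :: "'v \<Rightarrow> real"
    and Kbar :: "real^'v"
    and s :: real
  assumes "closed_surface S" and "connected_space S"
    and "triangulation_of S E F"
    and "\<forall>e\<in>E. I e > 1"
    and "\<forall>i. r i > 0"
    and "\<forall>i. Kbar $ i < 2 * pi"
    and "(\<Sum>i\<in>UNIV. Kbar $ i) = 2 * pi * euler_number E F"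
  shows
    "(\<forall>u0 \<in> admissible F I r. \<forall>u.
        (flow_solution (calabi_field F I r Kbar) (admissible F I r) {0..} u0 u \<or>
         flow_solution (fractional_calabi_field F I r s Kbar) (admissible F I r) {0..} u0 u) \<and>
        (\<exists>ulim \<in> admissible F I r. (u \<longlongrightarrow> ulim) at_top) \<longrightarrow>
        (\<exists>ubar \<in> admissible F I r. curvature F I r ubar = Kbar))
     \<and>
     (\<forall>ubar \<in> admissible F I r. curvature F I r ubar = Kbar \<longrightarrow>
        (\<exists>\<delta>>0. \<forall>u0. norm (u0 - ubar) < \<delta> \<and> (\<Sum>i\<in>UNIV. u0 $ i) = (\<Sum>i\<in>UNIV. ubar $ i) \<longrightarrow>
           global_exponential_convergence (calabi_field F I r Kbar) (admissible F I r) u0 ubar \<and>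
           global_exponential_convergence (fractional_calabi_field F I r s Kbar) (admissible F I r) u0 ubar))"
proof -
  have T: "\<forall>f\<in>F. card f = 3" "E = {e. card e = 2 \<and> (\<exists>f\<in>F. e \<subseteq> f)}" "\<Union>F = UNIV"
    "top_of_set (realization F) homeomorphic_space S"
    using assms(3) unfolding triangulation_of_def by auto
  have "connected_space (top_of_set (realization F))"
    using homeomorphic_connected_space[OF T(4)] assms(2) by simp
  then have "connectedin euclidean (realization F)" by (simp add: connectedin_def)
  then have conn: "connected (realization F)" by simp
  interpret circle_packing F I r
  proof
    show "card f = 3" if "f \<in> F" for f using T(1) that by blast
    show "0 < I e" if "f \<in> F" "e \<subseteq> f" "card e = 2" for f e
    proof -
      have "e \<in> E" using that T(2) by blast
      then show ?thesis using assms(4) by force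
    qed
    show "0 < r i" for i using assms(5) by blast
    show "A = UNIV" if "a \<in> A" "\<And>f. f \<in> F \<Longrightarrow> f \<subseteq> A \<or> f \<inter> A = {}" for a A
      by (rule connected_realization_faces[OF conn T(3) that(2,1)])
  qed
  have count: "real (card E) = 3 / 2 * real (card F)"
    using faces_edges_count[OF assms(1) T(4,1,2)] by linarith
  \<comment> \<open>With \<open>3 |F| = 2 |E|\<close> the total curvature
    \<open>2 pi N - pi |F|\<close> is \<open>2 pi\<close> times the Euler number.\<close>
  then have gauss_bonnet: "(\<Sum>i\<in>UNIV. Kbar $ i) = (\<Sum>i\<in>UNIV. curvature F I r u $ i)" if "u \<in> \<Omega>" for u
    using assms(7) unfolding curvature_sum[OF that] euler_number_def count by (simp add: algebra_simps)
  show ?thesis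
  proof (intro conjI ballI allI impI)
    fix u0 u
    assume "(flow_solution (calabi_field F I r Kbar) \<Omega> {0..} u0 u \<or>
         flow_solution (fractional_calabi_field F I r s Kbar) \<Omega> {0..} u0 u) \<and>
        (\<exists>ulim \<in> \<Omega>. (u \<longlongrightarrow> ulim) at_top)"
    \<comment> \<open>\<open>s'\<close> is 1 for the Calabi flow and \<open>s\<close> for the
      fractional one.\<close>
    then obtain s' l where "flow_solution (fractional_calabi_field F I r s' Kbar) \<Omega> {0..} u0 u"
      "l \<in> \<Omega>" "(u \<longlongrightarrow> l) at_top"
      unfolding flow_solution_calabi by blast
    then show "\<exists>ubar \<in> \<Omega>. curvature F I r ubar = Kbar"
      using flow_limit_curvature gauss_bonnet by blast
  next
    fix ubar assume ubar: "ubar \<in> \<Omega>" "curvature F I r ubar = Kbar"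
    obtain \<delta>1 \<delta>2 where "0 < \<delta>1" "0 < \<delta>2"
      and \<delta>: "\<And>u0. norm (u0 - ubar) < \<delta>1 \<Longrightarrow> (\<Sum>i\<in>UNIV. u0 $ i) = (\<Sum>i\<in>UNIV. ubar $ i) \<Longrightarrow>
          global_exponential_convergence (fractional_calabi_field F I r 1 Kbar) \<Omega> u0 ubar"
        "\<And>u0. norm (u0 - ubar) < \<delta>2 \<Longrightarrow> (\<Sum>i\<in>UNIV. u0 $ i) = (\<Sum>i\<in>UNIV. ubar $ i) \<Longrightarrow>
          global_exponential_convergence (fractional_calabi_field F I r s Kbar) \<Omega> u0 ubar"
      using local_convergence[OF ubar, of 1] local_convergence[OF ubar, of s] by metis
    then show "\<exists>\<delta>>0. \<forall>u0. norm (u0 - ubar) < \<delta> \<and> (\<Sum>i\<in>UNIV. u0 $ i) = (\<Sum>i\<in>UNIV. ubar $ i) \<longrightarrow>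
           global_exponential_convergence (calabi_field F I r Kbar) \<Omega> u0 ubar \<and>
           global_exponential_convergence (fractional_calabi_field F I r s Kbar) \<Omega> u0 ubar"
      unfolding global_exponential_convergence_calabi by (intro exI[of _ "min \<delta>1 \<delta>2"]) auto
  qed
qed

end
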